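(* There is an algorithm that is FPT w.r.t. $(\overline{W},\alpha)$ for the unit-length \textsc{Spanner} problem: given a connected undirected graph $G=(V,E)$ with $n=|V|$, $m=|E|$, edge weights $w\colon E\to\mathbb{N}_{\ge0}$, unit edge lengths $\ell(e)=1$ for all $e\in E$, a stretch factor $\alpha\ge 1$ and $\overline{W}\in\mathbb{N}$, the algorithm decides whether $G$ has an $\alpha$-spanner $H=(V,F)$ with $w(E\setminus F)\ge\overline{W}$, and returns such a witness $H$ if it exists, in $$\mathcal{O}\big(\overline{W}^{\,2\overline{W}+1}\alpha^{2\overline{W}}\cdot m+nm\big)$$ time.
   Context: For a subgraph $G'\subseteq G$ and $u,v\in V$, $\ell_{G'}[u,v]$ is the length of a shortest $u$-$v$-path in $G'$ w.r.t. $\ell$. A subgraph $H=(V,F)$, $F\subseteq E$, is an $\alpha$-spanner of $G$ if $\ell_H[u,v]\le\alpha\,\ell_G[u,v]$ for all $u,v\in V$; equivalently, for all $\{u,v\}\in E$. For a set $X$ of edges, $w(X)=\sum_{e\in X}w(e)$. An algorithm is FPT w.r.t. a (possibly combined) parameter $k$ if on instance $I$ it runs in $\mathcal{O}(f(k)\cdot p(\langle I\rangle))$ time for a computable function $f$ and a polynomial $p$ in the encoding length $\langle I\rangle$. *)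

theory Defs
  imports
    "HOL-Analysis.Analysis"
    "HOL-Library.Log_Nat"
    "HOL-Computational_Algebra.Polynomial"
begin

section \<open>Random access machine programs with uniform cost\<close>

text \<open>
  The model is the uniform-cost RAM with additive arithmetic (addition and truncated
  subtraction, no multiplication) and indirect addressing, presented as a structured language.
  The memory is split into named banks of cells holding natural numbers; the cell
  \<open>0\<close> of a bank can serve as a scalar variable. A program mentions only finitely many banks, so
  interleaving them in a single memory, and compiling the control structures to jumps, changes
  running times by a constant factor only. Leaving multiplication out keeps the bit lengths of the
  values after \<open>t\<close> steps linear in \<open>t\<close> plus the input length, so that unit costs are polynomially
  related to Turing machine time.
\<close>

type_synonym bank = string
type_synonym state = "bank \<Rightarrow> nat \<Rightarrow> nat"

datatype aexp = Const nat | Cell bank aexp | Plus aexp aexp | Minus aexp aexp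

datatype bexp = Less aexp aexp | Neg bexp | Conj bexp bexp

datatype com =
    Skip
  | Assign bank aexp aexp
  | Seq com com
  | Cond bexp com com
  | While bexp com

fun aval :: "aexp \<Rightarrow> state \<Rightarrow> nat" where
  "aval (Const k) s = k"
| "aval (Cell x a) s = s x (aval a s)"
| "aval (Plus a b) s = aval a s + aval b s"
| "aval (Minus a b) s = aval a s - aval b s"

fun bval :: "bexp \<Rightarrow> state \<Rightarrow> bool" where
  "bval (Less a b) s \<longleftrightarrow> aval a s < aval b s"
| "bval (Neg b) s \<longleftrightarrow> \<not> bval b s"
| "bval (Conj b c) s \<longleftrightarrow> bval b s \<and> bval c s"

fun acost :: "aexp \<Rightarrow> nat" where
  "acost (Const k) = 1"
| "acost (Cell x a) = acost a + 1"
| "acost (Plus a b) = acost a + acost b + 1"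
| "acost (Minus a b) = acost a + acost b + 1"

fun bcost :: "bexp \<Rightarrow> nat" where
  "bcost (Less a b) = acost a + acost b + 1"
| "bcost (Neg b) = bcost b + 1"
| "bcost (Conj b c) = bcost b + bcost c + 1"

text \<open>
  \<open>exec c s t s'\<close>: started in \<open>s\<close>, program \<open>c\<close> halts in \<open>s'\<close> after exactly \<open>t\<close> time units.
  \<open>Assign x a e\<close> writes the value of \<open>e\<close> to the cell of bank \<open>x\<close> with address \<open>a\<close>.
\<close>

inductive exec :: "com \<Rightarrow> state \<Rightarrow> nat \<Rightarrow> state \<Rightarrow> bool" where
  Skip: "exec Skip s 1 s"
| Assign: "exec (Assign x a e) s (acost a + acost e + 1)
     (s(x := (s x)(aval a s := aval e s)))"
| Seq: "exec c s t s' \<Longrightarrow> exec d s' t' s'' \<Longrightarrow> exec (Seq c d) s (t + t') s''"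
| IfTrue: "bval b s \<Longrightarrow> exec c s t s' \<Longrightarrow> exec (Cond b c d) s (bcost b + t + 1) s'"
| IfFalse: "\<not> bval b s \<Longrightarrow> exec d s t s' \<Longrightarrow> exec (Cond b c d) s (bcost b + t + 1) s'"
| WhileFalse: "\<not> bval b s \<Longrightarrow> exec (While b c) s (bcost b + 1) s"
| WhileTrue: "bval b s \<Longrightarrow> exec c s t s' \<Longrightarrow> exec (While b c) s' t' s''
     \<Longrightarrow> exec (While b c) s (bcost b + t + t' + 1) s''"

text \<open>The final state and the running time are functions of the program and the initial state.\<close>

lemma exec_deterministic:
  assumes "exec c s t s'" "exec c s u s''"
  shows "u = t \<and> s'' = s'"
  using assms
proof (induction arbitrary: u s'' rule: exec.induct)
  case (Skip s)
  from Skip.prems show ?case by cases auto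
next
  case (Assign x a e s)
  from Assign.prems show ?case by cases auto
next
  case (Seq c s t s' d t' s2)
  from Seq.prems show ?case by cases (auto dest: Seq.IH)
next
  case (IfTrue b s c t s' d)
  from IfTrue.prems IfTrue.hyps show ?case by cases (auto dest: IfTrue.IH)
next
  case (IfFalse b s d t s' c)
  from IfFalse.prems IfFalse.hyps show ?case by cases (auto dest: IfFalse.IH)
next
  case (WhileFalse b s c)
  from WhileFalse.prems WhileFalse.hyps show ?case by cases auto
next
  case (WhileTrue b s c t s1 t' s2)
  from WhileTrue.prems WhileTrue.hyps(1) show ?case
    by cases (auto dest: WhileTrue.IH)
qed

text \<open>
  Inputs and outputs are lists of numbers, stored with the length in cell \<open>0\<close> of the
  respective bank and the elements in the cells after it. All other cells are initially \<open>0\<close>.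
\<close>

definition input_state :: "nat list \<Rightarrow> state" where
  "input_state xs =
     (\<lambda>x i. if x = ''in'' \<and> i \<le> length xs then (length xs # xs) ! i else 0)"

definition output_of :: "state \<Rightarrow> nat list" where
  "output_of s = map (\<lambda>i. s ''out'' (Suc i)) [0..<s ''out'' 0]"

definition runs :: "com \<Rightarrow> nat list \<Rightarrow> nat \<Rightarrow> nat list \<Rightarrow> bool" where
  "runs c xs t ys \<longleftrightarrow> (\<exists>s. exec c (input_state xs) t s \<and> output_of s = ys)"

definition computable :: "(nat list \<Rightarrow> nat) \<Rightarrow> bool" where
  "computable f \<longleftrightarrow> (\<exists>c. \<forall>xs. \<exists>t. runs c xs t [f xs])"


section \<open>Fixed-parameter tractability\<close>

text \<open>Length in bits, one additional symbol per number serving as a delimiter.\<close>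

definition encoding_length :: "nat list \<Rightarrow> nat" where
  "encoding_length xs = (\<Sum>x\<leftarrow>xs. floorlog 2 x + 1)"

definition fpt :: "'i set \<Rightarrow> ('i \<Rightarrow> nat list) \<Rightarrow> ('i \<Rightarrow> nat list) \<Rightarrow> com \<Rightarrow> bool" where
  "fpt Insts enc param c \<longleftrightarrow>
     (\<exists>f (p :: nat poly) C. computable f \<and>
        (\<forall>I\<in>Insts. \<exists>t ys. runs c (enc I) t ys \<and>
           t \<le> C * (f (param I) * poly p (encoding_length (enc I)))))"


section \<open>Undirected graphs, shortest paths and spanners\<close>

definition simple_graph :: "'v set \<Rightarrow> 'v set set \<Rightarrow> bool" where
  "simple_graph V E \<longleftrightarrow> finite V \<and> (\<forall>e\<in>E. e \<subseteq> V \<and> card e = 2)"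

fun path_edges :: "'v list \<Rightarrow> 'v set list" where
  "path_edges (u # v # p) = {u, v} # path_edges (v # p)"
| "path_edges _ = []"

definition is_path :: "'v set \<Rightarrow> 'v set set \<Rightarrow> 'v \<Rightarrow> 'v list \<Rightarrow> 'v \<Rightarrow> bool" where
  "is_path V E u p v \<longleftrightarrow>
     p \<noteq> [] \<and> hd p = u \<and> last p = v \<and> distinct p \<and> set p \<subseteq> V \<and> set (path_edges p) \<subseteq> E"

definition connected_graph :: "'v set \<Rightarrow> 'v set set \<Rightarrow> bool" where
  "connected_graph V E \<longleftrightarrow> (\<forall>u\<in>V. \<forall>v\<in>V. \<exists>p. is_path V E u p v)"

definition path_length :: "('v set \<Rightarrow> real) \<Rightarrow> 'v list \<Rightarrow> real" where
  "path_length l p = (\<Sum>e\<leftarrow>path_edges p. l e)"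

text \<open>In a finite graph the infimum is a minimum; it is \<open>\<infinity>\<close> if there is no path.\<close>

definition sp_dist :: "'v set \<Rightarrow> 'v set set \<Rightarrow> ('v set \<Rightarrow> real) \<Rightarrow> 'v \<Rightarrow> 'v \<Rightarrow> ereal" where
  "sp_dist V E l u v = (INF p\<in>{p. is_path V E u p v}. ereal (path_length l p))"

definition spanner ::
  "'v set \<Rightarrow> 'v set set \<Rightarrow> ('v set \<Rightarrow> real) \<Rightarrow> real \<Rightarrow> 'v set set \<Rightarrow> bool" where
  "spanner V E l \<alpha> F \<longleftrightarrow>
     F \<subseteq> E \<and> (\<forall>u\<in>V. \<forall>v\<in>V. sp_dist V F l u v \<le> ereal \<alpha> * sp_dist V E l u v)"


section \<open>The unit-length spanner problem\<close>

text \<open>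
  The vertices of an input graph are numbered \<open>0, \<dots>, n - 1\<close>, and its edges are listed in an
  arbitrary order, each of them once and in an arbitrary orientation. Only the values of
  \<open>weight\<close> on edges of the graph matter. The stretch factor is rational in order to be
  finitely encodable.
\<close>

record spanner_input =
  vertex_count :: nat
  edge_list :: "(nat \<times> nat) list"
  weight :: "nat set \<Rightarrow> nat"
  stretch :: rat
  target :: nat

definition verts :: "spanner_input \<Rightarrow> nat set" where
  "verts I = {..<vertex_count I}"

definition edge_at :: "spanner_input \<Rightarrow> nat \<Rightarrow> nat set" where
  "edge_at I j = (case edge_list I ! j of (u, v) \<Rightarrow> {u, v})"

definition edges :: "spanner_input \<Rightarrow> nat set set" where
  "edges I = edge_at I ` {..<length (edge_list I)}"

definition unit_spanner_inputs :: "spanner_input set" where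
  "unit_spanner_inputs =
     {I. simple_graph (verts I) (edges I) \<and> connected_graph (verts I) (edges I) \<and>
         inj_on (edge_at I) {..<length (edge_list I)} \<and> 1 \<le> stretch I}"

definition unit_spanner_solution :: "spanner_input \<Rightarrow> nat set set \<Rightarrow> bool" where
  "unit_spanner_solution I F \<longleftrightarrow>
     spanner (verts I) (edges I) (\<lambda>_. 1) (of_rat (stretch I)) F \<and>
     target I \<le> (\<Sum>e\<in>edges I - F. weight I e)"

definition encode_stretch :: "rat \<Rightarrow> nat list" where
  "encode_stretch \<alpha> = (case quotient_of \<alpha> of (a, b) \<Rightarrow> [nat a, nat b])"

definition encode_input :: "spanner_input \<Rightarrow> nat list" where
  "encode_input I =
     [vertex_count I, length (edge_list I), target I] @ encode_stretch (stretch I) @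
     concat (map (\<lambda>(u, v). [u, v, weight I {u, v}]) (edge_list I))"

definition parameters :: "spanner_input \<Rightarrow> nat list" where
  "parameters I = target I # encode_stretch (stretch I)"

text \<open>
  A negative answer is \<open>[0]\<close>; a positive one is \<open>1\<close> followed by the positions, in the edge list of
  the input, of the edges of a witness.
\<close>

definition unit_spanner_answer :: "spanner_input \<Rightarrow> nat list \<Rightarrow> bool" where
  "unit_spanner_answer I ys \<longleftrightarrow>
     (ys = [0] \<and> (\<nexists>F. unit_spanner_solution I F)) \<or>
     (\<exists>js. ys = 1 # js \<and> distinct js \<and> set js \<subseteq> {..<length (edge_list I)} \<and>
           unit_spanner_solution I (edge_at I ` set js))"

text \<open>
  For a graph without edges the expression below would be \<open>0\<close>, although every program takes some
  time to halt; on all other connected graphs it is at least \<open>1\<close>, so there the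
  maximum has no effect.
\<close>

definition unit_spanner_bound :: "spanner_input \<Rightarrow> real" where
  "unit_spanner_bound I =
     (let n = real (card (verts I)); m = real (card (edges I));
          W = target I; \<alpha> = real_of_rat (stretch I)
      in max 1 (real W ^ (2 * W + 1) * \<alpha> ^ (2 * W) * m + n * m))"

end

theory Submission
  imports Defs
begin

text \<open>
  With unit lengths, \<open>F\<close> is a spanner iff the ends of every edge outside \<open>F\<close> are joined in \<open>F\<close> by a
  walk of at most \<open>a = \<lfloor>\<alpha>\<rfloor>\<close> edges. Hence only removable edges matter: those of positive weight whose
  ends are joined by such a walk in the graph without the edge. They are found in time \<open>O(n m)\<close> by one
  breadth-first search per vertex \<open>u\<close> that labels every vertex with the child of \<open>u\<close> above it.

  Fix such a walk for every removable edge. Each walk uses at most \<open>a\<close> edges, so among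
  \<open>W (2 a + 1)\<close> removable edges there are \<open>W\<close> none of which lies on the walk of another, by greedy
  choice of an edge lying on at most \<open>a\<close> of the walks. These \<open>W\<close> edges can be deleted together. So it
  suffices to collect up to \<open>W (2 a + 1)\<close> removable edges and to try all \<open>W\<close>-tuples of
  them: if the collection is full, a solution is among the tuples; otherwise the collection contains
  all removable edges, and at most \<open>W\<close> of the edges outside a solution already have weight \<open>W\<close>. A tuple
  is checked by \<open>W\<close> breadth-first searches.
\<close>

section \<open>Total correctness with running time\<close>

text \<open>A separate search for every edge would cost on the order of \<open>m * m\<close>, beyond
  the \<open>n * m\<close> allowed; the labelling by children lets one search decide all edges at
  its root. The number of candidates must not grow with the graph, or the number of tuples would not
  depend on \<open>W\<close> and \<open>a\<close> alone. The cut-off \<open>W * (2 * a + 1)\<close>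
  ensures this, and positive weights make any \<open>W\<close> removable edges heavy enough.
  Checking a tuple takes time \<open>O(W m)\<close> because \<open>n \<le> m + 1\<close> in a
  connected graph.

  The machine has neither multiplication nor division, so \<open>a\<close> and the cut-off come from
  loops of \<open>a\<close> and \<open>W\<close> rounds. The claimed time has room for these loops
  only if \<open>W\<close> and \<open>m\<close> are positive: for \<open>W = 0\<close> its first
  summand vanishes, and for \<open>m = 0\<close> it is constant. These two cases are therefore
  answered at once.\<close>

definition run :: "com \<Rightarrow> state \<Rightarrow> nat \<Rightarrow> (state \<Rightarrow> bool) \<Rightarrow> bool" where
  "run c s T Q \<longleftrightarrow> (\<exists>t s'. exec c s t s' \<and> t \<le> T \<and> Q s')"

fun written :: "com \<Rightarrow> bank set" where
  "written Skip = {}"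
| "written (Assign x a e) = {x}"
| "written (Seq c d) = written c \<union> written d"
| "written (Cond b c d) = written c \<union> written d"
| "written (While b c) = written c"

lemma exec_frame: "exec c s t s' \<Longrightarrow> x \<notin> written c \<Longrightarrow> s' x = s x"
  by (induction rule: exec.induct) auto

text \<open>The new postcondition may use that all banks outside \<open>written c\<close> keep their
  contents; \<open>run_Seq\<close> passes on the same facts. Specifications of subprograms can thus
  concentrate on what is changed.\<close>

lemma run_mono:
  assumes "run c s T Q" "T \<le> T'" "\<And>s'. Q s' \<Longrightarrow> (\<And>x. x \<notin> written c \<Longrightarrow> s' x = s x) \<Longrightarrow> Q' s'"
  shows "run c s T' Q'"
  using assms exec_frame unfolding run_def by (meson le_trans)

lemma run_Seq:
  assumes "run c s T Q" "\<And>s'. Q s' \<Longrightarrow> (\<And>x. x \<notin> written c \<Longrightarrow> s' x = s x) \<Longrightarrow> run d s' U R"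
    "T + U \<le> T'"
  shows "run (Seq c d) s T' R"
proof -
  obtain t s' where 1: "exec c s t s'" "t \<le> T" "Q s'"
    using assms(1) unfolding run_def by blast
  then obtain u s'' where 2: "exec d s' u s''" "u \<le> U" "R s''"
    using assms(2)[of s'] exec_frame unfolding run_def by blast
  then show ?thesis
    using exec.Seq[OF 1(1) 2(1)] 1(2) assms(3) unfolding run_def by fastforce
qed

lemma run_Cond:
  assumes "bval b s \<Longrightarrow> run c s T Q" "\<not> bval b s \<Longrightarrow> run d s T Q" "bcost b + T + 1 \<le> T'"
  shows "run (Cond b c d) s T' Q"
proof (cases "bval b s")
  case True
  then obtain t s' where "exec c s t s'" "t \<le> T" "Q s'"
    using assms(1) unfolding run_def by blast
  then show ?thesis
    using exec.IfTrue[OF True] assms(3) unfolding run_def by fastforce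
next
  case False
  then obtain t s' where "exec d s t s'" "t \<le> T" "Q s'"
    using assms(2) unfolding run_def by blast
  then show ?thesis
    using exec.IfFalse[OF False] assms(3) unfolding run_def by fastforce
qed

text \<open>\<open>k\<close> is a variant bounding the number of remaining iterations. It may fall
  by more than one, which lets a search that has finished early jump to 0.\<close>

lemma run_While:
  assumes "\<And>k s. I k s \<Longrightarrow> bval b s \<Longrightarrow> run c s B (\<lambda>s'. \<exists>k'<k. I k' s')"
    and "\<And>k s. I k s \<Longrightarrow> \<not> bval b s \<Longrightarrow> Q s"
    and "I k s" "k * (B + bcost b + 1) + bcost b + 1 \<le> T"
  shows "run (While b c) s T Q"
proof -
  have "run (While b c) s (k * (B + bcost b + 1) + bcost b + 1) Q" using assms(3)
  proof (induction k arbitrary: s rule: less_induct)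
    case (less k)
    show ?case
    proof (cases "bval b s")
      case True
      then obtain t s' k' where 1: "exec c s t s'" "t \<le> B" "k' < k" "I k' s'"
        using assms(1)[OF less.prems] unfolding run_def by blast
      then obtain u s'' where 2: "exec (While b c) s' u s''"
          "u \<le> k' * (B + bcost b + 1) + bcost b + 1" "Q s''"
        using less.IH unfolding run_def by blast
      have "Suc k' * (B + bcost b + 1) \<le> k * (B + bcost b + 1)"
        using 1(3) by (intro mult_right_mono) auto
      then have "bcost b + t + u + 1 \<le> k * (B + bcost b + 1) + bcost b + 1"
        using 1(2) 2(2) by simp
      then show ?thesis
        using exec.WhileTrue[OF True 1(1) 2(1)] 2(3) unfolding run_def by blast
    next
      case False
      then show ?thesis
        using exec.WhileFalse[OF False] assms(2)[OF less.prems] unfolding run_def by fastforce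
    qed
  qed
  then show ?thesis using assms(4) by (rule run_mono)
qed

text \<open>A constant of its own, because rules such as \<open>has_input_upd\<close> and
  \<open>ready_upd\<close> need a symbol to match on; \<open>eff\<close> produces states in this
  form.\<close>

definition upd :: "state \<Rightarrow> bank \<Rightarrow> nat \<Rightarrow> nat \<Rightarrow> state" where
  "upd s x i v = s(x := (s x)(i := v))"

lemma upd_apply [simp]: "upd s x i v y = (if y = x then (s x)(i := v) else s y)"
  by (simp add: upd_def)

section \<open>Loop-free programs by symbolic evaluation\<close>

fun straight :: "com \<Rightarrow> bool" where
  "straight (Seq c d) \<longleftrightarrow> straight c \<and> straight d"
| "straight (Cond b c d) \<longleftrightarrow> straight c \<and> straight d"
| "straight (While b c) \<longleftrightarrow> False"
| "straight c \<longleftrightarrow> True"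

text \<open>For loops the last clause gives a dummy value, as does that of \<open>ccost\<close>;
  \<open>run_straight\<close> admits no loops.\<close>

fun eff :: "com \<Rightarrow> state \<Rightarrow> state" where
  "eff (Assign x a e) s = upd s x (aval a s) (aval e s)"
| "eff (Seq c d) s = eff d (eff c s)"
| "eff (Cond b c d) s = (if bval b s then eff c s else eff d s)"
| "eff c s = s"

fun ccost :: "com \<Rightarrow> nat" where
  "ccost (Assign x a e) = acost a + acost e + 1"
| "ccost (Seq c d) = ccost c + ccost d"
| "ccost (Cond b c d) = bcost b + max (ccost c) (ccost d) + 1"
| "ccost c = 1"

lemma run_straight:
  assumes "straight c" "ccost c \<le> T" "Q (eff c s)"
  shows "run c s T Q"
proof -
  have "run c s (ccost c) (\<lambda>s'. s' = eff c s)" using assms(1)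
  proof (induction c arbitrary: s)
    case Skip
    then show ?case using exec.Skip unfolding run_def by fastforce
  next
    case (Assign x a e)
    then show ?case using exec.Assign[of x a e s] unfolding run_def upd_def by fastforce
  next
    case (Seq c d)
    then show ?case by (intro run_Seq[OF Seq.IH(1)]) auto
  next
    case (Cond b c d)
    then have 1: "run c s (ccost c) (\<lambda>s'. s' = eff c s)" "run d s (ccost d) (\<lambda>s'. s' = eff d s)"
      by auto
    show ?case
      by (rule run_Cond[where T="max (ccost c) (ccost d)"])
        (auto intro: run_mono[OF 1(1)] run_mono[OF 1(2)])
  qed simp
  then show ?thesis using assms(2,3) by (auto elim: run_mono)
qed

section \<open>Counting loops\<close>

abbreviation seq :: "com \<Rightarrow> com \<Rightarrow> com" (infixr ";;" 60) where
  "c ;; d \<equiv> Seq c d"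

abbreviation Var :: "bank \<Rightarrow> aexp" where
  "Var x \<equiv> Cell x (Const 0)"

abbreviation Set :: "bank \<Rightarrow> aexp \<Rightarrow> com" (infix "::=" 61) where
  "x ::= e \<equiv> Assign x (Const 0) e"

abbreviation Inc :: "bank \<Rightarrow> com" where
  "Inc x \<equiv> x ::= Plus (Var x) (Const 1)"

abbreviation Pos :: "aexp \<Rightarrow> bexp" where
  "Pos a \<equiv> Less (Const 0) a"

definition For :: "bank \<Rightarrow> aexp \<Rightarrow> com \<Rightarrow> com" where
  "For x l c = (x ::= Const 0 ;; While (Less (Var x) l) (c ;; Inc x))"

lemma written_For [simp]: "written (For x l c) = insert x (written c)"
  by (auto simp: For_def)

text \<open>The limit \<open>l\<close> is evaluated anew before every round, hence
  \<open>lim\<close>. Each round pays 6 for \<open>Inc x\<close> and \<open>acost l + 4\<close> for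
  the test, together the 10; the 7 is the initial assignment (3) plus the last test (4 besides
  \<open>acost l\<close>).\<close>

lemma run_For:
  assumes init: "I 0 (upd s x 0 0)"
    and step: "\<And>k s. k < N \<Longrightarrow> s x 0 = k \<Longrightarrow> I k s \<Longrightarrow>
      run c s B (\<lambda>s'. s' x 0 = k \<and> I (Suc k) (upd s' x 0 (Suc k)))"
    and lim: "\<And>k s. k \<le> N \<Longrightarrow> I k s \<Longrightarrow> aval l s = N"
    and final: "\<And>s'. s' x 0 = N \<Longrightarrow> I N s' \<Longrightarrow> Q s'"
    and time: "N * (B + acost l + 10) + acost l + 7 \<le> T"
  shows "run (For x l c) s T Q"
  unfolding For_def
proof (rule run_Seq[where T=3 and Q="\<lambda>s'. s' = upd s x 0 0"])
  show "run (x ::= Const 0) s 3 (\<lambda>s'. s' = upd s x 0 0)"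
    by (rule run_straight) auto
next
  fix s' assume s': "s' = upd s x 0 0"
  show "run (While (Less (Var x) l) (c ;; Inc x)) s' (N * (B + acost l + 10) + acost l + 4) Q"
  \<comment> \<open>The variant counts the remaining rounds, so the loop counter is
    \<open>N - j\<close>.\<close>
  proof (rule run_While[where k=N and B="B+6"
        and I="\<lambda>j s. j \<le> N \<and> s x 0 = N - j \<and> I (N - j) s"])
    fix k s assume a: "k \<le> N \<and> s x 0 = N - k \<and> I (N - k) s" "bval (Less (Var x) l) s"
    then have k: "0 < k" using lim[of "N-k" s] by auto
    have *: "Suc (N - k) = N - (k - 1)" using k a by auto
    show "run (c ;; Inc x) s (B + 6) (\<lambda>s'. \<exists>k'<k. k' \<le> N \<and> s' x 0 = N - k' \<and> I (N - k') s')"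
    proof (rule run_Seq[OF step[of "N-k"], where U=6])
      fix s' assume s': "s' x 0 = N - k \<and> I (Suc (N - k)) (upd s' x 0 (Suc (N - k)))"
      show "run (Inc x) s' 6 (\<lambda>s'. \<exists>k'<k. k' \<le> N \<and> s' x 0 = N - k' \<and> I (N - k') s')"
        by (rule run_straight) (use s' k a in \<open>auto simp: * intro!: exI[of _ "k-1"]\<close>)
    qed (use k a in auto)
  next
    fix k s assume a: "k \<le> N \<and> s x 0 = N - k \<and> I (N - k) s" "\<not> bval (Less (Var x) l) s"
    then have "k = 0" using lim[of "N-k" s] by auto
    then show "Q s" using a final by auto
  qed (use init s' in \<open>auto simp: algebra_simps\<close>)
qed (use time in auto)

section \<open>Bounded walks and spanners\<close>

text \<open>Walks of at most \<open>k\<close> edges rather than simple paths: they can be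
  concatenated and reversed without removing repeated vertices.\<close>

primrec reach :: "'v set set \<Rightarrow> nat \<Rightarrow> 'v \<Rightarrow> 'v \<Rightarrow> bool" where
  "reach F 0 u v \<longleftrightarrow> u = v"
| "reach F (Suc k) u v \<longleftrightarrow> reach F k u v \<or> (\<exists>x. reach F k u x \<and> {x, v} \<in> F)"

lemma reach_refl [simp]: "reach F k u u"
  by (induction k) auto

lemma reach_edge: "{u, v} \<in> F \<Longrightarrow> reach F (Suc 0) u v"
  by auto

lemma reach_le: "reach F k u v \<Longrightarrow> k \<le> l \<Longrightarrow> reach F l u v"
  by (induction l) (auto simp: le_Suc_eq)

lemma reach_subset: "reach F k u v \<Longrightarrow> F \<subseteq> F' \<Longrightarrow> reach F' k u v"
proof (induction k arbitrary: v)
  case (Suc k)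
  then show ?case by (metis reach.simps(2) subsetD)
qed simp

lemma reach_trans: "reach F l v w \<Longrightarrow> reach F k u v \<Longrightarrow> reach F (k + l) u w"
  by (induction l arbitrary: w) auto

lemma reach_sym: "reach F k u v \<Longrightarrow> reach F k v u"
proof (induction k arbitrary: v)
  case (Suc k)
  show ?case
  proof (cases "reach F k u v")
    case True
    then show ?thesis using Suc.IH by simp
  next
    case False
    then obtain x where "reach F k u x" "{x, v} \<in> F" using Suc.prems by auto
    then have "reach F (1 + k) v u"
      using Suc.IH[of x] by (intro reach_trans[of F k x u 1 v]) (auto simp: insert_commute)
    then show ?thesis by simp
  qed
qed auto

text \<open>Supplies the conflict sets: the walk of a removable edge survives any deletion that
  spares \<open>P\<close>.\<close>

lemma reach_support:
  assumes "reach F k u v"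
  shows "\<exists>P\<subseteq>F. finite P \<and> card P \<le> k \<and> reach P k u v"
  using assms
proof (induction k arbitrary: v)
  case 0
  then show ?case by (intro exI[of _ "{}"]) auto
next
  case (Suc k)
  show ?case
  proof (cases "reach F k u v")
    case True
    then show ?thesis using Suc.IH[of v] by (meson le_SucI reach.simps(2))
  next
    case False
    then obtain x where x: "reach F k u x" "{x, v} \<in> F" using Suc.prems by auto
    then obtain P where P: "P \<subseteq> F" "finite P" "card P \<le> k" "reach P k u x"
      using Suc.IH[of x] by blast
    have "reach (insert {x, v} P) (Suc k) u v"
      using reach_subset[OF P(4), of "insert {x, v} P"] by auto
    then show ?thesis
      using P x(2) by (intro exI[of _ "insert {x, v} P"]) (auto simp: card_insert_if)
  qed
qed

section \<open>Bounded walks and shortest paths\<close>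

lemma path_edges_snoc: "p \<noteq> [] \<Longrightarrow> path_edges (p @ [v]) = path_edges p @ [{last p, v}]"
  by (induction p rule: path_edges.induct) auto

lemma path_edges_append_subset: "set (path_edges p) \<subseteq> set (path_edges (p @ q))"
  by (induction p rule: path_edges.induct) auto

lemma length_path_edges: "length (path_edges p) = length p - 1"
  by (induction p rule: path_edges.induct) auto

lemma path_length_unit: "path_length (\<lambda>_. 1) p = real (length p - 1)"
  by (simp add: path_length_def sum_list_triv length_path_edges)

lemma reach_imp_path:
  assumes "simple_graph V F" "u \<in> V" "reach F k u v"
  shows "\<exists>p. is_path V F u p v \<and> length p \<le> Suc k"
  using assms(3)
proof (induction k arbitrary: v)
  case 0
  then show ?case using assms(2) by (intro exI[of _ "[u]"]) (auto simp: is_path_def)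
next
  case (Suc k)
  show ?case
  proof (cases "reach F k u v")
    case True
    then show ?thesis using Suc.IH by (meson le_SucI)
  next
    case False
    then obtain x where x: "reach F k u x" "{x, v} \<in> F" using Suc.prems by auto
    then obtain p where p: "is_path V F u p x" "length p \<le> Suc k" using Suc.IH by blast
    have v: "v \<in> V" using x(2) assms(1) by (auto simp: simple_graph_def)
    show ?thesis
    proof (cases "v \<in> set p")
      case False
      then show ?thesis using p x v
        by (intro exI[of _ "p @ [v]"]) (auto simp: is_path_def path_edges_snoc)
    next
      \<comment> \<open>The walk returns to a vertex of the path built so far; cutting the path
        there only shortens it.\<close>
      case True
      then obtain as bs where s: "p = (as @ [v]) @ bs" by (metis split_list append_Cons append.assoc append_Nil)
      then have "set (path_edges (as @ [v])) \<subseteq> F"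
        using p(1) path_edges_append_subset unfolding is_path_def by (metis order_trans)
      then have "is_path V F u (as @ [v]) v"
        using p(1) unfolding is_path_def s by (auto simp: hd_append split: if_splits)
      then show ?thesis using p(2) s by (intro exI[of _ "as @ [v]"]) auto
    qed
  qed
qed

lemma path_imp_reach: "is_path V F u p v \<Longrightarrow> reach F (length p - 1) u v"
proof (induction p arbitrary: v rule: rev_induct)
  case (snoc x p)
  show ?case
  proof (cases "p = []")
    case True
    then show ?thesis using snoc.prems by (auto simp: is_path_def)
  next
    case False
    then have "is_path V F u p (last p)" "{last p, v} \<in> F" "x = v"
      using snoc.prems by (auto simp: is_path_def path_edges_snoc hd_append)
    moreover have "length (p @ [x]) - 1 = Suc (length p - 1)" using False by (cases p) auto
    ultimately show ?thesis using snoc.IH by (metis reach.simps(2))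
  qed
qed (auto simp: is_path_def)

lemma sp_dist_unit:
  assumes "simple_graph V F" "u \<in> V" "reach F k u v"
  shows "sp_dist V F (\<lambda>_. 1) u v = ereal (real (LEAST k. reach F k u v))"
proof -
  let ?k = "LEAST k. reach F k u v"
  have "reach F ?k u v" using assms(3) by (rule LeastI)
  then obtain p where p: "is_path V F u p v" "length p \<le> Suc ?k"
    using reach_imp_path[OF assms(1,2)] by blast
  show ?thesis
    unfolding sp_dist_def
  proof (rule antisym)
    show "(INF p\<in>{p. is_path V F u p v}. ereal (path_length (\<lambda>_. 1) p)) \<le> ereal (real ?k)"
      by (rule INF_lower2[of p]) (use p in \<open>auto simp: path_length_unit\<close>)
    show "ereal (real ?k) \<le> (INF p\<in>{p. is_path V F u p v}. ereal (path_length (\<lambda>_. 1) p))"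
      by (rule INF_greatest) (auto simp: path_length_unit intro!: Least_le dest: path_imp_reach)
  qed
qed

lemma sp_dist_no_path:
  assumes "\<not> (\<exists>k. reach F k u v)"
  shows "sp_dist V F l u v = \<infinity>"
proof -
  have "{p. is_path V F u p v} = {}" using assms path_imp_reach by fast
  then show ?thesis by (simp add: sp_dist_def top_ereal_def)
qed

text \<open>Unit-length distances are integers, so a real bound may be replaced by its floor;
  without any walk the distance is infinite and both sides are false.\<close>

lemma sp_dist_unit_le:
  assumes "simple_graph V F" "u \<in> V" "0 \<le> r"
  shows "sp_dist V F (\<lambda>_. 1) u v \<le> ereal r \<longleftrightarrow> reach F (nat \<lfloor>r\<rfloor>) u v"
proof (cases "\<exists>k. reach F k u v")
  case True
  then obtain k where k: "reach F k u v" by blast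
  have "real (LEAST k. reach F k u v) \<le> r \<longleftrightarrow> (LEAST k. reach F k u v) \<le> nat \<lfloor>r\<rfloor>"
    using le_nat_floor of_nat_floor[OF assms(3)] of_nat_mono order_trans by metis
  also have "\<dots> \<longleftrightarrow> reach F (nat \<lfloor>r\<rfloor>) u v"
    using LeastI[of "\<lambda>k. reach F k u v", OF k] reach_le Least_le[of "\<lambda>k. reach F k u v"] by metis
  finally show ?thesis using sp_dist_unit[OF assms(1,2) k] by simp
next
  case False
  then show ?thesis by (auto simp: sp_dist_no_path)
qed

lemma simple_graph_subset: "simple_graph V E \<Longrightarrow> F \<subseteq> E \<Longrightarrow> simple_graph V F"
  by (auto simp: simple_graph_def)

text \<open>The ends of an edge are at distance at most 1, so a spanner joins them within
  \<open>\<alpha>\<close>. Conversely, replacing every edge of a shortest walk with \<open>k\<close>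
  edges yields a walk of \<open>k * ?a\<close> edges, and
  \<open>k * ?a \<le> \<alpha> * k\<close>.\<close>

lemma spanner_unit_iff:
  assumes E: "simple_graph V E" "connected_graph V E" and F: "F \<subseteq> E" and \<alpha>: "1 \<le> \<alpha>"
  shows "spanner V E (\<lambda>_. 1) \<alpha> F \<longleftrightarrow> (\<forall>u v. {u, v} \<in> E - F \<longrightarrow> reach F (nat \<lfloor>\<alpha>\<rfloor>) u v)"
proof
  have sF: "simple_graph V F" using simple_graph_subset E(1) F by blast
  assume sp: "spanner V E (\<lambda>_. 1) \<alpha> F"
  show "\<forall>u v. {u, v} \<in> E - F \<longrightarrow> reach F (nat \<lfloor>\<alpha>\<rfloor>) u v"
  proof (intro allI impI)
    fix u v assume e: "{u, v} \<in> E - F"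
    then have uv: "u \<in> V" "v \<in> V" using E(1) by (auto simp: simple_graph_def)
    have "sp_dist V E (\<lambda>_. 1) u v \<le> ereal 1"
      using sp_dist_unit_le[OF E(1) uv(1), of 1 v] e reach_edge[of u v E] by auto
    then have "ereal \<alpha> * sp_dist V E (\<lambda>_. 1) u v \<le> ereal \<alpha> * ereal 1"
      using \<alpha> by (intro ereal_mult_left_mono) auto
    then have "sp_dist V F (\<lambda>_. 1) u v \<le> ereal \<alpha>"
      using sp uv unfolding spanner_def by fastforce
    then show "reach F (nat \<lfloor>\<alpha>\<rfloor>) u v"
      using sp_dist_unit_le[OF sF uv(1)] \<alpha> by simp
  qed
next
  have sF: "simple_graph V F" using simple_graph_subset E(1) F by blast
  assume w: "\<forall>u v. {u, v} \<in> E - F \<longrightarrow> reach F (nat \<lfloor>\<alpha>\<rfloor>) u v"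
  let ?a = "nat \<lfloor>\<alpha>\<rfloor>"
  have a: "1 \<le> ?a" "real ?a \<le> \<alpha>" using \<alpha> by (auto simp: le_nat_iff)
  have edge: "reach F ?a u v" if "{u, v} \<in> E" for u v
    using w that reach_le[OF reach_edge[of u v F]] a by (cases "{u, v} \<in> F") auto
  have stretched: "reach F (k * ?a) u v" if "reach E k u v" for k u v
    using that
  proof (induction k arbitrary: v)
    case (Suc k)
    show ?case
    proof (cases "reach E k u v")
      case True
      then show ?thesis using Suc.IH reach_le[of F "k * ?a"] by auto
    next
      case False
      then obtain x where "reach E k u x" "{x, v} \<in> E" using Suc.prems by auto
      then show ?thesis using reach_trans[OF edge Suc.IH, of x v] by (simp add: add.commute)
    qed
  qed simp
  show "spanner V E (\<lambda>_. 1) \<alpha> F"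
    unfolding spanner_def
  proof (intro conjI ballI)
    fix u v assume uv: "u \<in> V" "v \<in> V"
    then obtain p where "is_path V E u p v" using E(2) unfolding connected_graph_def by blast
    then have ex: "reach E (length p - 1) u v" by (rule path_imp_reach)
    define k where "k = (LEAST k. reach E k u v)"
    have k: "reach E k u v" unfolding k_def using ex by (rule LeastI)
    have "real k * real ?a \<le> real k * \<alpha>" using a(2) by (intro mult_left_mono) auto
    then have "real (k * ?a) \<le> \<alpha> * real k" by (simp only: of_nat_mult mult.commute)
    then have "k * ?a \<le> nat \<lfloor>\<alpha> * real k\<rfloor>" by (rule le_nat_floor)
    then have "reach F (nat \<lfloor>\<alpha> * real k\<rfloor>) u v" by (rule reach_le[OF stretched[OF k]])
    then have "sp_dist V F (\<lambda>_. 1) u v \<le> ereal (\<alpha> * real k)"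
      using sp_dist_unit_le[OF sF uv(1)] \<alpha> by simp
    then show "sp_dist V F (\<lambda>_. 1) u v \<le> ereal \<alpha> * sp_dist V E (\<lambda>_. 1) u v"
      using sp_dist_unit[OF E(1) uv(1) ex] k_def by simp
  qed (rule F)
qed

section \<open>Breadth-first search trees\<close>

text \<open>
  \<open>d x\<close> is one more than the depth of \<open>x\<close> if \<open>x\<close> is reachable from the root \<open>u\<close> and \<open>0\<close>
  otherwise; \<open>br x\<close> is the child of the root whose subtree contains \<open>x\<close>.
\<close>

definition bfs_tree ::
  "'v set \<Rightarrow> 'v set set \<Rightarrow> 'v \<Rightarrow> ('v \<Rightarrow> nat) \<Rightarrow> ('v \<Rightarrow> 'v) \<Rightarrow> bool" where
  "bfs_tree V F u d br \<longleftrightarrow> d u = 1 \<and>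
     (\<forall>x y. {x, y} \<in> F \<and> 0 < d x \<longrightarrow> 0 < d y \<and> d y \<le> Suc (d x)) \<and>
     (\<forall>y\<in>V. y \<noteq> u \<and> 0 < d y \<longrightarrow>
        (\<exists>x\<in>V. {x, y} \<in> F \<and> 0 < d x \<and> d y = Suc (d x) \<and> br y = (if x = u then y else br x)))"

text \<open>Along a walk the label rises by at most 1 per edge, starting from 1 at the root;
  conversely, following parents to the root gives a walk of \<open>d v - 1\<close> edges.\<close>

lemma bfs_tree_reach:
  assumes t: "bfs_tree V F u d br" and v: "v \<in> V"
  shows "reach F k u v \<longleftrightarrow> 0 < d v \<and> d v \<le> Suc k"
proof
  show "reach F k u v \<Longrightarrow> 0 < d v \<and> d v \<le> Suc k" for v
  proof (induction k arbitrary: v)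
    case 0
    then show ?case using t by (auto simp: bfs_tree_def)
  next
    case (Suc k)
    show ?case
    proof (cases "reach F k u v")
      case True
      then show ?thesis using Suc.IH by fastforce
    next
      case False
      then obtain x where "reach F k u x" "{x, v} \<in> F" using Suc.prems by auto
      then have "0 < d v \<and> d v \<le> Suc (d x)" "d x \<le> Suc k"
        using Suc.IH[of x] t by (auto simp: bfs_tree_def)
      then show ?thesis by simp
    qed
  qed
  show "0 < d v \<and> d v \<le> Suc k \<Longrightarrow> reach F k u v" using v
  proof (induction k arbitrary: v)
    case 0
    then have "d v = 1" by simp
    show ?case
    proof (rule ccontr)
      assume "\<not> reach F 0 u v"
      then obtain x where "0 < d x" "d v = Suc (d x)"
        using 0 t unfolding bfs_tree_def by (metis reach.simps(1))
      then show False using \<open>d v = 1\<close> by simp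
    qed
  next
    case (Suc k)
    show ?case
    proof (cases "v = u")
      case False
      then obtain x where "x \<in> V" "{x, v} \<in> F" "0 < d x" "d v = Suc (d x)"
        using Suc.prems t unfolding bfs_tree_def by metis
      then show ?thesis using Suc.IH[of x] Suc.prems by auto
    qed simp
  qed
qed

text \<open>
  A walk from \<open>u\<close> to its neighbour \<open>v\<close> avoiding the edge between them has to enter the subtree of
  \<open>v\<close> through some other edge \<open>{x, y}\<close>; replacing the rest of it by the tree paths from \<open>u\<close> to \<open>x\<close> and
  from \<open>y\<close> to \<open>v\<close>, which avoid the edge as well, does not make it longer.
\<close>

lemma bfs_tree_detour:
  assumes t: "bfs_tree V E u d br" and V: "\<forall>x\<in>V. 0 < d x" and u: "u \<in> V"
    and E: "simple_graph V E" and e: "{u, v} \<in> E"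
  shows "reach (E - {{u, v}}) a u v \<longleftrightarrow>
    (\<exists>x y. {x, y} \<in> E \<and> x \<noteq> u \<and> y \<noteq> u \<and> br x \<noteq> v \<and> br y = v \<and> d x + d y \<le> a + 2)"
    (is "reach ?E a u v \<longleftrightarrow> ?R")
proof -
  have "card {u, v} = 2 \<and> {u, v} \<subseteq> V" using E e unfolding simple_graph_def by blast
  then have uv: "u \<noteq> v" "v \<in> V" by auto
  have inV: "x \<in> V \<and> y \<in> V" if "{x, y} \<in> E" for x y using that E by (auto simp: simple_graph_def)
  have root: "d u = 1" using t by (simp add: bfs_tree_def)
  have step: "d y \<le> Suc (d x)" if "{x, y} \<in> E" for x y
    using conjunct1[OF conjunct2[OF t[unfolded bfs_tree_def]], rule_format, of x y] V inV[OF that] that by blast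
  have parent: "\<exists>x\<in>V. {x, y} \<in> E \<and> d y = Suc (d x) \<and> br y = (if x = u then y else br x)"
    if y: "y \<in> V" "y \<noteq> u" for y
  proof -
    have "0 < d y" using V y(1) by simp
    then obtain x where "x \<in> V" "{x, y} \<in> E" "d y = Suc (d x)" "br y = (if x = u then y else br x)"
      using bspec[OF conjunct2[OF conjunct2[OF t[unfolded bfs_tree_def]]] y(1)] y(2) by metis
    then show ?thesis by (intro bexI[of _ x] conjI)
  qed
  have pos: "0 < d x" if "x \<in> V" for x using V that by blast
  \<comment> \<open>A neighbour of the root has label at most 2. Its parent has label at most 1, too
    small to have a parent of its own, so it is the root.\<close>
  have br_child: "br y = y" if "{u, y} \<in> E" "y \<noteq> u" for y
  proof -
    have y: "y \<in> V" "y \<noteq> u" "d y \<le> 2" using inV[OF that(1)] step[OF that(1)] root that by auto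
    then obtain x where x: "x \<in> V" "d y = Suc (d x)" "br y = (if x = u then y else br x)"
      using parent[OF y(1,2)] by blast
    have "x = u"
    proof (rule ccontr)
      assume "x \<noteq> u"
      then obtain z where "z \<in> V" "d x = Suc (d z)" using parent[OF x(1)] by blast
      then show False using x(2) y(3) pos[of z] by simp
    qed
    then show ?thesis using x(3) by simp
  qed
  show ?thesis
  proof
    assume w: "reach ?E a u v"
    show ?R
    proof (rule ccontr)
      assume no: "\<not> ?R"
      \<comment> \<open>A potential argument: inside the subtree of \<open>v\<close>, steps taken
        plus label amount to at least \<open>a + 3\<close>. This holds on entering, since by
        assumption every crossing edge has label sum at least \<open>a + 3\<close>, and it persists
        because a step changes the label by at most 1. But \<open>v\<close> has label at most 2 and
        would be reached with a sum of at most \<open>a + 2\<close>.\<close>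
      have "reach ?E k u y \<Longrightarrow> d y \<le> Suc k \<and> (y \<noteq> u \<and> br y = v \<longrightarrow> a + 3 \<le> k + d y)" for k y
      proof (induction k arbitrary: y)
        case 0
        then show ?case using root by auto
      next
        case (Suc k)
        show ?case
        proof (cases "reach ?E k u y")
          case True
          then show ?thesis using Suc.IH by fastforce
        next
          case False
          then obtain x where x: "reach ?E k u x" "{x, y} \<in> ?E" using Suc.prems by auto
          have le: "d y \<le> Suc (d x)" "d x \<le> Suc (d y)"
            using step x(2) by (auto simp: insert_commute)
          note IH = Suc.IH[OF x(1)]
          show ?thesis
          proof (intro conjI impI)
            show "d y \<le> Suc (Suc k)" using le IH by simp
            assume y: "y \<noteq> u \<and> br y = v"
            \<comment> \<open>From \<open>u\<close> itself the subtree could only be entered through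
              the deleted edge.\<close>
            have "x \<noteq> u" using x(2) br_child[of y] y by auto
            show "a + 3 \<le> Suc k + d y"
            proof (cases "br x = v")
              case True
              then show ?thesis using IH \<open>x \<noteq> u\<close> le by simp
            next
              case False
              moreover have "{x, y} \<in> E" using x(2) by (rule DiffD1)
              ultimately have "\<not> d x + d y \<le> a + 2" using no \<open>x \<noteq> u\<close> y by blast
              then show ?thesis using IH by simp
            qed
          qed
        qed
      qed
      from this[OF w] have "v \<noteq> u \<and> br v = v \<longrightarrow> a + 3 \<le> a + d v" by blast
      then show False using uv(1) br_child[OF e] step[OF e] root by simp
    qed
  next
    assume ?R
    then obtain x y where xy: "{x, y} \<in> E" "x \<noteq> u" "y \<noteq> u" "br x \<noteq> v" "br y = v"
      "d x + d y \<le> a + 2" by blast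
    \<comment> \<open>The tree path from the root to a vertex outside the subtree of
      \<open>v\<close> does not use \<open>{u, v}\<close>.\<close>
    have outer: "reach ?E (d x - 1) u x" if "x \<in> V" "x \<noteq> u" "br x \<noteq> v" for x
      using that
    proof (induction "d x" arbitrary: x rule: less_induct)
      case less
      obtain z where z: "z \<in> V" "{z, x} \<in> E" "d x = Suc (d z)" "br x = (if z = u then x else br z)"
        using parent[OF less.prems(1,2)] by blast
      have ne: "{z, x} \<noteq> {u, v}" using less.prems z(4) by (auto simp: doubleton_eq_iff)
      have "reach ?E (d z - 1) u z"
      proof (cases "z = u")
        case False
        then have "br z \<noteq> v" using z(4) less.prems(3) by simp
        have "d z < d x" using z(3) by simp
        from less.hyps[OF this z(1) False \<open>br z \<noteq> v\<close>] show ?thesis .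
      qed simp
      moreover have "{z, x} \<in> ?E" using z(2) ne by simp
      ultimately have "reach ?E (Suc (d z - 1)) u x" by (meson reach.simps(2))
      then show ?case using z(3) pos[OF z(1)] by simp
    qed
    \<comment> \<open>Within the subtree the tree path starts at \<open>v\<close>, whose label is 2;
      hence \<open>d y - 2\<close>.\<close>
    have inner: "reach ?E (d y - 2) v y" if "y \<in> V" "y \<noteq> u" "br y = v" for y
      using that
    proof (induction "d y" arbitrary: y rule: less_induct)
      case less
      obtain z where z: "z \<in> V" "{z, y} \<in> E" "d y = Suc (d z)" "br y = (if z = u then y else br z)"
        using parent[OF less.prems(1,2)] by blast
      show ?case
      proof (cases "z = u")
        case True
        then show ?thesis using z(4) less.prems by simp
      next
        case False
        then obtain z' where "z' \<in> V" "d z = Suc (d z')" using parent[OF z(1)] by blast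
        then have "2 \<le> d z" using pos[of z'] by simp
        have "d z < d y" using z(3) by simp
        have "br z = v" using z(4) less.prems(3) False by simp
        from less.hyps[OF \<open>d z < d y\<close> z(1) False this] have "reach ?E (d z - 2) v z" .
        moreover have "{z, y} \<in> ?E"
          using z(2) False less.prems(2) by (simp add: doubleton_eq_iff)
        ultimately have "reach ?E (Suc (d z - 2)) v y" by (meson reach.simps(2))
        moreover have "Suc (d z - 2) = d y - 2" using z(3) \<open>2 \<le> d z\<close> by simp
        ultimately show ?thesis by metis
      qed
    qed
    have V': "x \<in> V" "y \<in> V" using inV xy(1) by auto
    have "{x, y} \<in> ?E" using xy(1,2,3) by (simp add: doubleton_eq_iff)
    with outer[OF V'(1) xy(2,4)] have "reach ?E (Suc (d x - 1)) u y" by (meson reach.simps(2))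
    \<comment> \<open>The detour has \<open>(d x - 1) + 1 + (d y - 2)\<close> edges, which explains
      the \<open>a + 2\<close> of the criterion.\<close>
    from reach_trans[OF reach_sym[OF inner[OF V'(2) xy(3,5)]] this]
    have "reach ?E (Suc (d x - 1) + (d y - 2)) u v" .
    moreover
    have "2 \<le> d y"
    proof -
      obtain z where "z \<in> V" "d y = Suc (d z)" using parent[OF V'(2) xy(3)] by blast
      then show ?thesis using pos[of z] by simp
    qed
    then have "Suc (d x - 1) + (d y - 2) \<le> a" using xy(6) pos[OF V'(1)] by simp
    ultimately show "reach ?E a u v" by (rule reach_le)
  qed
qed

text \<open>Send every vertex other than the root to the edge joining it to a neighbour closer to
  the root. Of the two ends of such an edge the farther one is the preimage, so the map is
  injective. Through this bound a search costs \<open>O(m)\<close>.\<close>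

lemma connected_card_le:
  assumes E: "simple_graph V E" "connected_graph V E"
  shows "card V \<le> Suc (card E)"
proof (cases "V = {}")
  case False
  then obtain u where u: "u \<in> V" by blast
  define d where "d y = (LEAST k. reach E k u y)" for y
  have reachable: "\<exists>k. reach E k u y" if "y \<in> V" for y
  proof -
    obtain p where "is_path V E u p y" using E(2) u \<open>y \<in> V\<close> unfolding connected_graph_def by blast
    then show ?thesis using path_imp_reach by fast
  qed
  have d: "reach E (d y) u y" if "y \<in> V" for y
    unfolding d_def using reachable[OF that] by (auto intro: LeastI)
  have "\<exists>x\<in>V. {x, y} \<in> E \<and> d x < d y" if y: "y \<in> V - {u}" for y
  proof (cases "d y")
    case 0
    then show ?thesis using d[of y] y by simp
  next
    case (Suc k)
    then have "\<not> reach E k u y" unfolding d_def by (metis lessI not_less_Least)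
    then obtain x where x: "reach E k u x" "{x, y} \<in> E" using d[of y] y Suc by auto
    then have "d x \<le> k" unfolding d_def by (simp add: Least_le)
    moreover have "x \<in> V" using x(2) E(1) by (auto simp: simple_graph_def)
    ultimately show ?thesis using x(2) Suc by auto
  qed
  then obtain p where p: "\<And>y. y \<in> V - {u} \<Longrightarrow> {p y, y} \<in> E \<and> d (p y) < d y" by metis
  have "inj_on (\<lambda>y. {p y, y}) (V - {u})"
  proof (rule inj_onI)
    fix x y assume "x \<in> V - {u}" "y \<in> V - {u}" "{p x, x} = {p y, y}"
    then show "x = y" using p[of x] p[of y] by (auto simp: doubleton_eq_iff)
  qed
  moreover have "(\<lambda>y. {p y, y}) ` (V - {u}) \<subseteq> E" using p by blast
  moreover have "finite E"
    using E(1) by (auto simp: simple_graph_def intro!: finite_subset[of E "Pow V"])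
  ultimately have "card (V - {u}) \<le> card E" using card_inj_on_le by blast
  then show ?thesis using u E(1) by (simp add: simple_graph_def card_Diff_singleton)
qed simp

section \<open>Independent sets in sparse conflict relations\<close>

text \<open>Counted by \<open>e\<close>, there are at most \<open>a * card R\<close> pairs
  \<open>f \<in> P e\<close> within \<open>R\<close>, so some \<open>f\<close> lies in at most
  \<open>a\<close> of the sets. Choosing it excludes \<open>f\<close>, the members of
  \<open>P f\<close> and all \<open>e\<close> with \<open>f \<in> P e\<close>: at most
  \<open>2 * a + 1\<close> elements, the price of each element of \<open>S\<close>.\<close>

lemma independent_subset:
  assumes "finite R" "\<And>e. e \<in> R \<Longrightarrow> finite (P e) \<and> card (P e) \<le> a \<and> e \<notin> P e"
    and "W * (2 * a + 1) \<le> card R"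
  shows "\<exists>S\<subseteq>R. card S = W \<and> (\<forall>e\<in>S. P e \<inter> S = {})"
  using assms
proof (induction W arbitrary: R)
  case 0
  then show ?case by (intro exI[of _ "{}"]) auto
next
  case (Suc W)
  let ?in = "\<lambda>f. {e\<in>R. f \<in> P e}"
  have "\<exists>f\<in>R. card (?in f) \<le> a"
  proof (rule ccontr)
    assume "\<not> ?thesis"
    then have "(\<Sum>f\<in>R. Suc a) \<le> (\<Sum>f\<in>R. card (?in f))" by (intro sum_mono) auto
    also have "\<dots> = (\<Sum>f\<in>R. \<Sum>e\<in>R. if f \<in> P e then 1 else 0)"
      using Suc.prems(1) by (intro sum.cong refl) (simp add: sum.If_cases Int_def)
    also have "\<dots> = (\<Sum>e\<in>R. \<Sum>f\<in>R. if f \<in> P e then 1 else 0)" by (rule sum.swap)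
    also have "\<dots> = (\<Sum>e\<in>R. card (R \<inter> P e))"
      using Suc.prems(1) by (intro sum.cong refl) (simp add: sum.If_cases Int_def)
    also have "\<dots> \<le> (\<Sum>e\<in>R. a)"
      using Suc.prems(2) by (intro sum_mono) (meson card_mono inf_le2 order_trans)
    finally have "card R = 0" by simp
    then show False using Suc.prems(3) by simp
  qed
  then obtain f where f: "f \<in> R" "card (?in f) \<le> a" by blast
  let ?X = "{f} \<union> P f \<union> ?in f"
  have Pf: "finite (P f)" "card (P f) \<le> a" using Suc.prems(2)[OF f(1)] by auto
  have "card ?X \<le> card ({f} \<union> P f) + card (?in f)" by (rule card_Un_le)
  also have "\<dots> \<le> card {f} + card (P f) + card (?in f)" using card_Un_le by (rule add_right_mono)
  also have "\<dots> \<le> 2 * a + 1" using Pf f(2) by simp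
  finally have "card ?X \<le> 2 * a + 1" .
  moreover have "card R - card ?X \<le> card (R - ?X)"
    using Pf Suc.prems(1) by (intro diff_card_le_card_Diff) auto
  ultimately have "W * (2 * a + 1) \<le> card (R - ?X)" using Suc.prems(3) by simp
  then obtain S where S: "S \<subseteq> R - ?X" "card S = W" "\<forall>e\<in>S. P e \<inter> S = {}"
    using Suc.IH[of "R - ?X"] Suc.prems(1,2) by auto
  have "finite S" using S(1) Suc.prems(1) finite_subset by blast
  moreover have "f \<notin> S" using S(1) by blast
  ultimately have "card (insert f S) = Suc W" using S(2) by simp
  moreover have "\<forall>e\<in>insert f S. P e \<inter> insert f S = {}"
    using S(1,3) Suc.prems(2)[OF f(1)] by blast
  ultimately show ?case using S(1) f(1) by (intro exI[of _ "insert f S"]) auto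
qed

section \<open>Breadth-first search\<close>

text \<open>
  The arcs are numbered \<open>1, \<dots>, M\<close>, arc \<open>a\<close> leading from \<open>src a\<close> to \<open>dst a\<close>. The adjacency
  list of \<open>u\<close> is a linked list in decreasing order; \<open>pred_arc src u b\<close> is the last arc before \<open>b\<close>
  with source \<open>u\<close>, or \<open>0\<close>.
\<close>

fun pred_arc :: "(nat \<Rightarrow> nat) \<Rightarrow> nat \<Rightarrow> nat \<Rightarrow> nat" where
  "pred_arc src u 0 = 0"
| "pred_arc src u (Suc b) = (if 0 < b \<and> src b = u then b else pred_arc src u b)"

lemma pred_arc_le: "pred_arc src u b \<le> b - 1"
  by (induction b) auto

lemma pred_arc_less: "0 < b \<Longrightarrow> pred_arc src u b < b"
  using pred_arc_le[of src u b] by simp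

lemma src_pred_arc: "0 < pred_arc src u b \<Longrightarrow> src (pred_arc src u b) = u"
  by (induction b) (auto split: if_splits)

lemma pred_arc_greatest: "a < b \<Longrightarrow> src a = u \<Longrightarrow> a \<le> pred_arc src u b"
  by (induction b) (auto simp: less_Suc_eq)

declare pred_arc.simps(2) [simp del]

text \<open>
  The search has finished with the vertices \<open>q 0, \<dots>, q (qh - 1)\<close>, and with the arcs of \<open>q qh\<close>
  after \<open>p\<close>; the cells \<open>q qh, \<dots>, q (qt - 1)\<close> are waiting.
\<close>

definition scanned :: "(nat \<Rightarrow> nat) \<Rightarrow> (nat \<Rightarrow> nat) \<Rightarrow> nat \<Rightarrow> nat \<Rightarrow> nat \<Rightarrow> nat \<Rightarrow> bool" where
  "scanned src q qh qt p a \<longleftrightarrow> (\<exists>i<qh. src a = q i) \<or> (qh < qt \<and> src a = q qh \<and> p < a)"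

text \<open>Labels do not decrease along the queue and exceed that of \<open>q qh\<close> by at most
  1. This is why an endpoint that is already labelled can be skipped: its label is small enough for
  the arc condition.\<close>

definition bfs_inv :: "nat \<Rightarrow> nat \<Rightarrow> (nat \<Rightarrow> nat) \<Rightarrow> (nat \<Rightarrow> nat) \<Rightarrow> (nat \<Rightarrow> bool) \<Rightarrow> nat \<Rightarrow>
    (nat \<Rightarrow> nat) \<Rightarrow> (nat \<Rightarrow> nat) \<Rightarrow> (nat \<Rightarrow> nat) \<Rightarrow> nat \<Rightarrow> nat \<Rightarrow> nat \<Rightarrow> bool" where
  "bfs_inv n M src dst alive u d br q qh qt p \<longleftrightarrow>
     qh \<le> qt \<and> 0 < qt \<and> q 0 = u \<and> d u = 1 \<and> inj_on q {..<qt} \<and>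
     q ` {..<qt} = {v. v < n \<and> 0 < d v} \<and>
     (\<forall>i j. i \<le> j \<longrightarrow> j < qt \<longrightarrow> d (q i) \<le> d (q j)) \<and>
     (\<forall>j<qt. qh < qt \<longrightarrow> d (q j) \<le> Suc (d (q qh))) \<and>
     (qh < qt \<longrightarrow> p \<le> M \<and> (0 < p \<longrightarrow> src p = q qh)) \<and>
     (\<forall>a\<in>{1..M}. alive a \<longrightarrow> scanned src q qh qt p a \<longrightarrow>
        0 < d (dst a) \<and> d (dst a) \<le> Suc (d (src a))) \<and>
     (\<forall>y<n. y \<noteq> u \<longrightarrow> 0 < d y \<longrightarrow>
        (\<exists>a\<in>{1..M}. alive a \<and> dst a = y \<and> 0 < d (src a) \<and> d y = Suc (d (src a)) \<and>
           br y = (if src a = u then y else br (src a))))"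

text \<open>Visiting a vertex leaves this measure unchanged. It drops in every iteration because the
  program follows each visit by the step to the next arc.\<close>

definition bfs_todo :: "nat \<Rightarrow> nat \<Rightarrow> (nat \<Rightarrow> nat) \<Rightarrow> (nat \<Rightarrow> nat) \<Rightarrow> nat \<Rightarrow> nat \<Rightarrow> nat \<Rightarrow> nat" where
  "bfs_todo n M src q qh qt p = card {a\<in>{1..M}. \<not> scanned src q qh qt p a} + (n - qh)"

lemma scanned_snoc:
  assumes "qh < qt"
  shows "scanned src (q(qt := y)) qh (Suc qt) p a = scanned src q qh qt p a"
proof -
  have "(\<exists>i<qh. src a = (q(qt := y)) i) \<longleftrightarrow> (\<exists>i<qh. src a = q i)"
    using assms by (intro ex_cong) auto
  then show ?thesis using assms by (simp add: scanned_def)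
qed

lemma bfs_todo_snoc:
  "qh < qt \<Longrightarrow> bfs_todo n M src (q(qt := y)) qh (Suc qt) p = bfs_todo n M src q qh qt p"
  by (simp only: bfs_todo_def scanned_snoc)

lemma bfs_inv_init:
  assumes "u < n" "d u = 1" "\<And>v. v < n \<Longrightarrow> v \<noteq> u \<Longrightarrow> d v = 0" "q 0 = u"
    "p = pred_arc src u (Suc M)"
  shows "bfs_inv n M src dst alive u d br q 0 (Suc 0) p"
proof -
  have "\<not> scanned src q 0 (Suc 0) p a" if "a \<in> {1..M}" for a
    using pred_arc_greatest[of a "Suc M" src u] that assms(4,5) by (auto simp: scanned_def)
  moreover have "{v. v < n \<and> 0 < d v} = {u}"
  proof -
    have "0 < d v \<Longrightarrow> v < n \<Longrightarrow> v = u" for v using assms(3)[of v] by fastforce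
    then show ?thesis using assms(1,2) by auto
  qed
  moreover have "p \<le> M" using assms(5) pred_arc_less[of "Suc M" src u] by simp
  moreover have "0 < p \<Longrightarrow> src p = u" using assms(5) src_pred_arc by simp
  moreover have "y = u" if "y < n" "0 < d y" for y using assms(3)[of y] that by fastforce
  ultimately show ?thesis using assms(2,4) unfolding bfs_inv_def by (auto simp: lessThan_Suc)
qed

context
  fixes n M src dst alive u d br q qh qt p
  assumes inv: "bfs_inv n M src dst alive u d br q qh qt p" and act: "qh < qt"
    and range: "\<forall>a\<in>{1..M}. src a < n \<and> dst a < n" "u < n"
begin

lemma bfs_facts:
  shows "0 < qt" "q 0 = u" "d u = 1" "inj_on q {..<qt}" "q ` {..<qt} = {v. v < n \<and> 0 < d v}"
    and "\<And>i j. i \<le> j \<Longrightarrow> j < qt \<Longrightarrow> d (q i) \<le> d (q j)"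
    and "\<And>j. j < qt \<Longrightarrow> d (q j) \<le> Suc (d (q qh))"
    and "p \<le> M" "0 < p \<Longrightarrow> src p = q qh"
    and "\<And>a. a \<in> {1..M} \<Longrightarrow> alive a \<Longrightarrow> scanned src q qh qt p a \<Longrightarrow>
      0 < d (dst a) \<and> d (dst a) \<le> Suc (d (src a))"
    and "\<And>y. y < n \<Longrightarrow> y \<noteq> u \<Longrightarrow> 0 < d y \<Longrightarrow>
        \<exists>a\<in>{1..M}. alive a \<and> dst a = y \<and> 0 < d (src a) \<and> d y = Suc (d (src a)) \<and>
           br y = (if src a = u then y else br (src a))"
  using inv act unfolding bfs_inv_def by simp_all

lemma queued: "i < qt \<Longrightarrow> q i < n \<and> 0 < d (q i)"
  using bfs_facts(5) by auto

lemma queue_length: "qt \<le> n"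
proof -
  have "card (q ` {..<qt}) \<le> card {..<n}"
    unfolding bfs_facts(5) by (rule card_mono) auto
  then show ?thesis using card_image[OF bfs_facts(4)] by simp
qed

lemma bfs_inv_visit:
  assumes "0 < p" "alive p" "d (dst p) = 0"
  shows "bfs_inv n M src dst alive u (d(dst p := Suc (d (q qh))))
    (br(dst p := (if qh = 0 then dst p else br (q qh)))) (q(qt := dst p)) qh (Suc qt) p"
proof -
  note f = bfs_facts
  let ?y = "dst p" and ?d = "d(dst p := Suc (d (q qh)))" and ?q = "q(qt := dst p)"
    and ?br = "br(dst p := (if qh = 0 then dst p else br (q qh)))"
  have p: "p \<in> {1..M}" using f(8) assms(1) by simp
  have y: "?y < n" using range p by blast
  have ne: "q i \<noteq> ?y" if "i < qt" for i using queued[OF that] assms(3) by auto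
  have u: "u \<noteq> ?y" using f(3) assms(3) by auto
  \<comment> \<open>The queue is injective and starts with the root, so the test
    \<open>qh = 0\<close> recognises the root without comparing vertices.\<close>
  have root: "qh = 0 \<longleftrightarrow> q qh = u"
    using inj_onD[OF f(4), of qh 0] f(1,2) act by auto
  have dq: "?d (?q i) = d (q i)" if "i < qt" for i using ne[OF that] that by simp
  have dqt: "?d (?q qt) = Suc (d (q qh))" by simp
  have keep: "?d x = d x" if "0 < d x" for x using that assms(3) by auto
  have inj: "inj_on ?q {..<Suc qt}"
    using f(4) ne unfolding inj_on_def by (metis fun_upd_apply less_SucE lessThan_iff)
  have im: "?q ` {..<Suc qt} = {v. v < n \<and> 0 < ?d v}"
  proof -
    have "?q ` {..<Suc qt} = insert ?y (q ` {..<qt})" by (auto simp: lessThan_Suc image_iff)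
    then show ?thesis using f(5) y by auto
  qed
  have sorted: "?d (?q i) \<le> ?d (?q j)" if "i \<le> j" "j < Suc qt" for i j
    using that f(6)[of i j] f(7)[of i] dq[of i] dq[of j] dqt by (cases "j = qt"; cases "i = qt") auto
  have near: "?d (?q j) \<le> Suc (?d (?q qh))" if "j < Suc qt" for j
    using that f(7)[of j] dq[of j] dqt dq[OF act] by (cases "j = qt") auto
  note sc = scanned_snoc[OF act]
  have arcs: "0 < ?d (dst a) \<and> ?d (dst a) \<le> Suc (?d (src a))"
    if "a \<in> {1..M}" "alive a" "scanned src q qh qt p a" for a
  proof -
    have "0 < d (src a)" using that(3) queued act by (auto simp: scanned_def)
    then show ?thesis using f(10)[OF that] keep by simp
  qed
  have parents: "\<exists>a\<in>{1..M}. alive a \<and> dst a = y \<and> 0 < ?d (src a) \<and> ?d y = Suc (?d (src a)) \<and>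
      ?br y = (if src a = u then y else ?br (src a))" if y: "y < n" "y \<noteq> u" "0 < ?d y" for y
  proof (cases "y = ?y")
    case True
    have "src p = q qh" using f(9) assms(1) by blast
    then show ?thesis using True p assms(2) queued[OF act] ne[OF act] root
      by (intro bexI[of _ p]) auto
  next
    case False
    then have "0 < d y" using y(3) by simp
    then obtain a where a: "a \<in> {1..M}" "alive a" "dst a = y" "0 < d (src a)"
      "d y = Suc (d (src a))" "br y = (if src a = u then y else br (src a))"
      using f(11)[OF y(1,2)] by blast
    have "src a \<noteq> ?y" using a(4) assms(3) by auto
    then show ?thesis using a False by (intro bexI[of _ a]) auto
  qed
  show ?thesis
    unfolding bfs_inv_def sc
    using act f(2,3,8,9) u inj im sorted near arcs parents by (simp del: fun_upd_apply) simp
qed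

lemma bfs_inv_advance:
  assumes "0 < p" "alive p \<Longrightarrow> 0 < d (dst p)"
  shows "bfs_inv n M src dst alive u d br q qh qt (pred_arc src (q qh) p)"
    and "bfs_todo n M src q qh qt (pred_arc src (q qh) p) < bfs_todo n M src q qh qt p"
proof -
  note f = bfs_facts
  let ?p = "pred_arc src (q qh) p"
  have p: "p \<in> {1..M}" using f(8) assms(1) by simp
  have srcp: "src p = q qh" using f(9) assms(1) by blast
  have sc: "scanned src q qh qt ?p a \<longleftrightarrow> scanned src q qh qt p a \<or> a = p" if "a \<in> {1..M}" for a
    using pred_arc_greatest[of a p src "q qh"] pred_arc_less[OF assms(1), of src "q qh"] act srcp
    by (auto simp: scanned_def not_less_iff_gr_or_eq)
  have p_new: "0 < d (dst p) \<and> d (dst p) \<le> Suc (d (src p))" if "alive p"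
  proof -
    have "dst p \<in> q ` {..<qt}" using assms(2)[OF that] f(5) range p by blast
    then obtain j where "j < qt" "dst p = q j" by auto
    then show ?thesis using f(7)[of j] srcp assms(2)[OF that] by simp
  qed
  have "?p \<le> M" using f(8) pred_arc_less[OF assms(1), of src "q qh"] by simp
  moreover have "0 < ?p \<Longrightarrow> src ?p = q qh" by (rule src_pred_arc)
  moreover have "0 < d (dst a) \<and> d (dst a) \<le> Suc (d (src a))"
    if "a \<in> {1..M}" "alive a" "scanned src q qh qt ?p a" for a
    using that sc[OF that(1)] p_new f(10) by blast
  ultimately show "bfs_inv n M src dst alive u d br q qh qt ?p"
    using inv unfolding bfs_inv_def by simp
  \<comment> \<open>Earlier queue positions hold vertices other than \<open>src p\<close>, so
    \<open>p\<close> is newly scanned and the measure drops.\<close>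
  have "\<not> scanned src q qh qt p p"
    using inj_onD[OF f(4), of qh] act srcp by (fastforce simp: scanned_def)
  then have "{a\<in>{1..M}. \<not> scanned src q qh qt ?p a} \<subset> {a\<in>{1..M}. \<not> scanned src q qh qt p a}"
    using sc p by blast
  then have "card {a\<in>{1..M}. \<not> scanned src q qh qt ?p a} < card {a\<in>{1..M}. \<not> scanned src q qh qt p a}"
    by (intro psubset_card_mono) auto
  then show "bfs_todo n M src q qh qt ?p < bfs_todo n M src q qh qt p"
    by (simp add: bfs_todo_def)
qed

lemma bfs_inv_pop:
  assumes "p = 0" "Suc qh < qt \<Longrightarrow> p' = pred_arc src (q (Suc qh)) (Suc M)"
  shows "bfs_inv n M src dst alive u d br q (Suc qh) qt p'"
    and "bfs_todo n M src q (Suc qh) qt p' < bfs_todo n M src q qh qt p"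
proof -
  note f = bfs_facts
  have sc: "scanned src q (Suc qh) qt p' a \<longleftrightarrow> scanned src q qh qt p a" if "a \<in> {1..M}" for a
  proof -
    have "\<not> p' < a" if "Suc qh < qt" "src a = q (Suc qh)"
      using pred_arc_greatest[of a "Suc M" src "q (Suc qh)"] that \<open>a \<in> {1..M}\<close> assms(2) by simp
    then show ?thesis using that assms(1) act by (auto simp: scanned_def less_Suc_eq)
  qed
  have "Suc qh < qt \<Longrightarrow> p' \<le> M" using assms(2) pred_arc_less[of "Suc M" src "q (Suc qh)"] by simp
  moreover have "Suc qh < qt \<Longrightarrow> 0 < p' \<Longrightarrow> src p' = q (Suc qh)" using assms(2) src_pred_arc by simp
  moreover have "d (q j) \<le> Suc (d (q (Suc qh)))" if "j < qt" "Suc qh < qt" for j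
    using f(6)[of qh "Suc qh"] f(7)[OF that(1)] that(2) by simp
  ultimately show "bfs_inv n M src dst alive u d br q (Suc qh) qt p'"
    using inv act sc unfolding bfs_inv_def by simp
  have "{a\<in>{1..M}. \<not> scanned src q (Suc qh) qt p' a} = {a\<in>{1..M}. \<not> scanned src q qh qt p a}"
    using sc by blast
  then show "bfs_todo n M src q (Suc qh) qt p' < bfs_todo n M src q qh qt p"
    using queue_length act by (simp add: bfs_todo_def)
qed

end

lemma bfs_inv_final:
  assumes inv: "bfs_inv n M src dst alive u d br q qh qt p" "\<not> qh < qt"
    and range: "\<forall>a\<in>{1..M}. src a < n \<and> dst a < n" "u < n"
    and F: "\<And>x y. {x, y} \<in> F \<longleftrightarrow> (\<exists>a\<in>{1..M}. alive a \<and> src a = x \<and> dst a = y)"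
  shows "bfs_tree {..<n} F u d br"
  unfolding bfs_tree_def
proof (intro conjI allI impI ballI)
  show "d u = 1" using inv unfolding bfs_inv_def by simp
  fix x y assume "{x, y} \<in> F \<and> 0 < d x"
  then obtain a where a: "a \<in> {1..M}" "alive a" "src a = x" "dst a = y" "0 < d x"
    using F by blast
  have "x \<in> q ` {..<qt}" using inv(1) a range unfolding bfs_inv_def by auto
  moreover have "qh = qt" using inv unfolding bfs_inv_def by simp
  ultimately have "scanned src q qh qt p a" using a(3) by (auto simp: scanned_def)
  then have "0 < d (dst a) \<and> d (dst a) \<le> Suc (d (src a))"
    using inv(1) a(1,2) unfolding bfs_inv_def by simp
  then show "0 < d y" "d y \<le> Suc (d x)" using a by auto
next
  fix y assume y: "y \<in> {..<n}" "y \<noteq> u \<and> 0 < d y"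
  then have "\<exists>a\<in>{1..M}. alive a \<and> dst a = y \<and> 0 < d (src a) \<and> d y = Suc (d (src a)) \<and>
           br y = (if src a = u then y else br (src a))"
    using inv(1) unfolding bfs_inv_def by simp
  then obtain a where a: "a \<in> {1..M}" "alive a" "dst a = y" "0 < d (src a)"
      "d y = Suc (d (src a))" "br y = (if src a = u then y else br (src a))" by blast
  show "\<exists>x\<in>{..<n}. {x, y} \<in> F \<and> 0 < d x \<and> d y = Suc (d x) \<and> br y = (if x = u then y else br x)"
    by (rule bexI[of _ "src a"]) (use a range F in auto)
qed

lemma bfs_todo_le: "bfs_todo n M src q qh qt p \<le> n + M"
proof -
  have "card {a\<in>{1..M}. \<not> scanned src q qh qt p a} \<le> card {1..M}" by (rule card_mono) auto
  then show ?thesis by (simp add: bfs_todo_def)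
qed

section \<open>Access to the input\<close>

abbreviation vertex_number :: aexp where
  "vertex_number \<equiv> Cell ''in'' (Const 1)"

abbreviation edge_number :: aexp where
  "edge_number \<equiv> Cell ''in'' (Const 2)"

abbreviation target_weight :: aexp where
  "target_weight \<equiv> Cell ''in'' (Const 3)"

text \<open>Cell 0 holds the length and cells 1 to 5 the header, so the triple of edge
  \<open>e\<close> starts at \<open>6 + 3 * e\<close>; without multiplication this becomes a
  sum.\<close>

definition end1 :: "aexp \<Rightarrow> aexp" where
  "end1 e = Cell ''in'' (Plus (Const 6) (Plus e (Plus e e)))"

definition end2 :: "aexp \<Rightarrow> aexp" where
  "end2 e = Cell ''in'' (Plus (Const 7) (Plus e (Plus e e)))"

definition edge_weight :: "aexp \<Rightarrow> aexp" where
  "edge_weight e = Cell ''in'' (Plus (Const 8) (Plus e (Plus e e)))"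

lemma acost_edge [simp]:
  "acost (end1 e) = 3 * acost e + 5" "acost (end2 e) = 3 * acost e + 5"
  "acost (edge_weight e) = 3 * acost e + 5"
  by (simp_all add: end1_def end2_def edge_weight_def)

lemma nth_concat_triples:
  "j < length xs \<Longrightarrow> i < 3 \<Longrightarrow>
    concat (map (\<lambda>(u, v). [f u v, g u v, h u v]) xs) ! (3 * j + i) =
    (case xs ! j of (u, v) \<Rightarrow> [f u v, g u v, h u v] ! i)"
proof (induction xs arbitrary: j)
  case (Cons x xs)
  obtain a b where x: "x = (a, b)" by fastforce
  show ?case
  proof (cases j)
    case 0
    then have "i = 0 \<or> i = 1 \<or> i = 2" using Cons.prems by auto
    then show ?thesis using 0 x by auto
  next
    case (Suc j')
    then have "3 * j + i = Suc (Suc (Suc (3 * j' + i)))" by simp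
    then show ?thesis using Cons.IH[of j'] Cons.prems x Suc by (simp only: nth_Cons_Suc) simp
  qed
qed simp

lemma length_concat_triples:
  "length (concat (map (\<lambda>(u, v). [f u v, g u v, h u v]) xs)) = 3 * length xs"
  by (induction xs) auto

locale spanner_instance =
  fixes I :: spanner_input
  assumes inst: "I \<in> unit_spanner_inputs"
begin

abbreviation "n \<equiv> vertex_count I"
abbreviation "m \<equiv> length (edge_list I)"
abbreviation "W \<equiv> target I"
definition "eu j = fst (edge_list I ! j)"
definition "ev j = snd (edge_list I ! j)"
definition "ew j = weight I (edge_at I j)"
definition "num = nat (fst (quotient_of (stretch I)))"
definition "den = nat (snd (quotient_of (stretch I)))"

definition has_input :: "state \<Rightarrow> bool" where
  "has_input s \<longleftrightarrow> s ''in'' = input_state (encode_input I) ''in''"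

lemma edge_at_eq: "edge_at I j = {eu j, ev j}"
  by (simp add: edge_at_def eu_def ev_def case_prod_unfold)

lemma simple: "simple_graph {..<n} (edges I)" and connected: "connected_graph {..<n} (edges I)"
  and inj_edge: "inj_on (edge_at I) {..<m}" and stretch_ge_1: "1 \<le> stretch I"
  using inst by (auto simp: unit_spanner_inputs_def verts_def)

lemma edge_ends: "j < m \<Longrightarrow> eu j < n \<and> ev j < n \<and> eu j \<noteq> ev j"
proof -
  assume "j < m"
  then have "edge_at I j \<in> edges I" by (simp add: edges_def)
  then have "{eu j, ev j} \<in> edges I" by (simp only: edge_at_eq)
  moreover have "\<forall>e\<in>edges I. e \<subseteq> {..<n} \<and> card e = 2"
    using simple by (simp add: simple_graph_def)
  ultimately have "{eu j, ev j} \<subseteq> {..<n} \<and> card {eu j, ev j} = 2" by (rule bspec[rotated])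
  then show "eu j < n \<and> ev j < n \<and> eu j \<noteq> ev j" by (auto simp: card_insert_if split: if_splits)
qed

lemma encode_input_eq: "encode_input I = [n, m, W, num, den] @
    concat (map (\<lambda>(u, v). [u, v, weight I {u, v}]) (edge_list I))"
  by (simp add: encode_input_def encode_stretch_def num_def den_def case_prod_unfold)

lemma has_input_header:
  assumes "has_input s"
  shows "s ''in'' (Suc 0) = n" "s ''in'' 2 = m" "s ''in'' 3 = W" "s ''in'' 4 = num" "s ''in'' 5 = den"
  using assms by (simp_all add: has_input_def input_state_def encode_input_eq)

lemma has_input_edge:
  assumes "has_input s" "j < m"
  shows "s ''in'' (6 + (j + (j + j))) = eu j" "s ''in'' (7 + (j + (j + j))) = ev j"
    "s ''in'' (8 + (j + (j + j))) = ew j"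
proof -
  let ?c = "concat (map (\<lambda>(u, v). [u, v, weight I {u, v}]) (edge_list I))"
  have "s ''in'' (6 + (3 * j + i)) = ?c ! (3 * j + i)" if "i < 3" for i
  proof -
    have "6 + (3 * j + i) \<le> length (encode_input I)"
      using assms(2) that length_concat_triples[of "\<lambda>u v. u" "\<lambda>u v. v" "\<lambda>u v. weight I {u, v}" "edge_list I"]
      by (simp add: encode_input_eq)
    then have "s ''in'' (6 + (3 * j + i)) = (length (encode_input I) # encode_input I) ! (6 + (3 * j + i))"
      using assms(1) by (simp only: has_input_def input_state_def) simp
    also have "\<dots> = encode_input I ! (length [n, m, W, num, den] + (3 * j + i))"
    proof -
      have "6 + (3 * j + i) = Suc (length [n, m, W, num, den] + (3 * j + i))" by simp
      then show ?thesis by (simp only: nth_Cons_Suc)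
    qed
    also have "\<dots> = ?c ! (3 * j + i)" unfolding encode_input_eq by (rule nth_append_length_plus)
    finally show ?thesis .
  qed
  moreover have "?c ! (3 * j + i) = [eu j, ev j, ew j] ! i" if "i < 3" for i
    using nth_concat_triples[OF assms(2) that, of "\<lambda>u v. u" "\<lambda>u v. v" "\<lambda>u v. weight I {u, v}"]
    by (simp add: eu_def ev_def ew_def edge_at_def case_prod_unfold)
  ultimately have *: "s ''in'' (6 + (3 * j + i)) = [eu j, ev j, ew j] ! i" if "i < 3" for i
    using that by simp
  have eq: "6 + (j + (j + j)) = 6 + (3 * j + 0)" "7 + (j + (j + j)) = 6 + (3 * j + 1)"
    "8 + (j + (j + j)) = 6 + (3 * j + 2)" by simp_all
  show "s ''in'' (6 + (j + (j + j))) = eu j" "s ''in'' (7 + (j + (j + j))) = ev j"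
    "s ''in'' (8 + (j + (j + j))) = ew j"
    unfolding eq by (subst *, simp, simp)+
qed

lemma aval_edge [simp]:
  assumes "has_input s" "aval e s < m"
  shows "aval (end1 e) s = eu (aval e s)" "aval (end2 e) s = ev (aval e s)"
    "aval (edge_weight e) s = ew (aval e s)"
  unfolding end1_def end2_def edge_weight_def aval.simps
  by (rule has_input_edge[OF assms])+

lemma has_input_upd [simp]: "x \<noteq> ''in'' \<Longrightarrow> has_input (upd s x i v) = has_input s"
  by (simp add: has_input_def)

end

section \<open>Adjacency lists\<close>

definition link :: "aexp \<Rightarrow> aexp \<Rightarrow> aexp \<Rightarrow> com" where
  "link a x y = (Assign ''dst'' a y ;; Assign ''eid'' a (Var ''j'') ;;
     Assign ''nxt'' a (Cell ''head'' x) ;; Assign ''head'' x a)"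

definition build :: com where
  "build = For ''j'' edge_number
     (link (Plus (Plus (Var ''j'') (Var ''j'')) (Const 1)) (end1 (Var ''j'')) (end2 (Var ''j'')) ;;
      link (Plus (Plus (Var ''j'') (Var ''j'')) (Const 2)) (end2 (Var ''j'')) (end1 (Var ''j'')))"

lemma written_build [simp]: "written build = {''j'', ''dst'', ''eid'', ''nxt'', ''head''}"
  by (auto simp: build_def link_def)

context spanner_instance
begin

text \<open>Edge \<open>j\<close> yields arc \<open>2 * j + 1\<close> from \<open>eu j\<close> to \<open>ev j\<close> and arc \<open>2 * j + 2\<close> in the other direction.\<close>

definition "eid a = (a - 1) div 2"
definition "asrc a = (if odd a then eu (eid a) else ev (eid a))"
definition "adst a = (if odd a then ev (eid a) else eu (eid a))"

definition arcs_upto :: "nat \<Rightarrow> state \<Rightarrow> bool" where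
  "arcs_upto k s \<longleftrightarrow> (\<forall>u<n. s ''head'' u = pred_arc asrc u (Suc (2 * k))) \<and>
     (\<forall>a\<in>{1..2 * k}. s ''dst'' a = adst a \<and> s ''eid'' a = eid a \<and>
        s ''nxt'' a = pred_arc asrc (asrc a) a)"

lemma arcs_upto_cong:
  "arcs_upto k s \<Longrightarrow> s' ''head'' = s ''head'' \<Longrightarrow> s' ''dst'' = s ''dst'' \<Longrightarrow> s' ''eid'' = s ''eid'' \<Longrightarrow>
   s' ''nxt'' = s ''nxt'' \<Longrightarrow> arcs_upto k s'"
  by (simp add: arcs_upto_def)

lemma arcs_upto_upd [simp]:
  "x \<notin> {''head'', ''dst'', ''eid'', ''nxt''} \<Longrightarrow> arcs_upto k (upd s x i v) = arcs_upto k s"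
  unfolding arcs_upto_def upd_def by (subst fun_upd_other, force)+ simp

lemma arcs_upto_Suc:
  assumes s: "arcs_upto k s" and k: "k < m"
    and "s' ''head'' = (s ''head'')(eu k := Suc (k + k), ev k := Suc (Suc (k + k)))"
    "s' ''dst'' = (s ''dst'')(Suc (k + k) := ev k, Suc (Suc (k + k)) := eu k)"
    "s' ''eid'' = (s ''eid'')(Suc (k + k) := k, Suc (Suc (k + k)) := k)"
    "s' ''nxt'' = (s ''nxt'')(Suc (k + k) := s ''head'' (eu k), Suc (Suc (k + k)) := s ''head'' (ev k))"
  shows "arcs_upto (Suc k) s'"
proof -
  have a: "eid (Suc (k + k)) = k" "eid (Suc (Suc (k + k))) = k"
    "asrc (Suc (k + k)) = eu k" "asrc (Suc (Suc (k + k))) = ev k"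
    "adst (Suc (k + k)) = ev k" "adst (Suc (Suc (k + k))) = eu k"
    by (simp_all add: asrc_def adst_def eid_def)
  \<comment> \<open>The two ends differ, so the first arc of the edge does not enter the list that
    the second arc extends.\<close>
  note e = edge_ends[OF k]
  have head: "s ''head'' u = pred_arc asrc u (Suc (k + k))" if "u < n" for u
    using s that by (simp add: arcs_upto_def mult_2)
  show ?thesis
    unfolding arcs_upto_def
  proof (intro conjI allI impI ballI)
    show "s' ''head'' u = pred_arc asrc u (Suc (2 * Suc k))" if "u < n" for u
      using head[OF that] assms(3) a by (auto simp: pred_arc.simps mult_2)
    fix b assume "b \<in> {1..2 * Suc k}"
    then consider "b \<in> {1..2 * k}" | "b = Suc (k + k)" | "b = Suc (Suc (k + k))"
      by fastforce
    then have "s' ''dst'' b = adst b \<and> s' ''eid'' b = eid b \<and> s' ''nxt'' b = pred_arc asrc (asrc b) b"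
    proof cases
      case 1
      then have "b \<noteq> Suc (k + k)" "b \<noteq> Suc (Suc (k + k))" by auto
      then show ?thesis using s 1 assms(4-6) by (simp add: arcs_upto_def)
    next
      case 2
      then show ?thesis using assms(4-6) a head e by simp
    next
      case 3
      then show ?thesis using assms(4-6) a head[of "ev k"] e
        by (simp add: pred_arc.simps(2)[of _ _ "Suc (k + k)"])
    qed
    then show "s' ''dst'' b = adst b" "s' ''eid'' b = eid b" "s' ''nxt'' b = pred_arc asrc (asrc b) b"
      by auto
  qed
qed

text \<open>\<open>head\<close> has to be 0 everywhere at the start: 0 marks the end of a list, arcs
  being numbered from 1.\<close>

lemma run_build:
  assumes "has_input s" "s ''head'' = (\<lambda>_. 0)"
  shows "run build s (150 * m + 10) (arcs_upto m)"
  unfolding build_def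
proof (rule run_For[where N=m and I="\<lambda>k s. has_input s \<and> arcs_upto k s" and B=136])
  show "has_input (upd s ''j'' 0 0) \<and> arcs_upto 0 (upd s ''j'' 0 0)"
    using assms by (auto simp: has_input_def arcs_upto_def pred_arc.simps)
next
  fix k s
  assume k: "k < m" "s ''j'' 0 = k" and s: "has_input s \<and> arcs_upto k s"
  show "run (link (Plus (Plus (Var ''j'') (Var ''j'')) (Const 1)) (end1 (Var ''j'')) (end2 (Var ''j'')) ;;
      link (Plus (Plus (Var ''j'') (Var ''j'')) (Const 2)) (end2 (Var ''j'')) (end1 (Var ''j''))) s 136
    (\<lambda>s'. s' ''j'' 0 = k \<and> has_input (upd s' ''j'' 0 (Suc k)) \<and> arcs_upto (Suc k) (upd s' ''j'' 0 (Suc k)))"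
    by (rule run_straight)
      (use k s edge_ends[OF k(1)] in \<open>auto simp: link_def intro!: arcs_upto_Suc[of "s ''j'' 0" s]\<close>)
qed (use assms in \<open>auto simp: has_input_header\<close>)

end

abbreviation arc_end :: aexp where
  "arc_end \<equiv> Cell ''dst'' (Var ''p'')"

abbreviation queue_head :: aexp where
  "queue_head \<equiv> Cell ''q'' (Var ''qh'')"

definition bfs_visit :: com where
  "bfs_visit =
    (Assign ''d'' arc_end (Plus (Cell ''d'' queue_head) (Const 1)) ;;
     Cond (Pos (Var ''qh'')) (Assign ''br'' arc_end (Cell ''br'' queue_head)) (Assign ''br'' arc_end arc_end) ;;
     Assign ''q'' (Var ''qt'') arc_end ;;
     Inc ''qt'')"

text \<open>One loop in place of two nested ones: an iteration handles one arc or moves on to the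
  next queue vertex. Deleted edges are skipped by means of \<open>del\<close>, so the adjacency
  lists are built only once.\<close>

definition bfs_body :: com where
  "bfs_body = Cond (Pos (Var ''p''))
     (Cond (Conj (Less (Cell ''del'' (Cell ''eid'' (Var ''p''))) (Const 1)) (Less (Cell ''d'' arc_end) (Const 1)))
        bfs_visit Skip ;;
      ''p'' ::= Cell ''nxt'' (Var ''p''))
     (Inc ''qh'' ;; ''p'' ::= Cell ''head'' queue_head)"

definition bfs :: com where
  "bfs =
    (For ''i'' vertex_number (Assign ''d'' (Var ''i'') (Const 0)) ;;
     (Assign ''d'' (Var ''src'') (Const 1) ;; ''q'' ::= Var ''src'' ;; ''qh'' ::= Const 0 ;;
      ''qt'' ::= Const 1 ;; ''p'' ::= Cell ''head'' (Var ''src'')) ;;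
     While (Less (Var ''qh'') (Var ''qt'')) bfs_body)"

lemma written_bfs [simp]: "written bfs = {''i'', ''d'', ''q'', ''qh'', ''qt'', ''p'', ''br''}"
  by (auto simp: bfs_def bfs_body_def bfs_visit_def)

context spanner_instance
begin

definition alive_edges :: "(nat \<Rightarrow> nat) \<Rightarrow> nat set set" where
  "alive_edges del = edge_at I ` {j. j < m \<and> del j = 0}"

lemma alive_edges_arcs:
  "{x, y} \<in> alive_edges del \<longleftrightarrow> (\<exists>a\<in>{1..2 * m}. del (eid a) = 0 \<and> asrc a = x \<and> adst a = y)"
proof
  assume "{x, y} \<in> alive_edges del"
  then obtain j where j: "j < m" "del j = 0" "{x, y} = {eu j, ev j}"
    by (auto simp: alive_edges_def edge_at_eq)
  have a: "eid (2 * j + 1) = j" "eid (2 * j + 2) = j" "asrc (2 * j + 1) = eu j"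
    "asrc (2 * j + 2) = ev j" "adst (2 * j + 1) = ev j" "adst (2 * j + 2) = eu j"
    by (simp_all add: asrc_def adst_def eid_def)
  from j(3) consider "x = eu j" "y = ev j" | "x = ev j" "y = eu j" by (auto simp: doubleton_eq_iff)
  then show "\<exists>a\<in>{1..2 * m}. del (eid a) = 0 \<and> asrc a = x \<and> adst a = y"
  proof cases
    case 1
    then show ?thesis using j a by (intro bexI[of _ "2 * j + 1"]) auto
  next
    case 2
    then show ?thesis using j a by (intro bexI[of _ "2 * j + 2"]) auto
  qed
next
  assume "\<exists>a\<in>{1..2 * m}. del (eid a) = 0 \<and> asrc a = x \<and> adst a = y"
  then obtain a where a: "a \<in> {1..2 * m}" "del (eid a) = 0" "asrc a = x" "adst a = y" by blast
  have "eid a < m" using a(1) by (auto simp: eid_def)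
  moreover have "{x, y} = edge_at I (eid a)"
    using a(3,4) by (auto simp: edge_at_eq asrc_def adst_def split: if_splits)
  ultimately show "{x, y} \<in> alive_edges del" using a(2) by (auto simp: alive_edges_def)
qed

lemma arc_ends: "\<forall>a\<in>{1..2 * m}. asrc a < n \<and> adst a < n"
proof
  fix a assume "a \<in> {1..2 * m}"
  then have "eid a < m" by (auto simp: eid_def)
  then show "asrc a < n \<and> adst a < n" using edge_ends by (simp add: asrc_def adst_def)
qed

abbreviation bfs_state :: "(nat \<Rightarrow> nat) \<Rightarrow> nat \<Rightarrow> state \<Rightarrow> bool" where
  "bfs_state del u s \<equiv> bfs_inv n (2 * m) asrc adst (\<lambda>a. del (eid a) = 0) u (s ''d'') (s ''br'')
     (s ''q'') (s ''qh'' 0) (s ''qt'' 0) (s ''p'' 0)"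

abbreviation bfs_rest :: "state \<Rightarrow> nat" where
  "bfs_rest s \<equiv> bfs_todo n (2 * m) asrc (s ''q'') (s ''qh'' 0) (s ''qt'' 0) (s ''p'' 0)"

lemma run_bfs_body:
  assumes adj: "arcs_upto m s" and u: "u < n" and inv: "bfs_state (s ''del'') u s"
    and act: "s ''qh'' 0 < s ''qt'' 0"
  shows "run bfs_body s 80 (\<lambda>s'. bfs_state (s ''del'') u s' \<and> bfs_rest s' < bfs_rest s)"
proof -
  let ?p = "s ''p'' 0" and ?q = "s ''q'' (s ''qh'' 0)"
  note facts = bfs_facts[OF inv act arc_ends u]
  note rules = bfs_inv_visit[OF inv act arc_ends u] bfs_inv_advance[OF inv act arc_ends u]
    bfs_inv_pop[OF inv act arc_ends u]
  have arc: "s ''dst'' ?p = adst ?p" "s ''eid'' ?p = eid ?p" "s ''nxt'' ?p = pred_arc asrc ?q ?p"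
    if "0 < ?p"
    using adj facts(8,9) that by (simp_all add: arcs_upto_def)
  show ?thesis
    unfolding bfs_body_def
  proof (rule run_Cond[where T=70])
    assume "bval (Pos (Var ''p'')) s"
    then have p: "0 < ?p" by simp
    show "run (Cond (Conj (Less (Cell ''del'' (Cell ''eid'' (Var ''p''))) (Const 1)) (Less (Cell ''d'' arc_end) (Const 1)))
        bfs_visit Skip ;; ''p'' ::= Cell ''nxt'' (Var ''p'')) s 70
      (\<lambda>s'. bfs_state (s ''del'') u s' \<and> bfs_rest s' < bfs_rest s)"
    proof (intro run_straight)
      let ?body = "Cond (Conj (Less (Cell ''del'' (Cell ''eid'' (Var ''p''))) (Const 1)) (Less (Cell ''d'' arc_end) (Const 1)))
        bfs_visit Skip ;; ''p'' ::= Cell ''nxt'' (Var ''p'')"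
      show "straight ?body" "ccost ?body \<le> 70" by (simp_all add: bfs_visit_def)
      show "bfs_state (s ''del'') u (eff ?body s) \<and> bfs_rest (eff ?body s) < bfs_rest s"
      proof (cases "s ''del'' (eid ?p) = 0 \<and> s ''d'' (adst ?p) = 0")
        case True
        then have inv': "bfs_inv n (2 * m) asrc adst (\<lambda>a. s ''del'' (eid a) = 0) u
            ((s ''d'')(adst ?p := Suc (s ''d'' ?q)))
            ((s ''br'')(adst ?p := (if s ''qh'' 0 = 0 then adst ?p else s ''br'' ?q)))
            ((s ''q'')(s ''qt'' 0 := adst ?p)) (s ''qh'' 0) (Suc (s ''qt'' 0)) ?p"
          using rules(1)[OF p] by blast
        have act': "s ''qh'' 0 < Suc (s ''qt'' 0)" using act by simp
        note adv = bfs_inv_advance[OF inv' act' arc_ends u p, unfolded bfs_todo_snoc[OF act]]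
        show ?thesis
          using True act arc[OF p] adv by (auto simp: bfs_visit_def bfs_todo_snoc)
      next
        case False
        then have "eff ?body s = upd s ''p'' 0 (pred_arc asrc ?q ?p)" using arc[OF p] by auto
        then show ?thesis using rules(2,3)[OF p] False by auto
      qed
    qed
  next
    assume "\<not> bval (Pos (Var ''p'')) s"
    then have p: "?p = 0" by simp
    have "s ''head'' (s ''q'' (Suc (s ''qh'' 0))) = pred_arc asrc (s ''q'' (Suc (s ''qh'' 0))) (Suc (2 * m))"
      if "Suc (s ''qh'' 0) < s ''qt'' 0"
      using adj queued[OF inv act arc_ends u that] by (simp add: arcs_upto_def)
    then show "run (Inc ''qh'' ;; ''p'' ::= Cell ''head'' queue_head) s 70
      (\<lambda>s'. bfs_state (s ''del'') u s' \<and> bfs_rest s' < bfs_rest s)"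
      by (intro run_straight) (use rules(4,5) p in simp_all)
  qed simp
qed

lemma run_bfs:
  assumes inp: "has_input s" and adj: "arcs_upto m s" and u: "s ''src'' 0 = u" "u < n"
  shows "run bfs s (200 * (n + m + 1))
    (\<lambda>s'. bfs_tree {..<n} (alive_edges (s ''del'')) u (s' ''d'') (s' ''br''))"
  unfolding bfs_def
proof (rule run_Seq[where T="20 * n + 10" and U="180 * (n + m + 1)" and Q="\<lambda>s'. \<forall>v<n. s' ''d'' v = 0"])
  show "run (For ''i'' vertex_number (Assign ''d'' (Var ''i'') (Const 0))) s (20 * n + 10)
    (\<lambda>s'. \<forall>v<n. s' ''d'' v = 0)"
  proof (rule run_For[where N=n and B=4 and I="\<lambda>k s'. has_input s' \<and> (\<forall>v<k. s' ''d'' v = 0)"])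
    fix k s' assume "k < n" "s' ''i'' 0 = k" "has_input s' \<and> (\<forall>v<k. s' ''d'' v = 0)"
    then show "run (Assign ''d'' (Var ''i'') (Const 0)) s' 4 (\<lambda>s'. s' ''i'' 0 = k \<and>
        has_input (upd s' ''i'' 0 (Suc k)) \<and> (\<forall>v<Suc k. upd s' ''i'' 0 (Suc k) ''d'' v = 0))"
      by (intro run_straight) (auto simp: less_Suc_eq)
  qed (use inp in \<open>auto simp: has_input_header\<close>)
next
  let ?init = "Assign ''d'' (Var ''src'') (Const 1) ;; ''q'' ::= Var ''src'' ;; ''qh'' ::= Const 0 ;;
      ''qt'' ::= Const 1 ;; ''p'' ::= Cell ''head'' (Var ''src'')"
  fix s1 assume s1: "\<forall>v<n. s1 ''d'' v = 0"
    and fr: "\<And>x. x \<notin> written (For ''i'' vertex_number (Assign ''d'' (Var ''i'') (Const 0))) \<Longrightarrow> s1 x = s x"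
  have adj1: "arcs_upto m s1" using adj by (rule arcs_upto_cong) (auto intro!: fr)
  have del1: "s1 ''del'' = s ''del''" and src1: "s1 ''src'' 0 = u" using u fr by auto
  have head1: "s1 ''head'' u = pred_arc asrc u (Suc (2 * m))" using adj1 u by (simp add: arcs_upto_def)
  have st: "bfs_state (s ''del'') u (eff ?init s1)"
    using src1 head1 s1 u(2) by simp (rule bfs_inv_init, auto)
  show "run (?init ;; While (Less (Var ''qh'') (Var ''qt'')) bfs_body) s1 (180 * (n + m + 1))
    (\<lambda>s'. bfs_tree {..<n} (alive_edges (s ''del'')) u (s' ''d'') (s' ''br''))"
  proof (rule run_Seq[where T=30 and U="180 * (n + m) + 60" and Q="\<lambda>s'. s' = eff ?init s1"])
    show "run ?init s1 30 (\<lambda>s'. s' = eff ?init s1)" by (rule run_straight) auto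
    fix s2 assume s2: "s2 = eff ?init s1"
    show "run (While (Less (Var ''qh'') (Var ''qt'')) bfs_body) s2 (180 * (n + m) + 60)
      (\<lambda>s'. bfs_tree {..<n} (alive_edges (s ''del'')) u (s' ''d'') (s' ''br''))"
    proof (rule run_While[where B=80 and k="bfs_rest s2"
          and I="\<lambda>k s'. k = bfs_rest s' \<and> arcs_upto m s' \<and> s' ''del'' = s ''del'' \<and> bfs_state (s ''del'') u s'"])
      fix k s' assume k: "k = bfs_rest s' \<and> arcs_upto m s' \<and> s' ''del'' = s ''del'' \<and> bfs_state (s ''del'') u s'"
        and "bval (Less (Var ''qh'') (Var ''qt'')) s'"
      then have "run bfs_body s' 80 (\<lambda>s''. bfs_state (s' ''del'') u s'' \<and> bfs_rest s'' < bfs_rest s')"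
        using run_bfs_body[of s' u] u by simp
      then show "run bfs_body s' 80 (\<lambda>s''. \<exists>k'<k. k' = bfs_rest s'' \<and> arcs_upto m s'' \<and>
          s'' ''del'' = s ''del'' \<and> bfs_state (s ''del'') u s'')"
      proof (rule run_mono)
        fix s'' assume "bfs_state (s' ''del'') u s'' \<and> bfs_rest s'' < bfs_rest s'"
          and fr: "\<And>x. x \<notin> written bfs_body \<Longrightarrow> s'' x = s' x"
        moreover have "arcs_upto m s''"
          using k by (auto intro!: arcs_upto_cong[of m s'] fr simp: bfs_body_def bfs_visit_def)
        moreover have "s'' ''del'' = s' ''del''" by (rule fr) (simp add: bfs_body_def bfs_visit_def)
        ultimately show "\<exists>k'<k. k' = bfs_rest s'' \<and> arcs_upto m s'' \<and>
          s'' ''del'' = s ''del'' \<and> bfs_state (s ''del'') u s''" using k by simp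
      qed simp
    next
      fix k s' assume k: "k = bfs_rest s' \<and> arcs_upto m s' \<and> s' ''del'' = s ''del'' \<and> bfs_state (s ''del'') u s'"
        and b: "\<not> bval (Less (Var ''qh'') (Var ''qt'')) s'"
      show "bfs_tree {..<n} (alive_edges (s ''del'')) u (s' ''d'') (s' ''br'')"
        by (rule bfs_inv_final[where M="2 * m" and alive="\<lambda>a. s ''del'' (eid a) = 0"])
          (use k b arc_ends u alive_edges_arcs in auto)
    next
      show "bfs_rest s2 = bfs_rest s2 \<and> arcs_upto m s2 \<and> s2 ''del'' = s ''del'' \<and> bfs_state (s ''del'') u s2"
        using st adj1 del1 unfolding s2 by (simp del: One_nat_def)
      \<comment> \<open>There are at most \<open>n + 2 * m\<close> iterations, each of cost 86
        including the loop test.\<close>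
      show "bfs_rest s2 * (80 + bcost (Less (Var ''qh'') (Var ''qt'')) + 1) + bcost (Less (Var ''qh'') (Var ''qt'')) + 1
        \<le> 180 * (n + m) + 60"
        using bfs_todo_le[of n "2 * m" asrc "s2 ''q''" "s2 ''qh'' 0" "s2 ''qt'' 0" "s2 ''p'' 0"] by simp
    qed
  qed simp
qed simp

end

section \<open>Removable edges\<close>

abbreviation Equal :: "aexp \<Rightarrow> aexp \<Rightarrow> bexp" where
  "Equal e f \<equiv> Conj (Neg (Less e f)) (Neg (Less f e))"

text \<open>Division by repeated subtraction. Its \<open>radius\<close> rounds are later charged to
  \<open>\<alpha> ^ (2 * W)\<close>; this code runs only if \<open>0 < W\<close>.\<close>

definition floor_stretch :: com where
  "floor_stretch =
     ((''x'' ::= Cell ''in'' (Const 4) ;; ''a'' ::= Const 0) ;;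
      While (Neg (Less (Var ''x'') (Cell ''in'' (Const 5))))
        (''x'' ::= Minus (Var ''x'') (Cell ''in'' (Const 5)) ;; Inc ''a''))"

definition compute_cap :: com where
  "compute_cap = (''K'' ::= Const 0 ;;
     For ''i'' target_weight (''K'' ::= Plus (Var ''K'') (Plus (Var ''a'') (Plus (Var ''a'') (Const 1)))))"

text \<open>
  The stamp \<open>u + 1\<close> in bank \<open>mk\<close> marks the neighbours \<open>v\<close> of \<open>u\<close> that have a short detour; stamps
  of earlier roots need not be erased.
\<close>

definition scan_edges :: com where
  "scan_edges = For ''j'' edge_number
     (Cond (Conj (Conj (Neg (Equal (end1 (Var ''j'')) (Var ''u''))) (Neg (Equal (end2 (Var ''j'')) (Var ''u''))))
           (Conj (Neg (Equal (Cell ''br'' (end1 (Var ''j''))) (Cell ''br'' (end2 (Var ''j'')))))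
             (Less (Plus (Cell ''d'' (end1 (Var ''j''))) (Cell ''d'' (end2 (Var ''j'')))) (Plus (Var ''a'') (Const 3)))))
        (Assign ''mk'' (Cell ''br'' (end1 (Var ''j''))) (Plus (Var ''u'') (Const 1)) ;;
         Assign ''mk'' (Cell ''br'' (end2 (Var ''j''))) (Plus (Var ''u'') (Const 1)))
        Skip)"

text \<open>Every edge is decided in the round of its first end, and only there.\<close>

definition flag_edges :: com where
  "flag_edges = For ''j'' edge_number
     (Cond (Conj (Equal (end1 (Var ''j'')) (Var ''u''))
         (Equal (Cell ''mk'' (end2 (Var ''j''))) (Plus (Var ''u'') (Const 1))))
       (Assign ''rem'' (Var ''j'') (Const 1)) Skip)"

definition mark :: com where
  "mark = For ''u'' vertex_number (''src'' ::= Var ''u'' ;; bfs ;; scan_edges ;; flag_edges)"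

definition collect :: com where
  "collect = (''r'' ::= Const 0 ;;
     For ''j'' edge_number
      (Cond (Conj (Pos (Cell ''rem'' (Var ''j''))) (Conj (Pos (edge_weight (Var ''j''))) (Less (Var ''r'') (Var ''K''))))
        (Assign ''R'' (Var ''r'') (Var ''j'') ;; Inc ''r'') Skip))"

lemma written_prepare [simp]:
  "written floor_stretch = {''x'', ''a''}" "written compute_cap = {''K'', ''i''}"
  "written scan_edges = {''j'', ''mk''}" "written flag_edges = {''j'', ''rem''}"
  "written mark = {''u'', ''src'', ''j'', ''mk'', ''rem''} \<union> written bfs"
  "written collect = {''r'', ''j'', ''R''}"
  by (auto simp: floor_stretch_def compute_cap_def scan_edges_def flag_edges_def mark_def collect_def)

context spanner_instance
begin

definition "radius = num div den"
definition "cap = W * (2 * radius + 1)"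

definition removable :: "nat \<Rightarrow> bool" where
  "removable j \<longleftrightarrow> reach (edges I - {edge_at I j}) radius (eu j) (ev j)"

lemma quotient: "quotient_of (stretch I) = (int num, int den)" "0 < den"
proof -
  obtain a b where ab: "quotient_of (stretch I) = (a, b)" by fastforce
  then have b: "0 < b" using quotient_of_denom_pos by blast
  have "stretch I = of_int a / of_int b" using ab quotient_of_div by blast
  then have "rat_of_int a = stretch I * of_int b" using b by simp
  moreover have "0 < stretch I * of_int b" using stretch_ge_1 b by simp
  ultimately have "0 < a" by (metis of_int_0_less_iff)
  then show "quotient_of (stretch I) = (int num, int den)" "0 < den"
    using ab b by (simp_all add: num_def den_def)
qed

lemma radius_eq: "radius = nat \<lfloor>real_of_rat (stretch I)\<rfloor>"
proof -
  have "stretch I = of_int (int num) / of_int (int den)" using quotient(1) quotient_of_div by blast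
  then have "real_of_rat (stretch I) = real_of_int (int num) / real_of_int (int den)"
    by (simp add: of_rat_divide)
  then have "\<lfloor>real_of_rat (stretch I)\<rfloor> = int num div int den"
    by (simp only: floor_divide_of_int_eq)
  then show ?thesis by (simp add: radius_def zdiv_int[symmetric] del: of_nat_div)
qed

lemma run_floor_stretch:
  assumes "has_input s"
  shows "run floor_stretch s (30 * (radius + 1)) (\<lambda>s'. s' ''a'' 0 = radius)"
  unfolding floor_stretch_def
proof (rule run_Seq[where T=12 and U="25 * radius + 12"])
  let ?init = "''x'' ::= Cell ''in'' (Const 4) ;; ''a'' ::= Const 0"
  show "run ?init s 12 (\<lambda>s'. s' = eff ?init s)" by (rule run_straight) auto
  fix s1 assume s1: "s1 = eff ?init s"
  show "run (While (Neg (Less (Var ''x'') (Cell ''in'' (Const 5))))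
        (''x'' ::= Minus (Var ''x'') (Cell ''in'' (Const 5)) ;; Inc ''a'')) s1 (25 * radius + 12)
     (\<lambda>s'. s' ''a'' 0 = radius)"
  proof (rule run_While[where B=15 and k=radius and
        I="\<lambda>k s. has_input s \<and> k = s ''x'' 0 div den \<and> k + s ''a'' 0 = radius"])
    fix k s assume k: "has_input s \<and> k = s ''x'' 0 div den \<and> k + s ''a'' 0 = radius"
      and "bval (Neg (Less (Var ''x'') (Cell ''in'' (Const 5)))) s"
    then have ge: "den \<le> s ''x'' 0" by (simp add: has_input_header)
    have "s ''x'' 0 div den = Suc ((s ''x'' 0 - den) div den)" using ge quotient(2) by (simp add: le_div_geq)
    then show "run (''x'' ::= Minus (Var ''x'') (Cell ''in'' (Const 5)) ;; Inc ''a'') s 15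
      (\<lambda>s'. \<exists>k'<k. has_input s' \<and> k' = s' ''x'' 0 div den \<and> k' + s' ''a'' 0 = radius)"
      using k by (intro run_straight) (simp_all add: has_input_header)
  next
    fix k s assume "has_input s \<and> k = s ''x'' 0 div den \<and> k + s ''a'' 0 = radius"
      and "\<not> bval (Neg (Less (Var ''x'') (Cell ''in'' (Const 5)))) s"
    then show "s ''a'' 0 = radius" by (simp add: has_input_header)
  qed (use assms in \<open>simp_all add: s1 has_input_header radius_def\<close>)
qed simp

lemma run_compute_cap:
  assumes "has_input s" "s ''a'' 0 = radius"
  shows "run compute_cap s (30 * (W + 1)) (\<lambda>s'. s' ''K'' 0 = cap)"
  unfolding compute_cap_def
proof (rule run_Seq[where T=3 and U="30 * W + 10"])
  let ?init = "''K'' ::= Const 0"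
  show "run ?init s 3 (\<lambda>s'. s' = eff ?init s)" by (rule run_straight) auto
  fix s1 assume s1: "s1 = eff ?init s"
  show "run (For ''i'' target_weight (''K'' ::= Plus (Var ''K'') (Plus (Var ''a'') (Plus (Var ''a'') (Const 1)))))
      s1 (30 * W + 10) (\<lambda>s'. s' ''K'' 0 = cap)"
  proof (rule run_For[where N=W and B=15 and
        I="\<lambda>k s. has_input s \<and> s ''a'' 0 = radius \<and> s ''K'' 0 = k * (2 * radius + 1)"])
    fix k s assume "s ''i'' 0 = k" "has_input s \<and> s ''a'' 0 = radius \<and> s ''K'' 0 = k * (2 * radius + 1)"
    then show "run (''K'' ::= Plus (Var ''K'') (Plus (Var ''a'') (Plus (Var ''a'') (Const 1)))) s 15
      (\<lambda>s'. s' ''i'' 0 = k \<and> has_input (upd s' ''i'' 0 (Suc k)) \<and>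
        upd s' ''i'' 0 (Suc k) ''a'' 0 = radius \<and>
        upd s' ''i'' 0 (Suc k) ''K'' 0 = Suc k * (2 * radius + 1))"
      by (intro run_straight) auto
  qed (use assms in \<open>auto simp: s1 has_input_header cap_def\<close>)
qed simp

text \<open>The criterion of \<open>bfs_tree_detour\<close> seen from the crossing edge: an edge
  between two subtrees certifies a detour for the top vertices of both, so one pass over the edges
  serves all neighbours of \<open>u\<close>.\<close>

definition detour :: "nat \<Rightarrow> (nat \<Rightarrow> nat) \<Rightarrow> (nat \<Rightarrow> nat) \<Rightarrow> nat \<Rightarrow> nat \<Rightarrow> bool" where
  "detour u d br j v \<longleftrightarrow> eu j \<noteq> u \<and> ev j \<noteq> u \<and> br (eu j) \<noteq> br (ev j) \<and>
     d (eu j) + d (ev j) \<le> radius + 2 \<and> (v = br (eu j) \<or> v = br (ev j))"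

lemma removable_iff_detour:
  assumes t: "bfs_tree {..<n} (edges I) u d br" and j: "j < m" and u: "eu j = u"
  shows "removable j \<longleftrightarrow> (\<exists>i<m. detour u d br i (ev j))"
proof -
  have un: "u < n" using edge_ends[OF j] u by simp
  \<comment> \<open>Connectivity makes all labels positive, as \<open>bfs_tree_detour\<close>
    requires.\<close>
  have pos: "\<forall>x\<in>{..<n}. 0 < d x"
  proof
    fix x assume x: "x \<in> {..<n}"
    then obtain p where "is_path {..<n} (edges I) u p x"
      using connected un unfolding connected_graph_def by blast
    then have "reach (edges I) (length p - 1) u x" by (rule path_imp_reach)
    then show "0 < d x" using bfs_tree_reach[OF t x] by blast
  qed
  have e: "{u, ev j} \<in> edges I" using j u edge_at_eq[of j] by (auto simp: edges_def)
  have "removable j \<longleftrightarrow> reach (edges I - {{u, ev j}}) radius u (ev j)"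
    using u by (simp add: removable_def edge_at_eq)
  also have "\<dots> \<longleftrightarrow> (\<exists>x y. {x, y} \<in> edges I \<and> x \<noteq> u \<and> y \<noteq> u \<and> br x \<noteq> ev j \<and> br y = ev j \<and>
      d x + d y \<le> radius + 2)"
    using un by (intro bfs_tree_detour[OF t pos _ simple e]) auto
  also have "\<dots> \<longleftrightarrow> (\<exists>i<m. detour u d br i (ev j))"
  proof
    assume "\<exists>x y. {x, y} \<in> edges I \<and> x \<noteq> u \<and> y \<noteq> u \<and> br x \<noteq> ev j \<and> br y = ev j \<and> d x + d y \<le> radius + 2"
    then obtain x y i where xy: "i < m" "{x, y} = {eu i, ev i}" "x \<noteq> u" "y \<noteq> u" "br x \<noteq> ev j"
      "br y = ev j" "d x + d y \<le> radius + 2" by (auto simp: edges_def edge_at_eq)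
    then have "detour u d br i (ev j)" by (auto simp: detour_def doubleton_eq_iff)
    then show "\<exists>i<m. detour u d br i (ev j)" using xy(1) by blast
  next
    assume "\<exists>i<m. detour u d br i (ev j)"
    then obtain i where i: "i < m" "detour u d br i (ev j)" by blast
    then have "{eu i, ev i} \<in> edges I" using edge_at_eq[of i] by (auto simp: edges_def)
    moreover from this have "{ev i, eu i} \<in> edges I" by (simp add: insert_commute)
    ultimately show "\<exists>x y. {x, y} \<in> edges I \<and> x \<noteq> u \<and> y \<noteq> u \<and> br x \<noteq> ev j \<and> br y = ev j \<and>
        d x + d y \<le> radius + 2"
      using i(2) unfolding detour_def by (metis add.commute)
  qed
  finally show ?thesis .
qed

lemma run_scan_edges:
  assumes "has_input s" "s ''u'' 0 = u" "s ''a'' 0 = radius" "\<forall>v. s ''mk'' v \<le> u"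
  shows "run scan_edges s (250 * m + 10) (\<lambda>s'. \<forall>v. s' ''mk'' v \<le> Suc u \<and>
    (s' ''mk'' v = Suc u \<longleftrightarrow> (\<exists>j<m. detour u (s ''d'') (s ''br'') j v)))"
  unfolding scan_edges_def
proof (rule run_For[where N=m and B=230 and
      I="\<lambda>k s'. has_input s' \<and> s' ''u'' 0 = u \<and> s' ''a'' 0 = radius \<and> s' ''d'' = s ''d'' \<and> s' ''br'' = s ''br'' \<and>
        (\<forall>v. s' ''mk'' v \<le> Suc u \<and>
          (s' ''mk'' v = Suc u \<longleftrightarrow> (\<exists>j<k. detour u (s ''d'') (s ''br'') j v)))"],
      goal_cases)
  case 1
  \<comment> \<open>The stamp is \<open>u + 1\<close> and not \<open>u\<close>, so that the initial
    zeros do not count as stamps of vertex 0.\<close>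
  have "s ''mk'' v \<noteq> Suc u \<and> s ''mk'' v \<le> Suc u" for v using assms(4) by (metis Suc_n_not_le_n le_SucI)
  then show ?case using assms by auto
next
  case (2 k s')
  then show ?case
    by (intro run_straight) (auto simp: detour_def less_Suc_eq)
qed (use assms in \<open>auto simp: has_input_header\<close>)

lemma run_flag_edges:
  assumes "has_input s" "s ''u'' 0 = u"
    "\<And>j. j < m \<Longrightarrow> eu j = u \<Longrightarrow> s ''mk'' (ev j) = Suc u \<longleftrightarrow> removable j"
    "\<forall>j<m. 0 < s ''rem'' j \<longleftrightarrow> eu j < u \<and> removable j"
  shows "run flag_edges s (120 * m + 10) (\<lambda>s'. \<forall>j<m. 0 < s' ''rem'' j \<longleftrightarrow> eu j < Suc u \<and> removable j)"
  unfolding flag_edges_def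
proof (rule run_For[where N=m and B=100 and
      I="\<lambda>k s'. has_input s' \<and> s' ''u'' 0 = u \<and> s' ''mk'' = s ''mk'' \<and>
        (\<forall>j<m. 0 < s' ''rem'' j \<longleftrightarrow> (eu j < u \<or> eu j = u \<and> j < k) \<and> removable j)"],
      goal_cases)
  case (2 k s')
  then show ?case
    using assms(3)[of k] by (intro run_straight) (auto simp: less_Suc_eq)
qed (use assms in \<open>auto simp: has_input_header\<close>)

lemma alive_edges_all: "alive_edges (\<lambda>_. 0) = edges I"
  by (auto simp: alive_edges_def edges_def)

lemma run_mark:
  assumes "has_input s" "arcs_upto m s" "s ''a'' 0 = radius" "s ''del'' = (\<lambda>_. 0)"
    "s ''mk'' = (\<lambda>_. 0)" "s ''rem'' = (\<lambda>_. 0)"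
  shows "run mark s (600 * n * (n + m + 1) + 10) (\<lambda>s'. \<forall>j<m. 0 < s' ''rem'' j \<longleftrightarrow> removable j)"
  unfolding mark_def
proof (rule run_For[where N=n and B="580 * (n + m + 1)" and
      I="\<lambda>k s'. has_input s' \<and> arcs_upto m s' \<and> s' ''a'' 0 = radius \<and> s' ''del'' = (\<lambda>_. 0) \<and>
        (\<forall>v. s' ''mk'' v \<le> k) \<and> (\<forall>j<m. 0 < s' ''rem'' j \<longleftrightarrow> eu j < k \<and> removable j)"],
      goal_cases)
  case (2 u s)
  note inv = this
  show ?case
  proof (rule run_Seq[where T=4 and U="570 * (n + m + 1) + 6"])
    show "run (''src'' ::= Var ''u'') s 4 (\<lambda>s'. s' ''src'' 0 = u)"
      using inv by (intro run_straight) auto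
    fix s1 assume s1: "s1 ''src'' 0 = u"
      and fr1: "\<And>x. x \<notin> written (''src'' ::= Var ''u'') \<Longrightarrow> s1 x = s x"
    have e1: "has_input s1" "arcs_upto m s1" "s1 ''del'' = (\<lambda>_. 0)" "s1 ''u'' = s ''u''"
      "s1 ''mk'' = s ''mk''" "s1 ''a'' = s ''a''" "s1 ''rem'' = s ''rem''"
      using inv by (auto simp: fr1 has_input_def intro: arcs_upto_cong)
    show "run (bfs ;; scan_edges ;; flag_edges) s1 (570 * (n + m + 1) + 6) (\<lambda>s'. s' ''u'' 0 = u \<and>
        has_input (upd s' ''u'' 0 (Suc u)) \<and> arcs_upto m (upd s' ''u'' 0 (Suc u)) \<and>
        upd s' ''u'' 0 (Suc u) ''a'' 0 = radius \<and> upd s' ''u'' 0 (Suc u) ''del'' = (\<lambda>_. 0) \<and>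
        (\<forall>v. upd s' ''u'' 0 (Suc u) ''mk'' v \<le> Suc u) \<and>
        (\<forall>j<m. (0 < upd s' ''u'' 0 (Suc u) ''rem'' j) = (eu j < Suc u \<and> removable j)))"
    proof (rule run_Seq[OF run_bfs[OF e1(1,2) s1 inv(1)], where U="370 * m + 20"])
      fix s2 assume t: "bfs_tree {..<n} (alive_edges (s1 ''del'')) u (s2 ''d'') (s2 ''br'')"
        and fr2: "\<And>x. x \<notin> written bfs \<Longrightarrow> s2 x = s1 x"
      have t: "bfs_tree {..<n} (edges I) u (s2 ''d'') (s2 ''br'')"
        using t e1(3) alive_edges_all by simp
      have e2: "has_input s2" "s2 ''u'' 0 = u" "s2 ''a'' 0 = radius" "\<forall>v. s2 ''mk'' v \<le> u"
        using e1 inv by (auto simp: fr2 has_input_def)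
      have e2': "arcs_upto m s2" "s2 ''del'' = (\<lambda>_. 0)" "s2 ''rem'' = s ''rem''"
        using e1 by (auto simp: fr2 intro: arcs_upto_cong)
      show "run (scan_edges ;; flag_edges) s2 (370 * m + 20) (\<lambda>s'. s' ''u'' 0 = u \<and>
        has_input (upd s' ''u'' 0 (Suc u)) \<and> arcs_upto m (upd s' ''u'' 0 (Suc u)) \<and>
        upd s' ''u'' 0 (Suc u) ''a'' 0 = radius \<and> upd s' ''u'' 0 (Suc u) ''del'' = (\<lambda>_. 0) \<and>
        (\<forall>v. upd s' ''u'' 0 (Suc u) ''mk'' v \<le> Suc u) \<and>
        (\<forall>j<m. (0 < upd s' ''u'' 0 (Suc u) ''rem'' j) = (eu j < Suc u \<and> removable j)))"
      proof (rule run_Seq[OF run_scan_edges[OF e2], where U="120 * m + 10"])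
        fix s3 assume mk: "\<forall>v. s3 ''mk'' v \<le> Suc u \<and>
            (s3 ''mk'' v = Suc u \<longleftrightarrow> (\<exists>j<m. detour u (s2 ''d'') (s2 ''br'') j v))"
          and fr3: "\<And>x. x \<notin> written scan_edges \<Longrightarrow> s3 x = s2 x"
        have e3: "has_input s3" "s3 ''u'' 0 = u" "arcs_upto m s3" "s3 ''del'' = (\<lambda>_. 0)"
          "s3 ''rem'' = s ''rem''" "s3 ''a'' 0 = radius"
          using e2 e2' by (auto simp: fr3 has_input_def intro: arcs_upto_cong)
        have "run flag_edges s3 (120 * m + 10) (\<lambda>s'. \<forall>j<m. 0 < s' ''rem'' j \<longleftrightarrow> eu j < Suc u \<and> removable j)"
          using mk removable_iff_detour[OF t] e3 inv by (intro run_flag_edges) auto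
        then show "run flag_edges s3 (120 * m + 10) (\<lambda>s'. s' ''u'' 0 = u \<and>
          has_input (upd s' ''u'' 0 (Suc u)) \<and> arcs_upto m (upd s' ''u'' 0 (Suc u)) \<and>
          upd s' ''u'' 0 (Suc u) ''a'' 0 = radius \<and> upd s' ''u'' 0 (Suc u) ''del'' = (\<lambda>_. 0) \<and>
          (\<forall>v. upd s' ''u'' 0 (Suc u) ''mk'' v \<le> Suc u) \<and>
          (\<forall>j<m. (0 < upd s' ''u'' 0 (Suc u) ''rem'' j) = (eu j < Suc u \<and> removable j)))"
          by (rule run_mono) (use mk e3 in \<open>auto simp: has_input_def intro: arcs_upto_cong\<close>)
      qed simp
    qed simp
  qed simp
qed (use assms edge_ends in \<open>auto simp: has_input_header algebra_simps\<close>)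

text \<open>Positive weights guarantee that any \<open>W\<close> candidates together reach the
  target.\<close>

definition candidates :: "nat \<Rightarrow> nat list" where
  "candidates k = filter (\<lambda>j. removable j \<and> 0 < ew j) [0..<k]"

definition pool :: "nat list" where
  "pool = take cap (candidates m)"

lemma run_collect:
  assumes "has_input s" "s ''K'' 0 = cap" "\<forall>j<m. 0 < s ''rem'' j \<longleftrightarrow> removable j"
  shows "run collect s (100 * m + 20) (\<lambda>s'. s' ''r'' 0 = length pool \<and> (\<forall>i<length pool. s' ''R'' i = pool ! i))"
  unfolding collect_def
proof (rule run_Seq[where T=3 and U="100 * m + 10"])
  let ?init = "''r'' ::= Const 0"
  show "run ?init s 3 (\<lambda>s'. s' = eff ?init s)" by (rule run_straight) auto
  fix s1 assume s1: "s1 = eff ?init s"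
  let ?c = "\<lambda>k. take cap (candidates k)"
  show "run (For ''j'' edge_number
      (Cond (Conj (Pos (Cell ''rem'' (Var ''j''))) (Conj (Pos (edge_weight (Var ''j''))) (Less (Var ''r'') (Var ''K''))))
        (Assign ''R'' (Var ''r'') (Var ''j'') ;; Inc ''r'') Skip)) s1 (100 * m + 10)
      (\<lambda>s'. s' ''r'' 0 = length pool \<and> (\<forall>i<length pool. s' ''R'' i = pool ! i))"
  proof (rule run_For[where N=m and B=80 and
        I="\<lambda>k s'. has_input s' \<and> s' ''K'' 0 = cap \<and> s' ''rem'' = s ''rem'' \<and>
          s' ''r'' 0 = length (?c k) \<and> (\<forall>i<length (?c k). s' ''R'' i = ?c k ! i)"], goal_cases)
    case (2 k s')
    note inv = this
    show ?case
    proof (rule run_Cond[where T=40])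
      assume "bval (Conj (Pos (Cell ''rem'' (Var ''j'')))
        (Conj (Pos (edge_weight (Var ''j''))) (Less (Var ''r'') (Var ''K'')))) s'"
      then have "?c (Suc k) = ?c k @ [k]" using inv assms(3) by (auto simp: candidates_def)
      then show "run (Assign ''R'' (Var ''r'') (Var ''j'') ;; Inc ''r'') s' 40 (\<lambda>s'. s' ''j'' 0 = k \<and>
        has_input (upd s' ''j'' 0 (Suc k)) \<and> upd s' ''j'' 0 (Suc k) ''K'' 0 = cap \<and>
        upd s' ''j'' 0 (Suc k) ''rem'' = s ''rem'' \<and> upd s' ''j'' 0 (Suc k) ''r'' 0 = length (?c (Suc k)) \<and>
        (\<forall>i<length (?c (Suc k)). upd s' ''j'' 0 (Suc k) ''R'' i = ?c (Suc k) ! i))"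
        using inv by (intro run_straight) (auto simp: nth_append)
    next
      assume "\<not> bval (Conj (Pos (Cell ''rem'' (Var ''j'')))
        (Conj (Pos (edge_weight (Var ''j''))) (Less (Var ''r'') (Var ''K'')))) s'"
      then have "?c (Suc k) = ?c k" using inv assms(3) by (auto simp: candidates_def)
      then show "run Skip s' 40 (\<lambda>s'. s' ''j'' 0 = k \<and>
        has_input (upd s' ''j'' 0 (Suc k)) \<and> upd s' ''j'' 0 (Suc k) ''K'' 0 = cap \<and>
        upd s' ''j'' 0 (Suc k) ''rem'' = s ''rem'' \<and> upd s' ''j'' 0 (Suc k) ''r'' 0 = length (?c (Suc k)) \<and>
        (\<forall>i<length (?c (Suc k)). upd s' ''j'' 0 (Suc k) ''R'' i = ?c (Suc k) ! i))"
        using inv by (intro run_straight) auto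
    qed simp
  qed (use assms in \<open>auto simp: s1 has_input_header candidates_def pool_def\<close>)
qed simp

end

section \<open>The search space\<close>

context spanner_instance
begin

definition good :: "nat set \<Rightarrow> bool" where
  "good S \<longleftrightarrow> W \<le> (\<Sum>j\<in>S. ew j) \<and>
     (\<forall>j\<in>S. reach (edge_at I ` ({..<m} - S)) radius (eu j) (ev j))"

text \<open>Repeated positions collapse, so \<open>W\<close>-tuples also describe the smaller
  nonempty sets.\<close>

definition selection :: "(nat \<Rightarrow> nat) \<Rightarrow> nat set" where
  "selection t = (\<lambda>i. pool ! t i) ` {..<W}"

lemma edges_eq: "edges I = edge_at I ` {..<m}"
  by (simp add: edges_def)

lemma edges_diff:
  assumes "S \<subseteq> {..<m}"
  shows "edges I - edge_at I ` ({..<m} - S) = edge_at I ` S"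
proof -
  have "edge_at I ` ({..<m} - S) = edge_at I ` {..<m} - edge_at I ` S"
    using inj_edge assms by (intro inj_on_image_set_diff[where C="{..<m}"]) auto
  moreover have "edge_at I ` S \<subseteq> edges I" using assms by (auto simp: edges_eq)
  ultimately show ?thesis by (auto simp: edges_eq)
qed

lemma sum_weight_edges:
  assumes "S \<subseteq> {..<m}"
  shows "(\<Sum>e\<in>edge_at I ` S. weight I e) = (\<Sum>j\<in>S. ew j)"
  using assms inj_edge by (subst sum.reindex) (auto simp: ew_def intro: inj_on_subset)

lemma spanner_iff:
  assumes "F \<subseteq> edges I"
  shows "spanner (verts I) (edges I) (\<lambda>_. 1) (of_rat (stretch I)) F \<longleftrightarrow>
    (\<forall>u v. {u, v} \<in> edges I - F \<longrightarrow> reach F radius u v)"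
proof -
  have "1 \<le> real_of_rat (stretch I)" using stretch_ge_1 by simp
  from spanner_unit_iff[OF simple connected assms this] show ?thesis
    by (simp add: verts_def radius_eq)
qed

lemma good_imp_solution:
  assumes S: "S \<subseteq> {..<m}" and "good S"
  shows "unit_spanner_solution I (edge_at I ` ({..<m} - S))"
proof -
  let ?F = "edge_at I ` ({..<m} - S)"
  have "reach ?F radius u v" if "{u, v} \<in> edges I - ?F" for u v
  proof -
    obtain j where j: "j \<in> S" "{u, v} = {eu j, ev j}"
      using \<open>{u, v} \<in> edges I - ?F\<close> unfolding edges_diff[OF S] by (auto simp: edge_at_eq)
    then have r: "reach ?F radius (eu j) (ev j)" using assms(2) by (simp add: good_def)
    from j(2) have "u = eu j \<and> v = ev j \<or> u = ev j \<and> v = eu j" by (auto simp: doubleton_eq_iff)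
    then show ?thesis using r reach_sym[OF r] by auto
  qed
  moreover have "?F \<subseteq> edges I" by (auto simp: edges_eq)
  ultimately show ?thesis
    using assms(2) by (simp add: unit_spanner_solution_def spanner_iff edges_diff[OF S]
        sum_weight_edges[OF S] good_def)
qed

text \<open>Edges of weight 0 outside \<open>F\<close> are returned to the graph: \<open>S\<close>
  retains the full weight, and walks in \<open>F\<close> survive in the larger graph.\<close>

lemma solution_imp_good:
  assumes sol: "unit_spanner_solution I F"
  defines "S \<equiv> {j. j < m \<and> edge_at I j \<notin> F \<and> 0 < ew j}"
  shows "F \<subseteq> edge_at I ` ({..<m} - S)" "W \<le> (\<Sum>j\<in>S. ew j)"
    "\<And>j. j \<in> S \<Longrightarrow> reach F radius (eu j) (ev j)"
proof -
  have F: "F \<subseteq> edges I" using sol by (simp add: unit_spanner_solution_def spanner_def)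
  then show "F \<subseteq> edge_at I ` ({..<m} - S)" by (auto simp: edges_eq S_def)
  have sp: "reach F radius u v" if "{u, v} \<in> edges I - F" for u v
    using sol spanner_iff[OF F] that by (simp add: unit_spanner_solution_def)
  show "reach F radius (eu j) (ev j)" if "j \<in> S" for j
    using that by (intro sp) (auto simp: S_def edges_eq simp flip: edge_at_eq)
  let ?D = "{j. j < m \<and> edge_at I j \<notin> F}"
  have "edges I - F = edge_at I ` ?D" by (auto simp: edges_eq)
  then have "W \<le> (\<Sum>j\<in>?D. ew j)"
    using sol sum_weight_edges[of ?D] by (simp add: unit_spanner_solution_def subset_eq)
  also have "\<dots> = (\<Sum>j\<in>S. ew j)"
    by (rule sum.mono_neutral_right) (auto simp: S_def)
  finally show "W \<le> (\<Sum>j\<in>S. ew j)" .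
qed

lemma set_candidates: "set (candidates m) = {j. j < m \<and> removable j \<and> 0 < ew j}"
  by (auto simp: candidates_def)

lemma pool_subset: "set pool \<subseteq> {j. j < m \<and> removable j \<and> 0 < ew j}"
  unfolding pool_def set_candidates[symmetric] by (rule set_take_subset)

lemma pool_less: "i < length pool \<Longrightarrow> pool ! i < m"
  using pool_subset nth_mem by blast

lemma distinct_pool: "distinct pool"
  by (simp add: pool_def candidates_def distinct_take)

lemma good_subset_pool:
  assumes sol: "unit_spanner_solution I F"
  shows "\<exists>S\<subseteq>set pool. card S \<le> W \<and> good S"
proof (cases "length (candidates m) \<le> cap")
  case True
  define S where "S = {j. j < m \<and> edge_at I j \<notin> F \<and> 0 < ew j}"
  note S = solution_imp_good[OF sol, folded S_def]
  have sub: "S \<subseteq> set pool"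
  proof
    fix j assume j: "j \<in> S"
    have "F \<subseteq> edges I - {edge_at I j}"
      using j sol by (auto simp: S_def unit_spanner_solution_def spanner_def)
    then have "removable j" unfolding removable_def by (rule reach_subset[OF S(3)[OF j]])
    then show "j \<in> set pool" using True j set_candidates by (auto simp: pool_def S_def)
  qed
  have fin: "finite S" by (simp add: S_def)
  obtain T where T: "T \<subseteq> S" "card T \<le> W" "W \<le> (\<Sum>j\<in>T. ew j)"
  proof (cases "card S \<le> W")
    case True
    then show thesis using that[of S] S(2) by blast
  next
    case False
    then obtain T where T: "T \<subseteq> S" "card T = W" using obtain_subset_with_card_n[of W S] by auto
    have "(\<Sum>j\<in>T. 1) \<le> (\<Sum>j\<in>T. ew j)" using T(1) by (intro sum_mono) (auto simp: S_def)
    then show thesis using that[of T] T by simp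
  qed
  \<comment> \<open>Restoring the edges of \<open>S - T\<close> only enlarges the graph, so the
    walks for \<open>T\<close> remain.\<close>
  have "edge_at I ` ({..<m} - S) \<subseteq> edge_at I ` ({..<m} - T)" using T(1) by blast
  then have "reach (edge_at I ` ({..<m} - T)) radius (eu j) (ev j)" if "j \<in> T" for j
    using that T(1) by (intro reach_subset[OF S(3) order_trans[OF S(1)]]) auto
  then show ?thesis using T sub by (intro exI[of _ T]) (auto simp: good_def)
next
  case False
  then have card: "card (set pool) = W * (2 * radius + 1)"
    using distinct_card[OF distinct_pool] by (simp add: pool_def cap_def)
  \<comment> \<open>\<open>reach_support\<close> yields edges; injectivity of
    \<open>edge_at I\<close> turns them into equally many positions in the edge list.\<close>
  have "\<exists>P\<subseteq>{..<m} - {j}. card P \<le> radius \<and> reach (edge_at I ` P) radius (eu j) (ev j)"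
    if "j \<in> set pool" for j
  proof -
    have j: "j < m" "removable j" using that pool_subset by auto
    then obtain Q where Q: "Q \<subseteq> edges I - {edge_at I j}" "finite Q" "card Q \<le> radius"
      "reach Q radius (eu j) (ev j)"
      using reach_support[OF j(2)[unfolded removable_def]] by blast
    let ?P = "{i. i < m \<and> edge_at I i \<in> Q}"
    have im: "edge_at I ` ?P = Q" using Q(1) by (auto simp: edges_eq)
    moreover have "inj_on (edge_at I) ?P" using inj_edge by (rule inj_on_subset) auto
    ultimately have "card ?P = card Q" using card_image by fastforce
    moreover have "?P \<subseteq> {..<m} - {j}" using Q(1) by auto
    ultimately show ?thesis using Q im by (intro exI[of _ ?P]) auto
  qed
  then obtain P where P: "\<And>j. j \<in> set pool \<Longrightarrow> P j \<subseteq> {..<m} - {j} \<and> card (P j) \<le> radius \<and>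
      reach (edge_at I ` P j) radius (eu j) (ev j)" by metis
  have "\<exists>S\<subseteq>set pool. card S = W \<and> (\<forall>j\<in>S. P j \<inter> S = {})"
  proof (rule independent_subset)
    show "W * (2 * radius + 1) \<le> card (set pool)" using card by simp
    fix j assume "j \<in> set pool"
    from P[OF this] show "finite (P j) \<and> card (P j) \<le> radius \<and> j \<notin> P j"
      using finite_subset[of "P j" "{..<m} - {j}"] by auto
  qed simp
  then obtain S where S: "S \<subseteq> set pool" "card S = W" "\<forall>j\<in>S. P j \<inter> S = {}" by blast
  have "(\<Sum>j\<in>S. 1) \<le> (\<Sum>j\<in>S. ew j)" using S(1) pool_subset by (intro sum_mono) fastforce
  moreover have "reach (edge_at I ` ({..<m} - S)) radius (eu j) (ev j)" if "j \<in> S" for j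
  proof (rule reach_subset)
    show "reach (edge_at I ` P j) radius (eu j) (ev j)" using P S(1) that by blast
    \<comment> \<open>Each walk was found with only edge \<open>j\<close> deleted; independence
      makes it avoid all of \<open>S\<close>, so the whole of \<open>S\<close> can go at
      once.\<close>
    have "P j \<subseteq> {..<m} - S" using P[of j] S(1,3) that by blast
    then show "edge_at I ` P j \<subseteq> edge_at I ` ({..<m} - S)" by (rule image_mono)
  qed
  ultimately show ?thesis using S by (intro exI[of _ S]) (auto simp: good_def)
qed

lemma solution_imp_selection:
  assumes sol: "unit_spanner_solution I F" and W: "0 < W"
  shows "\<exists>t. (\<forall>i<W. t i < length pool) \<and> good (selection t)"
proof -
  obtain S where S: "S \<subseteq> set pool" "card S \<le> W" "good S" using good_subset_pool[OF sol] by blast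
  have fin: "finite S" using S(1) finite_subset by blast
  have "S \<noteq> {}" using S(3) W by (auto simp: good_def)
  obtain f where f: "bij_betw f {..<card S} S"
    using ex_bij_betw_nat_finite[OF fin] by (auto simp: atLeast0LessThan)
  \<comment> \<open>The enumeration of \<open>S\<close> is padded to length \<open>W\<close> by
    repeating \<open>f 0\<close>, which lies in \<open>S\<close> because \<open>0 < W\<close> rules
    out the empty set.\<close>
  define g where "g i = f (if i < card S then i else 0)" for i
  have "0 < card S" using fin \<open>S \<noteq> {}\<close> by (simp add: card_gt_0_iff)
  have "g ` {..<W} = S"
  proof
    show "g ` {..<W} \<subseteq> S" using f \<open>0 < card S\<close> by (auto simp: g_def bij_betw_def)
    show "S \<subseteq> g ` {..<W}"
    proof
      fix x assume "x \<in> S"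
      then obtain i where "i < card S" "x = f i" using f by (auto simp: bij_betw_def)
      then show "x \<in> g ` {..<W}" using S(2) by (auto simp: g_def intro!: image_eqI[of _ _ i])
    qed
  qed
  moreover have "\<exists>k. k < length pool \<and> pool ! k = g i" if "i < W" for i
    using that S(1) \<open>g ` {..<W} = S\<close> by (metis imageI in_set_conv_nth lessThan_iff subsetD)
  then obtain t where t: "\<And>i. i < W \<Longrightarrow> t i < length pool \<and> pool ! t i = g i" by metis
  have "selection t = g ` {..<W}" unfolding selection_def using t by (intro image_cong) auto
  ultimately show ?thesis using S(3) t by (intro exI[of _ t]) simp
qed

end

text \<open>Never computed by the program: it measures the progress of the search. The counter
  raises it by exactly one and it determines the tuple, so no tuple is passed over.\<close>

definition tuple_value :: "nat \<Rightarrow> (nat \<Rightarrow> nat) \<Rightarrow> nat \<Rightarrow> nat" where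
  "tuple_value r t k = (\<Sum>i<k. t i * r ^ i)"

lemma tuple_value_Suc [simp]: "tuple_value r t (Suc k) = tuple_value r t k + t k * r ^ k"
  by (simp add: tuple_value_def)

lemma tuple_value_0 [simp]: "tuple_value r t 0 = 0"
  by (simp add: tuple_value_def)

lemma tuple_value_upd [simp]: "k \<le> i \<Longrightarrow> tuple_value r (t(i := v)) k = tuple_value r t k"
  by (simp add: tuple_value_def)

lemma tuple_value_less:
  "\<forall>i<k. t i < r \<Longrightarrow> tuple_value r t k < r ^ k"
proof (induction k)
  case (Suc k)
  have "Suc (t k) * r ^ k \<le> r * r ^ k" using Suc.prems by (intro mult_right_mono) auto
  then show ?case using Suc by simp
qed simp

lemma tuple_value_inj:
  "\<forall>i<k. t i < r \<Longrightarrow> \<forall>i<k. t' i < r \<Longrightarrow> tuple_value r t k = tuple_value r t' k \<Longrightarrow>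
    i < k \<Longrightarrow> t i = t' i"
proof (induction k)
  case (Suc k)
  have l: "tuple_value r t k < r ^ k" "tuple_value r t' k < r ^ k"
    using Suc.prems by (auto intro: tuple_value_less)
  then have p: "r ^ k \<noteq> 0" by linarith
  have "(tuple_value r t k + t k * r ^ k) div r ^ k = t k"
    using l(1) by (simp only: div_mult_self1[OF p] div_less add_0_right)
  moreover have "(tuple_value r t' k + t' k * r ^ k) div r ^ k = t' k"
    using l(2) by (simp only: div_mult_self1[OF p] div_less add_0_right)
  ultimately have "t k = t' k" using Suc.prems(3) by simp
  then show ?case using Suc by (auto simp: less_Suc_eq)
qed simp

section \<open>Exhaustive search\<close>

text \<open>
  Bank \<open>R\<close> holds the \<open>r\<close> edges of the pool, \<open>t\<close> the current tuple of positions in it, a counter in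
  base \<open>r\<close> with the least significant digit first, and \<open>del\<close> flags the edges outside \<open>F\<close>. Cell \<open>fl\<close>
  is \<open>0\<close> during the search, \<open>1\<close> after success and \<open>2\<close> after failure.
\<close>

abbreviation chosen :: aexp where
  "chosen \<equiv> Cell ''R'' (Cell ''t'' (Var ''k''))"

text \<open>The test on \<open>del\<close> keeps an edge that occurs twice in the tuple from
  contributing its weight twice.\<close>

definition select :: com where
  "select = (''sum'' ::= Const 0 ;;
     For ''k'' target_weight
      (Cond (Less (Cell ''del'' chosen) (Const 1))
        (Assign ''del'' chosen (Const 1) ;; ''sum'' ::= Plus (Var ''sum'') (edge_weight chosen)) Skip))"

text \<open>Labels exceed distances by 1, hence the strict bound \<open>a + 2\<close>; label 0
  stands for unreachable and is tested separately.\<close>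

definition verify :: com where
  "verify = ((''ok'' ::= Const 1 ;; Cond (Less (Var ''sum'') target_weight) (''ok'' ::= Const 0) Skip) ;;
     For ''k'' target_weight
      (''src'' ::= end1 chosen ;; bfs ;;
       Cond (Conj (Pos (Cell ''d'' (end2 chosen))) (Less (Cell ''d'' (end2 chosen)) (Plus (Var ''a'') (Const 2))))
         Skip (''ok'' ::= Const 0)))"

definition clear :: com where
  "clear = For ''k'' target_weight (Assign ''del'' chosen (Const 0))"

definition increment :: com where
  "increment = (''c'' ::= Const 1 ;;
     For ''k'' target_weight
      (Cond (Pos (Var ''c''))
        (Cond (Less (Plus (Cell ''t'' (Var ''k'')) (Const 1)) (Var ''r''))
          (Assign ''t'' (Var ''k'') (Plus (Cell ''t'' (Var ''k'')) (Const 1)) ;; ''c'' ::= Const 0)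
          (Assign ''t'' (Var ''k'') (Const 0)))
        Skip) ;;
     Cond (Pos (Var ''c'')) (''fl'' ::= Const 2) Skip)"

definition search :: com where
  "search = While (Less (Var ''fl'') (Const 1))
     (select ;; verify ;; Cond (Pos (Var ''ok'')) (''fl'' ::= Const 1) (clear ;; increment))"

lemma written_search [simp]:
  "written select = {''sum'', ''k'', ''del''}" "written verify = {''ok'', ''k'', ''src''} \<union> written bfs"
  "written clear = {''k'', ''del''}" "written increment = {''c'', ''k'', ''t'', ''fl''}"
  by (auto simp: select_def verify_def clear_def increment_def)

context spanner_instance
begin

definition ready :: "state \<Rightarrow> bool" where
  "ready s \<longleftrightarrow> has_input s \<and> arcs_upto m s \<and> s ''a'' 0 = radius \<and>
     s ''r'' 0 = length pool \<and> (\<forall>i<length pool. s ''R'' i = pool ! i)"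

lemma ready_frame:
  assumes "\<And>x. x \<in> {''in'', ''head'', ''dst'', ''eid'', ''nxt'', ''a'', ''r'', ''R''} \<Longrightarrow> s' x = s x" "ready s"
  shows "ready s'"
proof -
  have "arcs_upto m s'" using assms by (auto intro: arcs_upto_cong[of m s] simp: ready_def)
  then show ?thesis using assms by (simp add: ready_def has_input_def)
qed

lemma ready_upd [simp]:
  assumes "x \<notin> {''in'', ''head'', ''dst'', ''eid'', ''nxt'', ''a'', ''r'', ''R''}"
  shows "ready (upd s x i v) = ready s"
proof -
  have "upd s x i v y = s y" if "y \<in> {''in'', ''head'', ''dst'', ''eid'', ''nxt'', ''a'', ''r'', ''R''}" for y
    using assms that by (metis upd_apply)
  then show ?thesis using ready_frame[of "upd s x i v" s] ready_frame[of s "upd s x i v"] by metis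
qed

lemma chosen_less:
  assumes "ready s" "s ''t'' k < length pool"
  shows "s ''R'' (s ''t'' k) = pool ! (s ''t'' k)" "pool ! (s ''t'' k) < m"
  using assms pool_less by (simp_all add: ready_def)

lemma run_select:
  assumes s: "ready s" and t: "\<forall>i<W. s ''t'' i < length pool" and del: "s ''del'' = (\<lambda>_. 0)"
  shows "run select s (100 * W + 20) (\<lambda>s'. s' ''del'' = (\<lambda>j. if j \<in> selection (s ''t'') then 1 else 0) \<and>
    s' ''sum'' 0 = (\<Sum>j\<in>selection (s ''t''). ew j))"
  unfolding select_def
proof (rule run_Seq[where T=3 and U="100 * W + 10"])
  let ?init = "''sum'' ::= Const 0"
  let ?sel = "\<lambda>k. (\<lambda>i. pool ! s ''t'' i) ` {..<k}"
  show "run ?init s 3 (\<lambda>s'. s' = eff ?init s)" by (rule run_straight) auto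
  fix s1 assume s1: "s1 = eff ?init s"
  show "run (For ''k'' target_weight
      (Cond (Less (Cell ''del'' chosen) (Const 1))
        (Assign ''del'' chosen (Const 1) ;; ''sum'' ::= Plus (Var ''sum'') (edge_weight chosen)) Skip)) s1 (100 * W + 10)
    (\<lambda>s'. s' ''del'' = (\<lambda>j. if j \<in> selection (s ''t'') then 1 else 0) \<and>
    s' ''sum'' 0 = (\<Sum>j\<in>selection (s ''t''). ew j))"
  proof (rule run_For[where N=W and B=80 and
        I="\<lambda>k s'. ready s' \<and> s' ''t'' = s ''t'' \<and> s' ''del'' = (\<lambda>j. if j \<in> ?sel k then 1 else 0) \<and>
          s' ''sum'' 0 = (\<Sum>j\<in>?sel k. ew j)"], goal_cases)
    case (2 k s')
    note inv = this
    let ?j = "pool ! s ''t'' k"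
    have ch: "s' ''R'' (s' ''t'' k) = ?j" "?j < m" "has_input s'"
      using chosen_less[of s' k] inv t by (auto simp: ready_def)
    have Suc: "?sel (Suc k) = insert ?j (?sel k)" by (simp add: lessThan_Suc)
    show ?case
    proof (rule run_Cond[where T=60])
      assume "bval (Less (Cell ''del'' chosen) (Const 1)) s'"
      then have new: "?j \<notin> ?sel k" using inv ch by (auto split: if_splits)
      have "(\<Sum>j\<in>?sel (Suc k). ew j) = (\<Sum>j\<in>?sel k. ew j) + ew ?j"
        unfolding Suc using new by simp
      moreover have "(\<lambda>j. if j \<in> ?sel (Suc k) then 1 else 0) = (\<lambda>j. if j \<in> ?sel k then 1 else (0::nat))(?j := 1)"
        unfolding Suc by auto
      ultimately show "run (Assign ''del'' chosen (Const 1) ;; ''sum'' ::= Plus (Var ''sum'') (edge_weight chosen))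
        s' 60 (\<lambda>s'. s' ''k'' 0 = k \<and> ready (upd s' ''k'' 0 (Suc k)) \<and>
          upd s' ''k'' 0 (Suc k) ''t'' = s ''t'' \<and>
          upd s' ''k'' 0 (Suc k) ''del'' = (\<lambda>j. if j \<in> ?sel (Suc k) then 1 else 0) \<and>
          upd s' ''k'' 0 (Suc k) ''sum'' 0 = (\<Sum>j\<in>?sel (Suc k). ew j))"
        using inv ch by (intro run_straight) simp_all
    next
      assume "\<not> bval (Less (Cell ''del'' chosen) (Const 1)) s'"
      then have "?j \<in> ?sel k" using inv ch by (auto split: if_splits)
      then have "?sel (Suc k) = ?sel k" unfolding Suc by blast
      then show "run Skip s' 60 (\<lambda>s'. s' ''k'' 0 = k \<and> ready (upd s' ''k'' 0 (Suc k)) \<and>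
          upd s' ''k'' 0 (Suc k) ''t'' = s ''t'' \<and>
          upd s' ''k'' 0 (Suc k) ''del'' = (\<lambda>j. if j \<in> ?sel (Suc k) then 1 else 0) \<and>
          upd s' ''k'' 0 (Suc k) ''sum'' 0 = (\<Sum>j\<in>?sel (Suc k). ew j))"
        using inv by (intro run_straight) simp_all
    qed simp
  qed (use s del in \<open>auto simp: s1 ready_def has_input_header selection_def\<close>)
qed simp

lemma run_verify:
  assumes s: "ready s" and t: "\<forall>i<W. s ''t'' i < length pool"
  shows "run verify s (W * (200 * (n + m + 1) + 150) + 50) (\<lambda>s'. 0 < s' ''ok'' 0 \<longleftrightarrow>
     W \<le> s ''sum'' 0 \<and> (\<forall>j\<in>selection (s ''t''). reach (alive_edges (s ''del'')) radius (eu j) (ev j)))"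
  unfolding verify_def
proof (rule run_Seq[where T=20 and U="W * (200 * (n + m + 1) + 150) + 10"])
  let ?init = "''ok'' ::= Const 1 ;; Cond (Less (Var ''sum'') target_weight) (''ok'' ::= Const 0) Skip"
  let ?ok = "\<lambda>i. reach (alive_edges (s ''del'')) radius (eu (pool ! s ''t'' i)) (ev (pool ! s ''t'' i))"
  show "run ?init s 20 (\<lambda>s'. s' = eff ?init s)" by (rule run_straight) auto
  fix s1 assume s1: "s1 = eff ?init s"
  have inp: "has_input s" using s by (simp add: ready_def)
  have 1: "ready s1" "s1 ''t'' = s ''t''" "s1 ''del'' = s ''del''" "0 < s1 ''ok'' 0 \<longleftrightarrow> W \<le> s ''sum'' 0"
    using s inp by (auto simp: s1 has_input_header)
  show "run (For ''k'' target_weight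
      (''src'' ::= end1 chosen ;; bfs ;;
       Cond (Conj (Pos (Cell ''d'' (end2 chosen))) (Less (Cell ''d'' (end2 chosen)) (Plus (Var ''a'') (Const 2))))
         Skip (''ok'' ::= Const 0))) s1 (W * (200 * (n + m + 1) + 150) + 10)
     (\<lambda>s'. 0 < s' ''ok'' 0 \<longleftrightarrow> W \<le> s ''sum'' 0 \<and>
        (\<forall>j\<in>selection (s ''t''). reach (alive_edges (s ''del'')) radius (eu j) (ev j)))"
  proof (rule run_For[where N=W and B="200 * (n + m + 1) + 130" and
        I="\<lambda>k s'. ready s' \<and> s' ''t'' = s ''t'' \<and> s' ''del'' = s ''del'' \<and>
          (0 < s' ''ok'' 0 \<longleftrightarrow> W \<le> s ''sum'' 0 \<and> (\<forall>i<k. ?ok i))"], goal_cases)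
    case (2 k s2)
    note inv = this
    let ?j = "pool ! s ''t'' k"
    have ch: "s2 ''R'' (s2 ''t'' k) = ?j" "?j < m" "has_input s2"
      using chosen_less[of s2 k] inv t by (auto simp: ready_def)
    note ends = edge_ends[OF ch(2)]
    show ?case
    proof (rule run_Seq[where T=30 and U="200 * (n + m + 1) + 100"])
      show "run (''src'' ::= end1 chosen) s2 30 (\<lambda>s'. s' ''src'' 0 = eu ?j)"
        using ch inv by (intro run_straight) auto
      fix s3 assume src: "s3 ''src'' 0 = eu ?j" and fr: "\<And>x. x \<notin> written (''src'' ::= end1 chosen) \<Longrightarrow> s3 x = s2 x"
      have 3: "ready s3" "s3 ''t'' = s ''t''" "s3 ''del'' = s ''del''" "s3 ''ok'' = s2 ''ok''" "s3 ''k'' 0 = k"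
        using inv by (auto simp: fr intro: ready_frame)
      have bfs_pre: "has_input s3" "arcs_upto m s3" "eu ?j < n"
        using 3(1) ends by (auto simp: ready_def)
      show "run (bfs ;; Cond (Conj (Pos (Cell ''d'' (end2 chosen))) (Less (Cell ''d'' (end2 chosen)) (Plus (Var ''a'') (Const 2))))
         Skip (''ok'' ::= Const 0)) s3 (200 * (n + m + 1) + 100) (\<lambda>s'. s' ''k'' 0 = k \<and>
           ready (upd s' ''k'' 0 (Suc k)) \<and> upd s' ''k'' 0 (Suc k) ''t'' = s ''t'' \<and>
           upd s' ''k'' 0 (Suc k) ''del'' = s ''del'' \<and>
           (0 < upd s' ''k'' 0 (Suc k) ''ok'' 0 \<longleftrightarrow> W \<le> s ''sum'' 0 \<and> (\<forall>i<Suc k. ?ok i)))"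
      proof (rule run_Seq[OF run_bfs[OF bfs_pre(1,2) src bfs_pre(3)], where U=100])
        fix s4 assume t: "bfs_tree {..<n} (alive_edges (s3 ''del'')) (eu ?j) (s4 ''d'') (s4 ''br'')"
          and fr: "\<And>x. x \<notin> written bfs \<Longrightarrow> s4 x = s3 x"
        have 4: "ready s4" "s4 ''t'' = s ''t''" "s4 ''del'' = s ''del''" "s4 ''ok'' = s2 ''ok''" "s4 ''k'' 0 = k"
          using 3 by (auto simp: fr intro: ready_frame)
        have ch4: "s4 ''R'' (s4 ''t'' k) = ?j" "has_input s4" "s4 ''a'' 0 = radius"
          using 4 ch inv chosen_less[of s4 k] \<open>\<forall>i<W. s ''t'' i < length pool\<close> by (auto simp: ready_def)
        have "?ok k \<longleftrightarrow> 0 < s4 ''d'' (ev ?j) \<and> s4 ''d'' (ev ?j) \<le> Suc radius"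
          using bfs_tree_reach[OF t, of "ev ?j" radius] ends 3(3) by simp
        then show "run (Cond (Conj (Pos (Cell ''d'' (end2 chosen))) (Less (Cell ''d'' (end2 chosen)) (Plus (Var ''a'') (Const 2))))
         Skip (''ok'' ::= Const 0)) s4 100 (\<lambda>s'. s' ''k'' 0 = k \<and>
           ready (upd s' ''k'' 0 (Suc k)) \<and> upd s' ''k'' 0 (Suc k) ''t'' = s ''t'' \<and>
           upd s' ''k'' 0 (Suc k) ''del'' = s ''del'' \<and>
           (0 < upd s' ''k'' 0 (Suc k) ''ok'' 0 \<longleftrightarrow> W \<le> s ''sum'' 0 \<and> (\<forall>i<Suc k. ?ok i)))"
          using 4 ch4 ch(2) inv by (intro run_straight) (auto simp: less_Suc_eq)
      qed simp
    qed simp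
  qed (use 1 in \<open>auto simp: ready_def has_input_header selection_def algebra_simps\<close>)
qed simp

lemma run_clear:
  assumes s: "ready s" and t: "\<forall>i<W. s ''t'' i < length pool"
    and del: "\<forall>j. j \<notin> selection (s ''t'') \<longrightarrow> s ''del'' j = 0"
  shows "run clear s (50 * W + 20) (\<lambda>s'. s' ''del'' = (\<lambda>_. 0))"
  unfolding clear_def
proof (rule run_For[where N=W and B=20 and
      I="\<lambda>k s'. ready s' \<and> s' ''t'' = s ''t'' \<and>
        (\<forall>j. j \<notin> (\<lambda>i. pool ! s ''t'' i) ` {k..<W} \<longrightarrow> s' ''del'' j = 0)"], goal_cases)
  case (2 k s')
  have ch: "s' ''R'' (s' ''t'' k) = pool ! s ''t'' k"
    using chosen_less[of s' k] 2 t by auto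
  have "{k..<W} = insert k {Suc k..<W}" using 2(1) by auto
  then show ?case using 2 ch by (intro run_straight) auto
qed (use s del in \<open>auto simp: ready_def has_input_header selection_def atLeast0LessThan\<close>)

lemma run_increment:
  assumes s: "ready s" and t: "\<forall>i<W. s ''t'' i < length pool" and fl: "s ''fl'' 0 = 0"
  defines "val \<equiv> \<lambda>t. tuple_value (length pool) t W"
  shows "run increment s (60 * W + 40) (\<lambda>s'. (\<forall>i<W. s' ''t'' i < length pool) \<and>
     (s' ''fl'' 0 = 0 \<and> val (s' ''t'') = Suc (val (s ''t'')) \<or>
      s' ''fl'' 0 = 2 \<and> Suc (val (s ''t'')) = length pool ^ W))"
  unfolding increment_def
proof (rule run_Seq[where T=3 and U="60 * W + 30"])
  let ?init = "''c'' ::= Const 1" and ?r = "length pool"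
  show "run ?init s 3 (\<lambda>s'. s' = eff ?init s)" by (rule run_straight) auto
  fix s1 assume s1: "s1 = eff ?init s"
  \<comment> \<open>The digits below \<open>k\<close> and the pending carry together denote the
    successor of the old value of these digits; the digits from \<open>k\<close> on are still
    untouched.\<close>
  let ?inv = "\<lambda>k s'. ready s' \<and> s' ''fl'' 0 = 0 \<and> (\<forall>i<W. s' ''t'' i < ?r) \<and>
      (\<forall>i. k \<le> i \<longrightarrow> s' ''t'' i = s ''t'' i) \<and> s' ''c'' 0 \<le> 1 \<and>
      tuple_value ?r (s' ''t'') k + s' ''c'' 0 * ?r ^ k = Suc (tuple_value ?r (s ''t'') k)"
  let ?carry = "Cond (Pos (Var ''c''))
        (Cond (Less (Plus (Cell ''t'' (Var ''k'')) (Const 1)) (Var ''r''))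
          (Assign ''t'' (Var ''k'') (Plus (Cell ''t'' (Var ''k'')) (Const 1)) ;; ''c'' ::= Const 0)
          (Assign ''t'' (Var ''k'') (Const 0)))
        Skip"
  show "run (For ''k'' target_weight ?carry ;; Cond (Pos (Var ''c'')) (''fl'' ::= Const 2) Skip)
    s1 (60 * W + 30) (\<lambda>s'. (\<forall>i<W. s' ''t'' i < length pool) \<and>
     (s' ''fl'' 0 = 0 \<and> val (s' ''t'') = Suc (val (s ''t'')) \<or>
      s' ''fl'' 0 = 2 \<and> Suc (val (s ''t'')) = length pool ^ W))"
  proof (rule run_Seq[where T="60 * W + 10" and U=10])
    show "run (For ''k'' target_weight ?carry) s1 (60 * W + 10) (?inv W)"
    proof (rule run_For[where N=W and B=40 and I="?inv"], goal_cases)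
      case (2 k s')
      note inv = this
      have r: "s' ''r'' 0 = ?r" using inv by (simp add: ready_def)
      have tk: "s' ''t'' k = s ''t'' k" "s ''t'' k < ?r" using inv t by auto
      show ?case
      proof (cases "s' ''c'' 0 = 1")
        case False
        then have c: "s' ''c'' 0 = 0" using inv by simp
        show ?thesis by (rule run_straight) (use inv c tk in auto)
      next
        case c: True
        show ?thesis
        proof (cases "Suc (s ''t'' k) < ?r")
          case True
          then show ?thesis using inv c tk r
            by (intro run_straight) (auto simp: algebra_simps)
        next
          case False
          \<comment> \<open>The digit has its maximal value: \<open>r ^ k\<close> added to it is
            exactly one carry into the next position.\<close>
          then have "?r = Suc (s ''t'' k)" using tk by simp
          then have "?r ^ Suc k = ?r ^ k + s ''t'' k * ?r ^ k" by (metis mult_Suc power_Suc)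
          then show ?thesis using inv c tk r False
            by (intro run_straight) (auto simp: algebra_simps)
        qed
      qed
    qed (use s t fl in \<open>auto simp: s1 ready_def has_input_header\<close>)
    fix s2 assume 2: "?inv W s2"
    \<comment> \<open>A carry left at the end forces the old value to be the last one,
      \<open>r ^ W - 1\<close>.\<close>
    have "tuple_value ?r (s ''t'') W < ?r ^ W" using t by (rule tuple_value_less)
    then show "run (Cond (Pos (Var ''c'')) (''fl'' ::= Const 2) Skip) s2 10
     (\<lambda>s'. (\<forall>i<W. s' ''t'' i < length pool) \<and>
     (s' ''fl'' 0 = 0 \<and> val (s' ''t'') = Suc (val (s ''t'')) \<or>
      s' ''fl'' 0 = 2 \<and> Suc (val (s ''t'')) = length pool ^ W))"
      using 2 by (intro run_straight) (auto simp: val_def le_Suc_eq)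
  qed simp
qed simp

end

context spanner_instance
begin

lemma alive_edges_indicator:
  "alive_edges (\<lambda>j. if j \<in> S then 1 else 0) = edge_at I ` ({..<m} - S)"
  unfolding alive_edges_def by (intro arg_cong[where f="(`) (edge_at I)"]) auto

definition solved :: "state \<Rightarrow> bool" where
  "solved s \<longleftrightarrow>
     s ''fl'' 0 = 1 \<and> (\<exists>S\<subseteq>{..<m}. good S \<and> (\<forall>j<m. s ''del'' j = 0 \<longleftrightarrow> j \<notin> S)) \<or>
     s ''fl'' 0 = 2 \<and> (\<nexists>F. unit_spanner_solution I F)"

lemma selection_subset: "\<forall>i<W. t i < length pool \<Longrightarrow> selection t \<subseteq> {..<m}"
  using pool_less by (auto simp: selection_def)

lemma run_search_body:
  assumes s: "ready s" and t: "\<forall>i<W. s ''t'' i < length pool" and del: "s ''del'' = (\<lambda>_. 0)"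
    and fl: "s ''fl'' 0 = 0" and W: "0 < W"
  defines "val \<equiv> \<lambda>t. tuple_value (length pool) t W"
  shows "run (select ;; verify ;; Cond (Pos (Var ''ok'')) (''fl'' ::= Const 1) (clear ;; increment))
    s (1000 * W * (n + m + 1))
    (\<lambda>s'. ready s' \<and>
      (s' ''fl'' 0 = 1 \<and> (\<exists>S\<subseteq>{..<m}. good S \<and> (\<forall>j<m. s' ''del'' j = 0 \<longleftrightarrow> j \<notin> S)) \<or>
       \<not> good (selection (s ''t'')) \<and> (\<forall>i<W. s' ''t'' i < length pool) \<and>
         (s' ''fl'' 0 = 0 \<and> s' ''del'' = (\<lambda>_. 0) \<and> val (s' ''t'') = Suc (val (s ''t'')) \<or>
          s' ''fl'' 0 = 2 \<and> Suc (val (s ''t'')) = length pool ^ W)))"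
    (is "run _ _ _ ?Q")
proof (rule run_Seq[OF run_select[OF s t del],
      where U="W * (200 * (n + m + 1) + 150) + 50 + (110 * W + 80)"])
  let ?S = "selection (s ''t'')"
  fix s1 assume 1: "s1 ''del'' = (\<lambda>j. if j \<in> ?S then 1 else 0) \<and> s1 ''sum'' 0 = (\<Sum>j\<in>?S. ew j)"
    and fr: "\<And>x. x \<notin> written select \<Longrightarrow> s1 x = s x"
  have s1: "ready s1" "s1 ''t'' = s ''t''" "s1 ''fl'' = s ''fl''"
    using s by (auto simp: fr intro: ready_frame)
  have t1: "\<forall>i<W. s1 ''t'' i < length pool" using t s1 by simp
  show "run (verify ;; Cond (Pos (Var ''ok'')) (''fl'' ::= Const 1) (clear ;; increment)) s1
     (W * (200 * (n + m + 1) + 150) + 50 + (110 * W + 80)) ?Q"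
  proof (rule run_Seq[OF run_verify[OF s1(1) t1], where U="110 * W + 80"])
    fix s2 assume ok: "0 < s2 ''ok'' 0 \<longleftrightarrow> W \<le> s1 ''sum'' 0 \<and>
        (\<forall>j\<in>selection (s1 ''t''). reach (alive_edges (s1 ''del'')) radius (eu j) (ev j))"
      and fr: "\<And>x. x \<notin> written verify \<Longrightarrow> s2 x = s1 x"
    have ok: "0 < s2 ''ok'' 0 \<longleftrightarrow> good ?S"
      using ok 1 s1(2) by (simp only: good_def alive_edges_indicator)
    have s2: "ready s2" "s2 ''t'' = s ''t''" "s2 ''fl'' 0 = 0"
      "s2 ''del'' = (\<lambda>j. if j \<in> ?S then 1 else 0)"
      using s1 1 fl by (auto simp: fr intro: ready_frame)
    show "run (Cond (Pos (Var ''ok'')) (''fl'' ::= Const 1) (clear ;; increment)) s2 (110 * W + 80) ?Q"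
    proof (rule run_Cond[where T="110 * W + 70"])
      assume "bval (Pos (Var ''ok'')) s2"
      then have "good ?S" using ok by simp
      then show "run (''fl'' ::= Const 1) s2 (110 * W + 70) ?Q"
        using s2 selection_subset[OF t] by (intro run_straight) auto
    next
      assume "\<not> bval (Pos (Var ''ok'')) s2"
      then have bad: "\<not> good ?S" using ok by simp
      have pre: "\<forall>i<W. s2 ''t'' i < length pool" "\<forall>j. j \<notin> selection (s2 ''t'') \<longrightarrow> s2 ''del'' j = 0"
        using s2 t by auto
      show "run (clear ;; increment) s2 (110 * W + 70) ?Q"
      proof (rule run_Seq[OF run_clear[OF s2(1) pre], where U="60 * W + 40"])
        fix s3 assume del: "s3 ''del'' = (\<lambda>_. 0)" and fr: "\<And>x. x \<notin> written clear \<Longrightarrow> s3 x = s2 x"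
        have s3: "ready s3" "s3 ''t'' = s ''t''" "s3 ''fl'' 0 = 0"
          using s2 by (auto simp: fr intro: ready_frame)
        have t3: "\<forall>i<W. s3 ''t'' i < length pool" using s3 t by simp
        show "run increment s3 (60 * W + 40) ?Q"
        proof (rule run_mono[OF run_increment[OF s3(1) t3 s3(3)]])
          fix s'
          assume post: "(\<forall>i<W. s' ''t'' i < length pool) \<and>
              (s' ''fl'' 0 = 0 \<and> tuple_value (length pool) (s' ''t'') W = Suc (tuple_value (length pool) (s3 ''t'') W) \<or>
               s' ''fl'' 0 = 2 \<and> Suc (tuple_value (length pool) (s3 ''t'') W) = length pool ^ W)"
            and fr: "\<And>x. x \<notin> written increment \<Longrightarrow> s' x = s3 x"
          have "ready s'" using s3(1) by (rule ready_frame[rotated]) (auto simp: fr)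
          moreover have "s' ''del'' = (\<lambda>_. 0)" using del by (simp add: fr)
          ultimately show "?Q s'" using bad post s3(2) unfolding val_def by simp
        qed simp
      qed simp
    qed simp
  qed simp
next
  \<comment> \<open>Additive constants are charged to \<open>W\<close>, which is positive.\<close>
  have "1 * 530 \<le> W * 530" using W by (intro mult_right_mono) auto
  then show "100 * W + 20 + (W * (200 * (n + m + 1) + 150) + 50 + (110 * W + 80)) \<le> 1000 * W * (n + m + 1)"
    by (simp add: algebra_simps)
qed

lemma run_search:
  assumes s: "ready s" and pool: "pool \<noteq> []" and t: "s ''t'' = (\<lambda>_. 0)" and del: "s ''del'' = (\<lambda>_. 0)"
    and fl: "s ''fl'' 0 = 0" and W: "0 < W"
  shows "run search s (length pool ^ W * (1000 * W * (n + m + 1) + 10) + 10) solved"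
proof -
  let ?val = "\<lambda>t. tuple_value (length pool) t W"
  let ?digits = "\<lambda>t. \<forall>i<W. t i < length pool"
  \<comment> \<open>All tuples of smaller value have failed. Once \<open>fl\<close> is nonzero only
    \<open>solved\<close> can hold, and the variant is then set to 0.\<close>
  let ?open = "\<lambda>k s. s ''fl'' 0 = 0 \<and> ?digits (s ''t'') \<and> s ''del'' = (\<lambda>_. 0) \<and>
      (\<forall>t. ?digits t \<longrightarrow> ?val t < ?val (s ''t'') \<longrightarrow> \<not> good (selection t)) \<and>
      k = length pool ^ W - ?val (s ''t'')"
  show ?thesis
    unfolding search_def
  proof (rule run_While[where B="1000 * W * (n + m + 1)" and k="length pool ^ W" and
        I="\<lambda>k s. ready s \<and> (?open k s \<or> solved s)"])
    fix k s
    assume "ready s \<and> (?open k s \<or> solved s)" "bval (Less (Var ''fl'') (Const 1)) s"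
    then have s: "ready s" "?open k s" by (auto simp: solved_def)
    have val: "?val (s ''t'') < length pool ^ W" using s(2) by (intro tuple_value_less) simp
    show "run (select ;; verify ;; Cond (Pos (Var ''ok'')) (''fl'' ::= Const 1) (clear ;; increment)) s
      (1000 * W * (n + m + 1)) (\<lambda>s'. \<exists>k'<k. ready s' \<and> (?open k' s' \<or> solved s'))"
    proof (rule run_mono[OF run_search_body])
      fix s'
      assume post: "ready s' \<and>
        (s' ''fl'' 0 = 1 \<and> (\<exists>S\<subseteq>{..<m}. good S \<and> (\<forall>j<m. s' ''del'' j = 0 \<longleftrightarrow> j \<notin> S)) \<or>
         \<not> good (selection (s ''t'')) \<and> ?digits (s' ''t'') \<and>
           (s' ''fl'' 0 = 0 \<and> s' ''del'' = (\<lambda>_. 0) \<and> ?val (s' ''t'') = Suc (?val (s ''t'')) \<or>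
            s' ''fl'' 0 = 2 \<and> Suc (?val (s ''t'')) = length pool ^ W))"
      \<comment> \<open>Tuples of equal value agree in their first \<open>W\<close> entries and
        hence have the same selection.\<close>
      have bad: "\<not> good (selection t)"
        if "\<not> good (selection (s ''t''))" "?digits t" "?val t \<le> ?val (s ''t'')" for t
      proof (cases "?val t = ?val (s ''t'')")
        case True
        then have "selection t = selection (s ''t'')"
          using tuple_value_inj[of W t "length pool" "s ''t''"] that(2) s(2)
          unfolding selection_def by (intro image_cong) auto
        then show ?thesis using that(1) by simp
      next
        case False
        then show ?thesis using s(2) that by simp
      qed
      from post consider
          "s' ''fl'' 0 = 1" "\<exists>S\<subseteq>{..<m}. good S \<and> (\<forall>j<m. s' ''del'' j = 0 \<longleftrightarrow> j \<notin> S)"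
        | "\<not> good (selection (s ''t''))" "?digits (s' ''t'')" "s' ''fl'' 0 = 0" "s' ''del'' = (\<lambda>_. 0)"
            "?val (s' ''t'') = Suc (?val (s ''t''))"
        | "\<not> good (selection (s ''t''))" "s' ''fl'' 0 = 2" "Suc (?val (s ''t'')) = length pool ^ W"
        by (elim conjE disjE) simp_all
      then show "\<exists>k'<k. ready s' \<and> (?open k' s' \<or> solved s')"
      proof cases
        case 1
        then show ?thesis using post val s(2) by (intro exI[of _ 0]) (simp add: solved_def)
      next
        case 2
        have "\<not> good (selection t)" if "?digits t" "?val t < ?val (s' ''t'')" for t
          using bad[OF 2(1) that(1)] that(2) 2(5) by simp
        then have "?open (length pool ^ W - ?val (s' ''t'')) s'" using 2 by simp
        moreover have "length pool ^ W - ?val (s' ''t'') < k" using s(2) val 2(5) by simp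
        ultimately show ?thesis using post by blast
      next
        case 3
        have "\<not> unit_spanner_solution I F" for F
        proof
          assume "unit_spanner_solution I F"
          then obtain t where t: "?digits t" "good (selection t)"
            using solution_imp_selection W by blast
          \<comment> \<open>Values stay below \<open>length pool ^ W\<close>, so an overflow of the
            counter means that every tuple has failed.\<close>
          then have "?val t \<le> ?val (s ''t'')" using tuple_value_less[OF t(1)] 3(3) by simp
          then show False using bad[OF 3(1) t(1)] t(2) by blast
        qed
        then have "solved s'" using 3(2) by (simp add: solved_def)
        then show ?thesis using post val s(2) by (intro exI[of _ 0]) simp
      qed
    qed (use s W in auto)
  next
    fix k s assume "ready s \<and> (?open k s \<or> solved s)" "\<not> bval (Less (Var ''fl'') (Const 1)) s"
    then show "solved s" by simp
  next
    \<comment> \<open>The zero tuple is admissible only if the pool has a position 0; this is why an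
      empty pool is treated outside the search.\<close>
    have "?val (\<lambda>_. 0) = 0" by (simp add: tuple_value_def)
    then show "ready s \<and> (?open (length pool ^ W) s \<or> solved s)"
      using s pool t del fl by simp
  qed (simp add: algebra_simps)
qed

end

section \<open>The algorithm\<close>

definition emit :: com where
  "emit = Cond (Equal (Var ''fl'') (Const 1))
     (((Assign ''out'' (Const 1) (Const 1) ;; ''cnt'' ::= Const 1) ;;
      For ''j'' edge_number
        (Cond (Less (Cell ''del'' (Var ''j'')) (Const 1))
          (Inc ''cnt'' ;; Assign ''out'' (Var ''cnt'') (Var ''j'')) Skip)) ;;
      ''out'' ::= Var ''cnt'')
     (''out'' ::= Const 1 ;; Assign ''out'' (Const 1) (Const 0))"

definition prepare :: com where
  "prepare = (floor_stretch ;; compute_cap ;; build ;; mark ;; collect)"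

definition unit_spanner_program :: com where
  "unit_spanner_program =
    (Cond (Less target_weight (Const 1)) (''fl'' ::= Const 1)
      (Cond (Less edge_number (Const 1)) (''fl'' ::= Const 2)
        (prepare ;; Cond (Pos (Var ''r'')) search (''fl'' ::= Const 2))) ;;
     emit)"

context spanner_instance
begin

lemma run_emit:
  assumes s: "has_input s"
  shows "run emit s (100 * (m + 1)) (\<lambda>s'. output_of s' =
    (if s ''fl'' 0 = 1 then 1 # filter (\<lambda>j. s ''del'' j = 0) [0..<m] else [0]))"
  unfolding emit_def
proof (rule run_Cond[where T="80 * m + 60"])
  let ?L = "\<lambda>k. 1 # filter (\<lambda>j. s ''del'' j = 0) [0..<k]"
  assume "bval (Equal (Var ''fl'') (Const 1)) s"
  then have fl: "s ''fl'' 0 = 1" by simp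
  let ?init = "Assign ''out'' (Const 1) (Const 1) ;; ''cnt'' ::= Const 1"
  let ?loop = "For ''j'' edge_number
        (Cond (Less (Cell ''del'' (Var ''j'')) (Const 1))
          (Inc ''cnt'' ;; Assign ''out'' (Var ''cnt'') (Var ''j'')) Skip)"
  let ?inv = "\<lambda>k s'. has_input s' \<and> s' ''del'' = s ''del'' \<and> s' ''cnt'' 0 = length (?L k) \<and>
      (\<forall>i<length (?L k). s' ''out'' (Suc i) = ?L k ! i)"
  have init: "run ?init s 10 (?inv 0)"
    by (rule run_straight) (use s in auto)
  have step: "run ?loop s1 (70 * m + 10) (?inv m)" if "?inv 0 s1" for s1
  proof (rule run_For[where N=m and B=50 and I="?inv"], goal_cases)
    case (2 k s')
    show ?case
    proof (rule run_Cond[where T=30])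
      assume "bval (Less (Cell ''del'' (Var ''j'')) (Const 1)) s'"
      then have "?L (Suc k) = ?L k @ [k]" using 2 by simp
      then show "run (Inc ''cnt'' ;; Assign ''out'' (Var ''cnt'') (Var ''j'')) s' 30
        (\<lambda>s'. s' ''j'' 0 = k \<and> ?inv (Suc k) (upd s' ''j'' 0 (Suc k)))"
        using 2 by (intro run_straight) (auto simp: nth_append less_Suc_eq simp del: append.simps filter_append)
    next
      assume "\<not> bval (Less (Cell ''del'' (Var ''j'')) (Const 1)) s'"
      then have "?L (Suc k) = ?L k" using 2 by simp
      then show "run Skip s' 30 (\<lambda>s'. s' ''j'' 0 = k \<and> ?inv (Suc k) (upd s' ''j'' 0 (Suc k)))"
        using 2 by (intro run_straight) (auto simp del: filter_append)
    qed simp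
  qed (use that in \<open>auto simp: has_input_header\<close>)
  have last: "run (''out'' ::= Var ''cnt'') s1 10 (\<lambda>s'. output_of s' = ?L m)" if "?inv m s1" for s1
  proof (rule run_straight)
    show "output_of (eff (''out'' ::= Var ''cnt'') s1) = ?L m"
      using that by (intro nth_equalityI) (auto simp: output_of_def simp del: upt_Suc)
  qed auto
  have "run ((?init ;; ?loop) ;; ''out'' ::= Var ''cnt'') s (80 * m + 60) (\<lambda>s'. output_of s' = ?L m)"
    by (rule run_Seq[OF run_Seq[OF init step] last]) auto
  then show "run ((?init ;; ?loop) ;; ''out'' ::= Var ''cnt'') s (80 * m + 60) (\<lambda>s'. output_of s' =
    (if s ''fl'' 0 = 1 then ?L m else [0]))" using fl by simp
next
  assume "\<not> bval (Equal (Var ''fl'') (Const 1)) s"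
  then have "s ''fl'' 0 \<noteq> 1" by auto
  then show "run (''out'' ::= Const 1 ;; Assign ''out'' (Const 1) (Const 0)) s (80 * m + 60)
    (\<lambda>s'. output_of s' = (if s ''fl'' 0 = 1 then 1 # filter (\<lambda>j. s ''del'' j = 0) [0..<m] else [0]))"
    by (intro run_straight) (auto simp: output_of_def)
qed simp

lemma run_prepare:
  assumes s: "s = input_state (encode_input I)"
  shows "run prepare s (30 * radius + 30 * W + 250 * m + 600 * n * (n + m + 1) + 100) ready"
proof -
  have inp: "has_input s" by (simp add: s has_input_def)
  have zero: "s b = (\<lambda>_. 0)" if "b \<noteq> ''in''" for b using that by (auto simp: s input_state_def)
  show ?thesis
    unfolding prepare_def
  proof (rule run_Seq[OF run_floor_stretch[OF inp],
        where U="30 * W + 250 * m + 600 * n * (n + m + 1) + 70"])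
    fix s1 assume 1: "s1 ''a'' 0 = radius" and fr: "\<And>x. x \<notin> written floor_stretch \<Longrightarrow> s1 x = s x"
    have i1: "has_input s1" using inp by (simp add: has_input_def fr)
    have z1: "s1 b = (\<lambda>_. 0)" if "b \<in> {''head'', ''del'', ''mk'', ''rem''}" for b
      using that zero[of b] fr[of b] by auto
    show "run (compute_cap ;; build ;; mark ;; collect) s1
      (30 * W + 250 * m + 600 * n * (n + m + 1) + 70) ready"
    proof (rule run_Seq[OF run_compute_cap[OF i1 1], where U="250 * m + 600 * n * (n + m + 1) + 40"])
      fix s2 assume 2: "s2 ''K'' 0 = cap" and fr: "\<And>x. x \<notin> written compute_cap \<Longrightarrow> s2 x = s1 x"
      have i2: "has_input s2" "s2 ''a'' 0 = radius" using i1 1 by (simp_all add: has_input_def fr)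
      have z2: "s2 b = (\<lambda>_. 0)" if "b \<in> {''head'', ''del'', ''mk'', ''rem''}" for b
        using that z1[of b] fr[of b] by auto
      show "run (build ;; mark ;; collect) s2 (250 * m + 600 * n * (n + m + 1) + 40) ready"
      proof (rule run_Seq[OF run_build[OF i2(1)], where U="600 * n * (n + m + 1) + 10 + (100 * m + 20)"])
        show "s2 ''head'' = (\<lambda>_. 0)" by (rule z2) simp
        fix s3 assume 3: "arcs_upto m s3" and fr: "\<And>x. x \<notin> written build \<Longrightarrow> s3 x = s2 x"
        have i3: "has_input s3" "s3 ''a'' 0 = radius" "s3 ''K'' 0 = cap"
          using i2 2 by (simp_all add: has_input_def fr)
        have z3: "s3 ''del'' = (\<lambda>_. 0)" "s3 ''mk'' = (\<lambda>_. 0)" "s3 ''rem'' = (\<lambda>_. 0)"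
          by (simp_all add: fr z2)
        show "run (mark ;; collect) s3 (600 * n * (n + m + 1) + 10 + (100 * m + 20)) ready"
        proof (rule run_Seq[OF run_mark[OF i3(1) 3 i3(2) z3], where U="100 * m + 20"])
          fix s4 assume 4: "\<forall>j<m. 0 < s4 ''rem'' j \<longleftrightarrow> removable j"
            and fr: "\<And>x. x \<notin> written mark \<Longrightarrow> s4 x = s3 x"
          have i4: "has_input s4" "s4 ''K'' 0 = cap" "s4 ''a'' 0 = radius"
            using i3 by (simp_all add: has_input_def fr)
          have a4: "arcs_upto m s4" using 3 by (rule arcs_upto_cong) (simp_all add: fr)
          show "run collect s4 (100 * m + 20) ready"
          proof (rule run_mono[OF run_collect[OF i4(1,2) 4]])
            fix s5 assume 5: "s5 ''r'' 0 = length pool \<and> (\<forall>i<length pool. s5 ''R'' i = pool ! i)"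
              and fr: "\<And>x. x \<notin> written collect \<Longrightarrow> s5 x = s4 x"
            have "arcs_upto m s5" using a4 by (rule arcs_upto_cong) (simp_all add: fr)
            then show "ready s5" using 5 i4 by (simp add: ready_def has_input_def fr)
          qed simp
        qed simp
      qed simp
    qed simp
  qed simp
qed

definition solving_time :: nat where
  "solving_time =
    (if W = 0 then 0 else if m = 0 then 0 else
       30 * radius + 30 * W + 250 * m + 600 * n * (n + m + 1) +
       length pool ^ W * (1000 * W * (n + m + 1) + 10)) + 200"

lemma run_unit_spanner_program:
  "run unit_spanner_program (input_state (encode_input I)) (solving_time + 100 * (m + 1))
    (\<lambda>s. unit_spanner_answer I (output_of s))"
proof -
  let ?s = "input_state (encode_input I)"
  let ?c = "Cond (Less target_weight (Const 1)) (''fl'' ::= Const 1)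
      (Cond (Less edge_number (Const 1)) (''fl'' ::= Const 2)
        (prepare ;; Cond (Pos (Var ''r'')) search (''fl'' ::= Const 2)))"
  have inp: "has_input ?s" by (simp add: has_input_def)
  have zero: "?s b = (\<lambda>_. 0)" if "b \<noteq> ''in''" for b using that by (auto simp: input_state_def)
  have solve: "run ?c ?s solving_time (\<lambda>s. has_input s \<and> solved s)"
  proof (rule run_Cond[where T="solving_time - 10"])
    assume "bval (Less target_weight (Const 1)) ?s"
    then have "W = 0" using inp by (simp add: has_input_header)
    then have "good {}" by (simp add: good_def)
    then show "run (''fl'' ::= Const 1) ?s (solving_time - 10) (\<lambda>s. has_input s \<and> solved s)"
      using inp zero[of "''del''"]
      by (intro run_straight) (auto simp: solving_time_def solved_def intro!: exI[of _ "{}"])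
  next
    assume "\<not> bval (Less target_weight (Const 1)) ?s"
    then have W: "0 < W" using inp by (simp add: has_input_header)
    show "run (Cond (Less edge_number (Const 1)) (''fl'' ::= Const 2)
        (prepare ;; Cond (Pos (Var ''r'')) search (''fl'' ::= Const 2))) ?s (solving_time - 10)
      (\<lambda>s. has_input s \<and> solved s)"
    proof (rule run_Cond[where T="solving_time - 20"])
      assume "bval (Less edge_number (Const 1)) ?s"
      then have "m = 0" using inp by (simp add: has_input_header)
      then have "edges I = {}" by (simp add: edges_def)
      then have "\<nexists>F. unit_spanner_solution I F" using W by (simp add: unit_spanner_solution_def)
      then show "run (''fl'' ::= Const 2) ?s (solving_time - 20) (\<lambda>s. has_input s \<and> solved s)"
        using inp by (intro run_straight) (auto simp: solving_time_def solved_def)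
    next
      assume "\<not> bval (Less edge_number (Const 1)) ?s"
      then have m: "0 < m" using inp by (simp add: has_input_header)
      show "run (prepare ;; Cond (Pos (Var ''r'')) search (''fl'' ::= Const 2)) ?s (solving_time - 20)
        (\<lambda>s. has_input s \<and> solved s)"
      proof (rule run_Seq[OF run_prepare[OF refl],
            where U="length pool ^ W * (1000 * W * (n + m + 1) + 10) + 30"])
        fix s assume r: "ready s" and fr: "\<And>x. x \<notin> written prepare \<Longrightarrow> s x = ?s x"
        have z: "s b = (\<lambda>_. 0)" if "b \<in> {''t'', ''del'', ''fl''}" for b
          using that fr[of b] zero[of b] by (auto simp: prepare_def)
        show "run (Cond (Pos (Var ''r'')) search (''fl'' ::= Const 2)) s
          (length pool ^ W * (1000 * W * (n + m + 1) + 10) + 30) (\<lambda>s. has_input s \<and> solved s)"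
        proof (rule run_Cond[where T="length pool ^ W * (1000 * W * (n + m + 1) + 10) + 10"])
          assume "bval (Pos (Var ''r'')) s"
          then have "pool \<noteq> []" using r by (auto simp: ready_def)
          then have "run search s (length pool ^ W * (1000 * W * (n + m + 1) + 10) + 10) solved"
            using run_search[OF r] z W by simp
          then show "run search s (length pool ^ W * (1000 * W * (n + m + 1) + 10) + 10)
              (\<lambda>s. has_input s \<and> solved s)"
            by (rule run_mono) (use r in \<open>auto simp: ready_def has_input_def search_def\<close>)
        next
          assume "\<not> bval (Pos (Var ''r'')) s"
          then have "pool = []" using r by (auto simp: ready_def)
          \<comment> \<open>A solution would yield a tuple whose entry 0 is a position in the empty
            pool.\<close>
          then have "\<nexists>F. unit_spanner_solution I F" using solution_imp_selection W by fastforce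
          then show "run (''fl'' ::= Const 2) s (length pool ^ W * (1000 * W * (n + m + 1) + 10) + 10)
              (\<lambda>s. has_input s \<and> solved s)"
            using r by (intro run_straight) (auto simp: solved_def ready_def)
        qed simp
      qed (use W m in \<open>simp add: solving_time_def\<close>)
    qed (simp add: solving_time_def)
  qed (simp add: solving_time_def)
  show ?thesis
    unfolding unit_spanner_program_def
  proof (rule run_Seq[OF solve, where U="100 * (m + 1)"])
    fix s assume s: "has_input s \<and> solved s"
    let ?js = "filter (\<lambda>j. s ''del'' j = 0) [0..<m]"
    have "unit_spanner_answer I (if s ''fl'' 0 = 1 then 1 # ?js else [0])"
    proof (cases "s ''fl'' 0 = 1")
      case True
      then obtain S where S: "S \<subseteq> {..<m}" "good S" "\<forall>j<m. s ''del'' j = 0 \<longleftrightarrow> j \<notin> S"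
        using s by (auto simp: solved_def)
      have "set ?js = {..<m} - S" using S(3) by auto
      then have "unit_spanner_solution I (edge_at I ` set ?js)"
        using good_imp_solution[OF S(1,2)] by metis
      then show ?thesis using True by (auto simp: unit_spanner_answer_def)
    next
      case False
      then show ?thesis using s by (auto simp: solved_def unit_spanner_answer_def)
    qed
    then show "run emit s (100 * (m + 1)) (\<lambda>s. unit_spanner_answer I (output_of s))"
      using s by (auto intro: run_mono[OF run_emit])
  qed simp
qed

end

section \<open>Running time\<close>

context spanner_instance
begin

abbreviation "\<alpha> \<equiv> real_of_rat (stretch I)"

lemma alpha_ge_1: "1 \<le> \<alpha>"
  using stretch_ge_1 by simp

lemma radius_le_alpha: "real radius \<le> \<alpha>"
  unfolding radius_eq by (rule of_nat_floor) (use alpha_ge_1 in linarith)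

text \<open>
  At most \<open>(3 * W * \<alpha>) ^ W\<close> tuples are tried. For \<open>W * \<alpha> \<ge> 3\<close> the factor \<open>3\<close> is absorbed by the
  square, otherwise \<open>W \<le> 2\<close>.
\<close>

lemma pool_power_le:
  assumes W: "0 < W"
  shows "real W * real (length pool) ^ W \<le> 9 * (real W ^ (2 * W + 1) * \<alpha> ^ (2 * W))"
proof -
  let ?y = "real W * \<alpha>"
  have "1 * 1 \<le> ?y" using W alpha_ge_1 by (intro mult_mono) auto
  then have y: "1 \<le> ?y" by simp
  have "real (length pool) \<le> real cap" by (simp add: pool_def)
  also have "\<dots> = real W * (2 * real radius + 1)" by (simp add: cap_def algebra_simps)
  also have "\<dots> \<le> real W * (3 * \<alpha>)"
  proof (rule mult_left_mono)
    show "2 * real radius + 1 \<le> 3 * \<alpha>" using radius_le_alpha alpha_ge_1 by linarith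
  qed simp
  also have "\<dots> = 3 * ?y" by simp
  finally have "real (length pool) ^ W \<le> (3 * ?y) ^ W" by (intro power_mono) auto
  also have "\<dots> \<le> 9 * ?y ^ (2 * W)"
  proof (cases "3 \<le> ?y")
    case True
    then have "3 * ?y \<le> ?y * ?y" by (intro mult_right_mono) auto
    then have "(3 * ?y) ^ W \<le> (?y * ?y) ^ W" using y by (intro power_mono) auto
    also have "\<dots> = ?y ^ (2 * W)" by (simp add: power_mult power2_eq_square)
    finally show ?thesis using zero_le_power[of ?y "2 * W"] y by linarith
  next
    case False
    have "real W * 1 \<le> ?y" using alpha_ge_1 by (intro mult_left_mono) auto
    then have "W \<le> 2" using False by linarith
    \<comment> \<open>Origin of the factor 9 in the statement.\<close>
    then have "(3::real) ^ W \<le> 3 ^ 2" by (intro power_increasing) auto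
    moreover have "?y ^ W \<le> ?y ^ (2 * W)" using y by (intro power_increasing) auto
    ultimately have "3 ^ W * ?y ^ W \<le> 9 * ?y ^ (2 * W)" using y by (intro mult_mono) auto
    then show ?thesis by (simp only: power_mult_distrib)
  qed
  finally have "real W * real (length pool) ^ W \<le> real W * (9 * ?y ^ (2 * W))"
    by (rule mult_left_mono) simp
  also have "\<dots> = 9 * (real W ^ (2 * W + 1) * \<alpha> ^ (2 * W))"
    by (simp add: power_mult_distrib)
  finally show ?thesis .
qed

lemma card_verts_edges: "card (verts I) = n" "card (edges I) = m"
  using inj_edge by (simp_all add: verts_def edges_def card_image)

lemma vertex_count_le: "n \<le> Suc m"
  using connected_card_le[OF simple connected] card_verts_edges by (simp add: verts_def)

text \<open>Building the lists, marking, collecting and printing are charged to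
  \<open>n * m\<close>, the search to \<open>X * m\<close> by \<open>pool_power_le\<close>, and the
  two arithmetic loops to \<open>X * m\<close> as well.\<close>

lemma solving_time_le: "real (solving_time + 100 * (m + 1)) \<le> 100000 * unit_spanner_bound I"
proof -
  define X where "X = real W ^ (2 * W + 1) * \<alpha> ^ (2 * W)"
  have bound: "unit_spanner_bound I = max 1 (X * real m + real n * real m)"
    by (simp add: unit_spanner_bound_def card_verts_edges X_def Let_def)
  show ?thesis
  proof (cases "m = 0")
    case True
    then show ?thesis by (simp add: solving_time_def bound)
  next
    case m: False
    have n: "1 \<le> n" using edge_ends[of 0] m by auto
    have m1: "1 \<le> m" using m by linarith
    then have nm: "m \<le> n * m" "1 \<le> n * m" using mult_le_mono[OF n, of 1 m] n by simp_all
    define P where "P = n * m"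
    have X0: "0 \<le> X" using alpha_ge_1 by (simp add: X_def)
    show ?thesis
    proof (cases "W = 0")
      case True
      have "solving_time = 200" using True by (simp add: solving_time_def)
      then have "solving_time + 100 * (m + 1) \<le> 100000 * (n * m)"
        using nm unfolding P_def[symmetric] by simp
      then have "real (solving_time + 100 * (m + 1)) \<le> 100000 * (real n * real m)"
        by (metis of_nat_le_iff of_nat_mult of_nat_numeral)
      also have "real n * real m \<le> X * real m + real n * real m" using X0 by simp
      also have "\<dots> \<le> unit_spanner_bound I" by (simp add: bound)
      finally show ?thesis by simp
    next
      case False
      then have W: "1 \<le> W" by simp
      have W_le: "real W \<le> real W ^ (2 * W + 1)"
        using W by (intro self_le_power) auto
      have "\<alpha> \<le> \<alpha> ^ (2 * W)" using W alpha_ge_1 by (intro self_le_power) auto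
      \<comment> \<open>All exponents in \<open>X\<close> are at least 1 here, so \<open>X\<close>
        dominates both \<open>W\<close> and \<open>radius\<close>, the round numbers of the
        arithmetic loops.\<close>
      then have "real W * \<alpha> \<le> X" unfolding X_def using W_le alpha_ge_1 by (intro mult_mono) auto
      moreover have "real W * 1 \<le> real W * \<alpha>" using alpha_ge_1 by (intro mult_left_mono) auto
      moreover have "1 * \<alpha> \<le> real W * \<alpha>" using W alpha_ge_1 by (intro mult_right_mono) auto
      ultimately have WX: "real W \<le> X" "real radius \<le> X" using radius_le_alpha by linarith+
      have "X * 1 \<le> X * real m" using X0 m1 by (intro mult_left_mono) auto
      then have Xm: "X \<le> X * real m" by simp
      have "0 < W" using W by simp
      from pool_power_le[OF this] have "real W * real (length pool) ^ W \<le> 9 * X"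
        by (simp only: X_def)
      moreover have "real radius \<le> X * real m" "real W \<le> X * real m" using WX Xm by linarith+
      ultimately have terms: "real radius \<le> X * real m" "real W \<le> X * real m"
        "real W * real (length pool) ^ W \<le> 9 * X" by blast+
      \<comment> \<open>Connectivity gives \<open>n \<le> m + 1\<close>, so the cost of a search is
        linear in \<open>m\<close> alone, as the first summand of the bound demands.\<close>
      have le: "n + m + 1 \<le> 4 * m" using vertex_count_le m1 by linarith
      then have size1: "600 * n * (n + m + 1) \<le> 600 * n * (4 * m)" by (rule mult_le_mono2)
      have "1000 * W * (n + m + 1) \<le> 1000 * W * (4 * m)" using le by (rule mult_le_mono2)
      moreover have "10 * (1 * 1) \<le> 10 * (W * m)" using W m1 by (intro mult_le_mono) auto
      ultimately have "1000 * W * (n + m + 1) + 10 * (1 * 1) \<le> 1000 * W * (4 * m) + 10 * (W * m)"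
        by (rule add_mono)
      then have size2: "1000 * W * (n + m + 1) + 10 \<le> 4010 * W * m" by simp
      have "length pool ^ W * (1000 * W * (n + m + 1) + 10) \<le> length pool ^ W * (4010 * W * m)"
        using size2 by (rule mult_left_mono) simp
      then have "solving_time + 100 * (m + 1) \<le> 30 * radius + 30 * W + 250 * m + 2400 * (n * m) +
          4010 * (W * length pool ^ W * m) + 200 + 100 * (m + 1)"
        using size1 m W by (simp add: solving_time_def algebra_simps)
      \<comment> \<open>From \<open>1 \<le> m \<le> n * m\<close>: the coefficients 250, 2400, 200
        and twice 100 add up to 3050.\<close>
      also have "\<dots> \<le> 30 * radius + 30 * W + 3050 * (n * m) + 4010 * (W * length pool ^ W * m)"
        using nm unfolding P_def[symmetric] by simp
      finally have "real (solving_time + 100 * (m + 1)) \<le>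
          real (30 * radius + 30 * W + 3050 * (n * m) + 4010 * (W * length pool ^ W * m))"
        by (rule of_nat_mono)
      also have "\<dots> = 30 * real radius + 30 * real W + 3050 * (real n * real m) +
          4010 * ((real W * real (length pool) ^ W) * real m)" by simp
      also have "\<dots> \<le> 30 * (X * real m) + 30 * (X * real m) + 3050 * (real n * real m) +
          4010 * ((9 * X) * real m)"
        using terms by (intro add_mono mult_left_mono mult_right_mono order_refl) simp_all
      also have "\<dots> \<le> 100000 * (X * real m + real n * real m)"
        using X0 by (simp add: algebra_simps)
      also have "\<dots> \<le> 100000 * unit_spanner_bound I"
        unfolding bound by (rule mult_left_mono) simp_all
      finally show ?thesis .
    qed
  qed
qed

end

section \<open>The parameter function\<close>

text \<open>An iterated power of two is computable by two doubling loops without multiplication.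
  Reading the arguments through \<open>input_state\<close> gives missing list entries the value 0,
  which is what the program finds in its memory.\<close>

definition param_bound :: "nat list \<Rightarrow> nat" where
  "param_bound xs = (let s = input_state xs in
     2 ^ 2 ^ (2 * (s ''in'' 1 + s ''in'' 2) + 3))"

text \<open>For \<open>computable\<close> only halting matters, so the time of the second program
  may depend on the intermediate state.\<close>

lemma ex_run_Seq:
  assumes "run c s T Q"
    and "\<And>s'. Q s' \<Longrightarrow> (\<And>x. x \<notin> written c \<Longrightarrow> s' x = s x) \<Longrightarrow> \<exists>T. run d s' T R"
  shows "\<exists>T. run (Seq c d) s T R"
proof -
  obtain t s' where 1: "exec c s t s'" "Q s'" using assms(1) unfolding run_def by blast
  then obtain u s'' where "exec d s' u s''" "R s''"
    using assms(2)[OF 1(2) exec_frame[OF 1(1)]] unfolding run_def by blast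
  then show ?thesis using exec.Seq[OF 1(1)] unfolding run_def by blast
qed

lemma run_double:
  assumes "x \<noteq> y" "s x 0 = 1" "\<And>s'. (\<And>z. z \<noteq> x \<Longrightarrow> z \<noteq> y \<Longrightarrow> s' z = s z) \<Longrightarrow> aval l s' = N"
  shows "run (For y l (x ::= Plus (Var x) (Var x))) s (N * (acost l + 30) + acost l + 30)
    (\<lambda>s'. s' x 0 = 2 ^ N)"
proof (rule run_For[where N=N and B=20 and
      I="\<lambda>k s'. s' x 0 = 2 ^ k \<and> (\<forall>z. z \<noteq> x \<longrightarrow> z \<noteq> y \<longrightarrow> s' z = s z)"], goal_cases)
  case (2 k s')
  then show ?case using assms(1) by (intro run_straight) auto
qed (use assms in \<open>auto simp: algebra_simps\<close>)

lemma computable_param_bound: "computable param_bound"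
proof -
  let ?e = "Plus (Cell ''in'' (Const 1)) (Cell ''in'' (Const 2))"
  let ?N = "Plus (Plus ?e ?e) (Const 3)"
  let ?dbl = "\<lambda>x l. For ''i'' l (x ::= Plus (Var x) (Var x))"
  let ?fin = "Assign ''out'' (Const 1) (Var ''y'') ;; ''out'' ::= Const 1"
  let ?c = "(''z'' ::= Const 1 ;; ''y'' ::= Const 1) ;; ?dbl ''z'' ?N ;; ?dbl ''y'' (Var ''z'') ;; ?fin"
  have "\<exists>t. runs ?c xs t [param_bound xs]" for xs
  proof -
    let ?s = "input_state xs"
    let ?k = "2 * (?s ''in'' 1 + ?s ''in'' 2) + 3"
    have fin: "run ?fin s 20 (\<lambda>s'. output_of s' = [s ''y'' 0])" for s
      by (intro run_straight) (auto simp: output_of_def)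
    have init: "run (''z'' ::= Const 1 ;; ''y'' ::= Const 1) ?s 20 (\<lambda>s'. s' ''z'' 0 = 1 \<and> s' ''y'' 0 = 1)"
      by (intro run_straight) auto
    have "\<exists>T. run ?c ?s T (\<lambda>s'. output_of s' = [param_bound xs])"
    proof (rule ex_run_Seq[OF init])
      fix s1 assume 1: "s1 ''z'' 0 = 1 \<and> s1 ''y'' 0 = 1"
        and fr1: "\<And>x. x \<notin> written (''z'' ::= Const 1 ;; ''y'' ::= Const 1) \<Longrightarrow> s1 x = ?s x"
      show "\<exists>T. run (?dbl ''z'' ?N ;; ?dbl ''y'' (Var ''z'') ;; ?fin) s1 T
          (\<lambda>s'. output_of s' = [param_bound xs])"
      proof (rule ex_run_Seq[OF run_double[where N="?k"]])
        fix s' assume "\<And>z. z \<noteq> ''z'' \<Longrightarrow> z \<noteq> ''i'' \<Longrightarrow> s' z = s1 z"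
        then have "s' ''in'' = ?s ''in''" using fr1[of "''in''"] by simp
        then show "aval ?N s' = ?k" by simp
      next
        fix s2 assume 2: "s2 ''z'' 0 = 2 ^ ?k"
          and fr2: "\<And>x. x \<notin> written (?dbl ''z'' ?N) \<Longrightarrow> s2 x = s1 x"
        show "\<exists>T. run (?dbl ''y'' (Var ''z'') ;; ?fin) s2 T (\<lambda>s'. output_of s' = [param_bound xs])"
        proof (rule ex_run_Seq[OF run_double[where N="2 ^ ?k"]])
          fix s3 :: state assume "s3 ''y'' 0 = 2 ^ 2 ^ ?k"
          then have "s3 ''y'' 0 = param_bound xs" by (simp add: param_bound_def Let_def)
          then show "\<exists>T. run ?fin s3 T (\<lambda>s'. output_of s' = [param_bound xs])"
            using fin[of s3] by auto
        qed (use 1 2 fr2[of "''y''"] in auto)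
      qed (use 1 in auto)
    qed
    then show ?thesis unfolding run_def runs_def by blast
  qed
  then show ?thesis unfolding computable_def by blast
qed

context spanner_instance
begin

lemma param_bound_ge: "real W ^ (2 * W + 1) * \<alpha> ^ (2 * W) \<le> real (param_bound (parameters I))"
proof -
  let ?N = "W + num"
  have par: "parameters I = [W, num, den]"
    by (simp add: parameters_def encode_stretch_def quotient(1))
  have f: "param_bound (parameters I) = 2 ^ 2 ^ (2 * ?N + 3)"
    by (simp add: param_bound_def par input_state_def)
  have "\<alpha> \<le> real num"
  proof -
    have "stretch I = of_int (int num) / of_int (int den)" using quotient(1) quotient_of_div by blast
    then have "\<alpha> = real num / real den" by (simp add: of_rat_divide)
    also have "\<dots> \<le> real num / 1" using quotient(2) by (intro divide_left_mono) auto
    finally show ?thesis by simp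
  qed
  also have "\<dots> \<le> 2 ^ num" using less_exp[of num] by (metis less_imp_le of_nat_le_iff of_nat_numeral of_nat_power)
  finally have "\<alpha> ^ (2 * W) \<le> (2 ^ num) ^ (2 * W)" using alpha_ge_1 by (intro power_mono) auto
  moreover have "real W \<le> 2 ^ W" using less_exp[of W] by (metis less_imp_le of_nat_le_iff of_nat_numeral of_nat_power)
  then have "real W ^ (2 * W + 1) \<le> (2 ^ W) ^ (2 * W + 1)" by (intro power_mono) auto
  ultimately have "real W ^ (2 * W + 1) * \<alpha> ^ (2 * W) \<le> (2 ^ W) ^ (2 * W + 1) * (2 ^ num) ^ (2 * W)"
    using alpha_ge_1 by (intro mult_mono) auto
  also have "\<dots> = (2::real) ^ (W * (2 * W + 1) + num * (2 * W))"
    by (simp only: power_mult power_add)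
  also have "\<dots> \<le> 2 ^ 2 ^ (2 * ?N + 3)"
  proof (rule power_increasing)
    \<comment> \<open>The exponent is quadratic in \<open>?N\<close>; from
      \<open>?N \<le> 2 ^ ?N\<close> and \<open>3 \<le> 2 ^ 3\<close> comes the inner exponent
      \<open>2 * ?N + 3\<close> of \<open>param_bound\<close>.\<close>
    have "W * (2 * W + 1) + num * (2 * W) \<le> 3 * (?N * ?N)"
      by (simp add: algebra_simps) (rule trans_le_add1[OF le_square])
    also have "\<dots> \<le> 8 * (2 ^ ?N * 2 ^ ?N)"
      using less_imp_le[OF less_exp[of ?N]] by (intro mult_le_mono) simp_all
    also have "\<dots> = 2 ^ (?N + ?N + 3)" by (simp only: power_add) simp
    also have "?N + ?N + 3 = 2 * ?N + 3" by simp
    finally show "W * (2 * W + 1) + num * (2 * W) \<le> 2 ^ (2 * ?N + 3)" .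
  qed simp
  finally show ?thesis by (simp add: f)
qed

lemma edge_number_le: "m + 1 \<le> encoding_length (encode_input I)"
proof -
  have "length xs \<le> encoding_length xs" for xs
    by (induction xs) (auto simp: encoding_length_def)
  from this[of "encode_input I"] show ?thesis
    by (simp add: encode_input_eq length_concat_triples)
qed

end

theorem corollary5:
  shows "\<exists>c :: com.
    (\<exists>C :: real. \<forall>I\<in>unit_spanner_inputs. \<exists>t ys.
       runs c (encode_input I) t ys \<and> unit_spanner_answer I ys \<and>
       real t \<le> C * unit_spanner_bound I) \<and>
    fpt unit_spanner_inputs encode_input parameters c"
proof (intro exI conjI)
  have main: "\<exists>t ys. runs unit_spanner_program (encode_input I) t ys \<and> unit_spanner_answer I ys \<and>
      real t \<le> 100000 * unit_spanner_bound I" if "I \<in> unit_spanner_inputs" for I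
  proof -
    interpret spanner_instance I using that by unfold_locales
    obtain t s where "exec unit_spanner_program (input_state (encode_input I)) t s"
      "t \<le> solving_time + 100 * (m + 1)" "unit_spanner_answer I (output_of s)"
      using run_unit_spanner_program unfolding run_def by blast
    moreover from this(2) have "real t \<le> 100000 * unit_spanner_bound I"
      using solving_time_le by linarith
    ultimately show ?thesis unfolding runs_def by blast
  qed
  then show "\<forall>I\<in>unit_spanner_inputs. \<exists>t ys. runs unit_spanner_program (encode_input I) t ys \<and>
      unit_spanner_answer I ys \<and> real t \<le> 100000 * unit_spanner_bound I" by blast
  show "fpt unit_spanner_inputs encode_input parameters unit_spanner_program"
    unfolding fpt_def
  \<comment> \<open>In \<open>1 + x + x ^ 2\<close> the summands pay for the lower limit 1 of the
    bound, for the factor \<open>m\<close> and for \<open>n * m\<close>.\<close>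
  proof (rule exI[of _ param_bound], rule exI[of _ "[:1, 1, 1:]"], rule exI[of _ 100000],
      intro conjI ballI)
    show "computable param_bound" by (rule computable_param_bound)
    fix I assume I: "I \<in> unit_spanner_inputs"
    interpret spanner_instance I using I by unfold_locales
    let ?L = "encoding_length (encode_input I)" and ?f = "param_bound (parameters I)"
    from main[OF I] obtain t ys where t: "runs unit_spanner_program (encode_input I) t ys"
      "real t \<le> 100000 * unit_spanner_bound I" by blast
    have f: "1 \<le> ?f" by (simp add: param_bound_def Let_def)
    \<comment> \<open>Every listed edge contributes to the encoding length, whereas \<open>n\<close>
      itself is measured by its number of bits; it is bounded through connectivity, by
      \<open>vertex_count_le\<close>.\<close>
    have L: "m \<le> ?L" "n \<le> ?L" using edge_number_le vertex_count_le by simp_all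
    have "unit_spanner_bound I \<le> real (?f * (1 + ?L * (1 + ?L)))"
    proof -
      have "real W ^ (2 * W + 1) * \<alpha> ^ (2 * W) * real m \<le> real ?f * real ?L"
        using param_bound_ge L(1) alpha_ge_1 by (intro mult_mono) auto
      moreover have "real n * real m \<le> real ?L * real ?L" using L by (intro mult_mono) auto
      moreover have "1 * (real ?L * real ?L) \<le> real ?f * (real ?L * real ?L)"
        using f by (intro mult_right_mono) auto
      moreover have "1 \<le> real ?f" "0 \<le> real ?f * real ?L" "0 \<le> real ?f * (real ?L * real ?L)"
        using f by simp_all
      ultimately have "max 1 (real W ^ (2 * W + 1) * \<alpha> ^ (2 * W) * real m + real n * real m) \<le>
          real ?f + real ?f * real ?L + real ?f * (real ?L * real ?L)"
        by (intro max.boundedI) linarith+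
      then show ?thesis
        by (simp only: unit_spanner_bound_def Let_def card_verts_edges) (simp add: algebra_simps)
    qed
    also have "1 + ?L * (1 + ?L) = poly [:1, 1, 1:] ?L" by simp
    finally have "real t \<le> real (100000 * (?f * poly [:1, 1, 1:] ?L))"
      using t(2) by simp
    then have "t \<le> 100000 * (?f * poly [:1, 1, 1:] ?L)" by (simp only: of_nat_le_iff)
    then show "\<exists>t ys. runs unit_spanner_program (encode_input I) t ys \<and>
        t \<le> 100000 * (?f * poly [:1, 1, 1:] ?L)" using t(1) by blast
  qed
qed

end
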